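(* Let $R$ be a ring, $\mu$ an infinite regular cardinal, $\mathcal{K}=(\mathbf{K},\preccurlyeq)$ a $\mu$-AEC of $R$-modules, and $\kappa$ an infinite cardinal with $\kappa=\kappa^{<\mu}+\mathrm{LS}_\mu(\mathcal{K})$. If $\mathcal{K}$ is $\kappa$-tame and $\preccurlyeq$ is $\kappa$-syntactic on $\mathbf{K}$, then there is a cardinal $\xi\geq\kappa$ such that $\mathcal{K}$ is almost $\lambda$-stable for every $\lambda=\lambda^{\xi}$. In particular, $\mathcal{K}$ is almost stable, and if $\mathcal{K}$ has $\infty$-AP, then it is stable.
   Context: $R$ is an associative ring with identity; modules are unital left modules. The language of $R$-modules has symbols $0,+,-$ and a unary function symbol for each $r\in R$. Abstract classes. An abstract class (AC) is a pair $\mathcal{K}=(\mathbf{K},\preccurlyeq)$ where $\mathbf{K}$ is a non-empty class of structures in a fixed language $\tau=\tau_{\mathcal{K}}$ and $\preccurlyeq$ is a reflexive transitive relation on $\mathbf{K}$ such that $M\preccurlyeq N$ implies $M\leq N$ ($M$ is a substructure of $N$), closed under isomorphism: if $f:N\to N'$ is an isomorphism and $N\in\mathbf{K}$ then $N'\in\mathbf{K}$, and if moreover $M\in\mathbf{K}$ and $M\preccurlyeq N$ then $f(M)\in\mathbf{K}$ and $f(M)\preccurlyeq N'$. It is an AC of $R$-modules if $\tau$ is the language of $R$-modules and $\mathbf{K}$ is a class of $R$-modules. A $\mathcal{K}$-embedding is an embedding $f:M\to N$ with $M,N\in\mathbf{K}$ and $f(M)\preccurlyeq N$. $\mu$-AECs.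 A poset is $\mu$-directed if each subset of cardinality $<\mu$ has an upper bound. A $\mu$-directed system in $\mathcal{K}$ is a family $(M_i\mid i\in I)$ of members of $\mathbf{K}$ with $I$ a $\mu$-directed poset and $M_i\preccurlyeq M_j$ whenever $i<j$. An AC $\mathcal{K}$ is a $\mu$-AEC if: (coherence) $M_0,M_1,M_2\in\mathbf{K}$, $M_0\preccurlyeq M_2$ and $M_0\leq M_1\preccurlyeq M_2$ imply $M_0\preccurlyeq M_1$; ($\mu$-continuity) for each $\mu$-directed system $(M_i)_{i\in I}$ in $\mathcal{K}$, $M=\bigcup_i M_i\in\mathbf{K}$ and $M_i\preccurlyeq M$ for all $i$; ($\mu$-smoothness) if $N\in\mathbf{K}$ and $(M_i)_{i\in I}$ is a $\mu$-directed system in $\mathcal{K}$ with all $M_i\preccurlyeq N$ and $M=\bigcup_i M_i\in\mathbf{K}$, then $M\preccurlyeq N$; (Löwenheim-Skolem) there is a cardinal $\theta=\theta^{<\mu}\geq|\tau|+\mu$ such that for all $M\in\mathbf{K}$ and $A\subseteq M$ there is $M_0\in\mathbf{K}$ with $A\subseteq M_0\preccurlyeq M$ and $|M_0|\leq|A|^{<\mu}+\theta$. The least such $\theta$ is $\mathrm{LS}_\mu(\mathcal{K})$. Here $\theta^{<\mu}=\sup\{\theta^{\eta}\mid\eta<\mu\}$. Orbital types. For triples $(b_\ell,A,N_\ell)$ with $A\subseteq N_\ell\in\mathbf{K}$ and $b_\ell\in N_\ell$ ($\ell=1,2$), put $(b_1,A,N_1)E^{\mathrm{at}}(b_2,A,N_2)$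 if there are $\mathcal{K}$-embeddings $f_\ell:N_\ell\to N$ with $f_1(b_1)=f_2(b_2)$ and $f_1\restriction A=f_2\restriction A=\mathrm{id}_A$; let $E$ be the transitive closure of $E^{\mathrm{at}}$, and let $\mathrm{ortp}(b/A;N)$ be the $E$-class of $(b,A,N)$. If $p=\mathrm{ortp}(b/A;N)$ and $B\subseteq A$, then $p\restriction B=\mathrm{ortp}(b/B;N)$ (well defined). For $M\preccurlyeq N$ let $\mathcal{S}(M;N)=\{\mathrm{ortp}(c/M;N)\mid c\in N\}$ and $\mathcal{S}(M)=\bigcup_{M\preccurlyeq N\in\mathbf{K}}\mathcal{S}(M;N)$. Tameness and stability. $\mathcal{K}$ is $\kappa$-tame if for all $M\in\mathbf{K}$ and distinct $p,q\in\mathcal{S}(M)$ there is $M_0\in\mathbf{K}$ with $M_0\preccurlyeq M$, $|M_0|\leq\kappa$ and $p\restriction M_0\neq q\restriction M_0$. $\mathcal{K}$ is $\lambda$-stable if $|\mathcal{S}(M)|\leq\lambda$ for each $M\in\mathbf{K}$ with $|M|=\lambda$; it is almost $\lambda$-stable if $|\mathcal{S}(M;N)|\leq\lambda$ for all $M\preccurlyeq N$ in $\mathbf{K}$ with $|M|=\lambda$. It is (almost) stable if it is (almost) $\lambda$-stable for unboundedly many infinite cardinals $\lambda$. Amalgamation. $\mathcal{K}$ has $\infty$-AP if for every (set-indexed) collection of $\mathcal{K}$-embeddings $(f_i:M\to M_i\mid i\in I)$ there are $N\in\mathbf{K}$ and $\mathcal{K}$-embeddings $g_i:M_i\to N$ with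 $g_if_i=g_jf_j$ for all $i,j\in I$. Syntacticity. For regular $\nu_0\geq\nu_1$, $\mathfrak{L}_{\nu_0,\nu_1}(\tau)$ is the infinitary logic containing the atomic formulas, closed under negation, conjunctions and disjunctions of $<\nu_0$ formulas, and quantification over $<\nu_1$ variables, all formulas having $<\nu_1$ free variables. For an infinite cardinal $\kappa\geq|\tau|$, $\preccurlyeq$ is $\kappa$-syntactic on $\mathbf{K}$ if there are infinite regular cardinals $\nu_0\geq\nu_1\geq\kappa^+$ and a formula $\varphi(\bar{x})\in\mathfrak{L}_{\nu_0,\nu_1}(\tau)$ with $|\bar{x}|=\kappa$ such that for every $N\in\mathbf{K}$ and $\bar{a}\in N^{\kappa}$ such that the set of entries of $\bar{a}$ is the domain of a substructure $N\restriction\bar{a}$ of $N$: ($N\restriction\bar{a}\in\mathbf{K}$ and $N\restriction\bar{a}\preccurlyeq N$) if and only if $N\vDash\varphi(\bar{a})$. *)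

theory Defs
  imports "HOL-Algebra.Module"
begin

unbundle cardinal_syntax

(* Set-theoretic background.  HOL has no proper classes, so the universe of sets is represented by a
   type 'u whose cardinality is strongly inaccessible.  The role of sets is played by the small
   subsets of 'u (every set of a Grothendieck universe of that size is equinumerous to one of them),
   the role of cardinals by the small cardinal orders on 'u, and a class of structures is an
   arbitrary set of structures with small carriers contained in 'u. *)

definition strongly_inaccessible :: "'u rel \<Rightarrow> bool" where
  "strongly_inaccessible k \<longleftrightarrow>
     Card_order k \<and> natLeq <o k \<and> regularCard k \<and> (\<forall>A :: 'u set. |A| <o k \<longrightarrow> |Pow A| <o k)"

definition small :: "'u set \<Rightarrow> bool" where
  "small A \<longleftrightarrow> |A| <o |UNIV :: 'u set|"

definition small_card :: "'u rel \<Rightarrow> bool" where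
  "small_card r \<longleftrightarrow> Card_order r \<and> r <o |UNIV :: 'u set|"

(* r^{<m}, the supremum of r^e over the cardinals e < m.  A supremum of cardinals is a least upper
   bound, hence determined only up to =o. *)
definition powlt_bound :: "'u rel \<Rightarrow> 'u rel \<Rightarrow> 'u rel \<Rightarrow> bool" where
  "powlt_bound r m c \<longleftrightarrow>
     Card_order c \<and> (\<forall>e :: 'u rel. Card_order e \<and> e <o m \<longrightarrow> r ^c e \<le>o c)"

definition powlt :: "'u rel \<Rightarrow> 'u rel \<Rightarrow> 'u rel" where
  "powlt r m = (SOME c. powlt_bound r m c \<and> (\<forall>d. powlt_bound r m d \<longrightarrow> c \<le>o d))"


(* The library locale module requires a commutative ring of scalars. *)
locale left_module = R?: ring R + M?: abelian_group M for R (structure) and M (structure) +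
  assumes smult_closed:
      "\<lbrakk>a \<in> carrier R; x \<in> carrier M\<rbrakk> \<Longrightarrow> a \<odot>\<^bsub>M\<^esub> x \<in> carrier M"
    and smult_l_distr:
      "\<lbrakk>a \<in> carrier R; b \<in> carrier R; x \<in> carrier M\<rbrakk> \<Longrightarrow>
        (a \<oplus> b) \<odot>\<^bsub>M\<^esub> x = a \<odot>\<^bsub>M\<^esub> x \<oplus>\<^bsub>M\<^esub> b \<odot>\<^bsub>M\<^esub> x"
    and smult_r_distr:
      "\<lbrakk>a \<in> carrier R; x \<in> carrier M; y \<in> carrier M\<rbrakk> \<Longrightarrow>
        a \<odot>\<^bsub>M\<^esub> (x \<oplus>\<^bsub>M\<^esub> y) = a \<odot>\<^bsub>M\<^esub> x \<oplus>\<^bsub>M\<^esub> a \<odot>\<^bsub>M\<^esub> y"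
    and smult_assoc1:
      "\<lbrakk>a \<in> carrier R; b \<in> carrier R; x \<in> carrier M\<rbrakk> \<Longrightarrow>
        (a \<otimes> b) \<odot>\<^bsub>M\<^esub> x = a \<odot>\<^bsub>M\<^esub> (b \<odot>\<^bsub>M\<^esub> x)"
    and smult_one:
      "x \<in> carrier M \<Longrightarrow> \<one> \<odot>\<^bsub>M\<^esub> x = x"

datatype 'r mod_symbol = SZero | SPlus | SMinus | SScalar 'r

definition mod_language :: "('r, 'm) ring_scheme \<Rightarrow> 'r mod_symbol set" where
  "mod_language R = {SZero, SPlus, SMinus} \<union> SScalar ` carrier R"

(* Records may differ in irrelevant fields or outside the carrier and still denote the same
   structure.  Substructures, isomorphisms and unions below only depend on the denoted structure. *)

definition substructure ::
    "('r, 'm) ring_scheme \<Rightarrow> ('r, 'u) module \<Rightarrow> ('r, 'u) module \<Rightarrow> bool" where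
  "substructure R M N \<longleftrightarrow>
     carrier M \<subseteq> carrier N \<and>
     \<zero>\<^bsub>M\<^esub> = \<zero>\<^bsub>N\<^esub> \<and>
     (\<forall>x\<in>carrier M. \<forall>y\<in>carrier M. x \<oplus>\<^bsub>M\<^esub> y = x \<oplus>\<^bsub>N\<^esub> y) \<and>
     (\<forall>x\<in>carrier M. \<ominus>\<^bsub>M\<^esub> x = \<ominus>\<^bsub>N\<^esub> x) \<and>
     (\<forall>r\<in>carrier R. \<forall>x\<in>carrier M. r \<odot>\<^bsub>M\<^esub> x = r \<odot>\<^bsub>N\<^esub> x)"

definition mod_embedding ::
    "('r, 'm) ring_scheme \<Rightarrow> ('u \<Rightarrow> 'u) \<Rightarrow> ('r, 'u) module \<Rightarrow> ('r, 'u) module \<Rightarrow> bool" where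
  "mod_embedding R f M N \<longleftrightarrow>
     f ` carrier M \<subseteq> carrier N \<and> inj_on f (carrier M) \<and>
     f \<zero>\<^bsub>M\<^esub> = \<zero>\<^bsub>N\<^esub> \<and>
     (\<forall>x\<in>carrier M. \<forall>y\<in>carrier M. f (x \<oplus>\<^bsub>M\<^esub> y) = f x \<oplus>\<^bsub>N\<^esub> f y) \<and>
     (\<forall>x\<in>carrier M. f (\<ominus>\<^bsub>M\<^esub> x) = \<ominus>\<^bsub>N\<^esub> f x) \<and>
     (\<forall>r\<in>carrier R. \<forall>x\<in>carrier M. f (r \<odot>\<^bsub>M\<^esub> x) = r \<odot>\<^bsub>N\<^esub> f x)"

definition mod_isomorphism ::
    "('r, 'm) ring_scheme \<Rightarrow> ('u \<Rightarrow> 'u) \<Rightarrow> ('r, 'u) module \<Rightarrow> ('r, 'u) module \<Rightarrow> bool" where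
  "mod_isomorphism R f M N \<longleftrightarrow> mod_embedding R f M N \<and> f ` carrier M = carrier N"

(* In the last clause M' ranges over all records denoting the structure f(M); in particular sub
   respects equality of denoted structures. *)
definition abstract_class ::
    "('r, 'm) ring_scheme \<Rightarrow> ('r, 'u) module set \<Rightarrow>
     (('r, 'u) module \<Rightarrow> ('r, 'u) module \<Rightarrow> bool) \<Rightarrow> bool" where
  "abstract_class R K sub \<longleftrightarrow>
     K \<noteq> {} \<and>
     (\<forall>M\<in>K. left_module R M \<and> small (carrier M)) \<and>
     (\<forall>M N. sub M N \<longrightarrow> M \<in> K \<and> N \<in> K \<and> substructure R M N) \<and>
     (\<forall>M\<in>K. sub M M) \<and>
     (\<forall>M N P. sub M N \<and> sub N P \<longrightarrow> sub M P) \<and>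
     (\<forall>N\<in>K. \<forall>N' f. mod_isomorphism R f N N' \<longrightarrow>
        N' \<in> K \<and>
        (\<forall>M M'. sub M N \<and> substructure R M' N' \<and> carrier M' = f ` carrier M \<longrightarrow>
           M' \<in> K \<and> sub M' N'))"

definition K_embedding ::
    "('r, 'm) ring_scheme \<Rightarrow> ('r, 'u) module set \<Rightarrow>
     (('r, 'u) module \<Rightarrow> ('r, 'u) module \<Rightarrow> bool) \<Rightarrow>
     ('u \<Rightarrow> 'u) \<Rightarrow> ('r, 'u) module \<Rightarrow> ('r, 'u) module \<Rightarrow> bool" where
  "K_embedding R K sub f M N \<longleftrightarrow>
     M \<in> K \<and> N \<in> K \<and> mod_embedding R f M N \<and> sub (N\<lparr>carrier := f ` carrier M\<rparr>) N"


definition mu_directed_poset :: "'u rel \<Rightarrow> 'u set \<Rightarrow> 'u rel \<Rightarrow> bool" where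
  "mu_directed_poset \<mu> I r \<longleftrightarrow>
     partial_order_on I r \<and> (\<forall>X\<subseteq>I. |X| <o \<mu> \<longrightarrow> (\<exists>j\<in>I. \<forall>i\<in>X. (i, j) \<in> r))"

definition mu_directed_system ::
    "'u rel \<Rightarrow> ('r, 'u) module set \<Rightarrow> (('r, 'u) module \<Rightarrow> ('r, 'u) module \<Rightarrow> bool) \<Rightarrow>
     'u set \<Rightarrow> 'u rel \<Rightarrow> ('u \<Rightarrow> ('r, 'u) module) \<Rightarrow> bool" where
  "mu_directed_system \<mu> K sub I r Mi \<longleftrightarrow>
     small I \<and> mu_directed_poset \<mu> I r \<and> (\<forall>i\<in>I. Mi i \<in> K) \<and>
     (\<forall>i\<in>I. \<forall>j\<in>I. (i, j) \<in> r \<and> i \<noteq> j \<longrightarrow> sub (Mi i) (Mi j))"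

definition is_union ::
    "('r, 'm) ring_scheme \<Rightarrow> 'u set \<Rightarrow> ('u \<Rightarrow> ('r, 'u) module) \<Rightarrow> ('r, 'u) module \<Rightarrow> bool" where
  "is_union R I Mi M \<longleftrightarrow>
     carrier M = (\<Union>i\<in>I. carrier (Mi i)) \<and> (\<forall>i\<in>I. substructure R (Mi i) M)"

definition LS_witness ::
    "('r, 'm) ring_scheme \<Rightarrow> 'u rel \<Rightarrow> ('r, 'u) module set \<Rightarrow>
     (('r, 'u) module \<Rightarrow> ('r, 'u) module \<Rightarrow> bool) \<Rightarrow> 'u rel \<Rightarrow> bool" where
  "LS_witness R \<mu> K sub \<theta> \<longleftrightarrow>
     small_card \<theta> \<and> \<theta> =o powlt \<theta> \<mu> \<and> |mod_language R| +c \<mu> \<le>o \<theta> \<and>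
     (\<forall>M\<in>K. \<forall>A\<subseteq>carrier M. \<exists>M0\<in>K.
        A \<subseteq> carrier M0 \<and> sub M0 M \<and> |carrier M0| \<le>o powlt |A| \<mu> +c \<theta>)"

definition LS_number ::
    "('r, 'm) ring_scheme \<Rightarrow> 'u rel \<Rightarrow> ('r, 'u) module set \<Rightarrow>
     (('r, 'u) module \<Rightarrow> ('r, 'u) module \<Rightarrow> bool) \<Rightarrow> 'u rel" where
  "LS_number R \<mu> K sub =
     (SOME \<theta>. LS_witness R \<mu> K sub \<theta> \<and> (\<forall>\<theta>'. LS_witness R \<mu> K sub \<theta>' \<longrightarrow> \<theta> \<le>o \<theta>'))"

definition mu_AEC ::
    "('r, 'm) ring_scheme \<Rightarrow> 'u rel \<Rightarrow> ('r, 'u) module set \<Rightarrow>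
     (('r, 'u) module \<Rightarrow> ('r, 'u) module \<Rightarrow> bool) \<Rightarrow> bool" where
  "mu_AEC R \<mu> K sub \<longleftrightarrow>
     abstract_class R K sub \<and>
     (\<forall>M0\<in>K. \<forall>M1\<in>K. \<forall>M2\<in>K.
        sub M0 M2 \<and> substructure R M0 M1 \<and> sub M1 M2 \<longrightarrow> sub M0 M1) \<and>
     (\<forall>I r Mi M. mu_directed_system \<mu> K sub I r Mi \<and> is_union R I Mi M \<longrightarrow>
        M \<in> K \<and> (\<forall>i\<in>I. sub (Mi i) M)) \<and>
     (\<forall>I r Mi. \<forall>M\<in>K. \<forall>N\<in>K.
        mu_directed_system \<mu> K sub I r Mi \<and> (\<forall>i\<in>I. sub (Mi i) N) \<and> is_union R I Mi M \<longrightarrow>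
        sub M N) \<and>
     (\<exists>\<theta>. LS_witness R \<mu> K sub \<theta>)"


type_synonym ('r, 'u) type_triple = "'u \<times> 'u set \<times> ('r, 'u) module"

definition type_triples :: "('r, 'u) module set \<Rightarrow> ('r, 'u) type_triple set" where
  "type_triples K = {(b, A, N). N \<in> K \<and> A \<subseteq> carrier N \<and> b \<in> carrier N}"

definition E_at ::
    "('r, 'm) ring_scheme \<Rightarrow> ('r, 'u) module set \<Rightarrow>
     (('r, 'u) module \<Rightarrow> ('r, 'u) module \<Rightarrow> bool) \<Rightarrow> ('r, 'u) type_triple rel" where
  "E_at R K sub = {((b1, A1, N1), (b2, A2, N2)).
     (b1, A1, N1) \<in> type_triples K \<and> (b2, A2, N2) \<in> type_triples K \<and> A1 = A2 \<and>
     (\<exists>N f1 f2. K_embedding R K sub f1 N1 N \<and> K_embedding R K sub f2 N2 N \<and>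
        f1 b1 = f2 b2 \<and> (\<forall>a\<in>A1. f1 a = a \<and> f2 a = a))}"

definition ortp ::
    "('r, 'm) ring_scheme \<Rightarrow> ('r, 'u) module set \<Rightarrow>
     (('r, 'u) module \<Rightarrow> ('r, 'u) module \<Rightarrow> bool) \<Rightarrow>
     'u \<Rightarrow> 'u set \<Rightarrow> ('r, 'u) module \<Rightarrow> ('r, 'u) type_triple set" where
  "ortp R K sub b A N = (E_at R K sub)\<^sup>+ `` {(b, A, N)}"

(* All representatives of p give the same restriction, so the set below is a singleton. *)
definition ortp_restrict ::
    "('r, 'm) ring_scheme \<Rightarrow> ('r, 'u) module set \<Rightarrow>
     (('r, 'u) module \<Rightarrow> ('r, 'u) module \<Rightarrow> bool) \<Rightarrow>
     ('r, 'u) type_triple set \<Rightarrow> 'u set \<Rightarrow> ('r, 'u) type_triple set" where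
  "ortp_restrict R K sub p B = the_elem ((\<lambda>(b, A, N). ortp R K sub b B N) ` p)"

definition types_in ::
    "('r, 'm) ring_scheme \<Rightarrow> ('r, 'u) module set \<Rightarrow>
     (('r, 'u) module \<Rightarrow> ('r, 'u) module \<Rightarrow> bool) \<Rightarrow>
     ('r, 'u) module \<Rightarrow> ('r, 'u) module \<Rightarrow> ('r, 'u) type_triple set set" where
  "types_in R K sub M N = (\<lambda>c. ortp R K sub c (carrier M) N) ` carrier N"

definition types_over ::
    "('r, 'm) ring_scheme \<Rightarrow> ('r, 'u) module set \<Rightarrow>
     (('r, 'u) module \<Rightarrow> ('r, 'u) module \<Rightarrow> bool) \<Rightarrow>
     ('r, 'u) module \<Rightarrow> ('r, 'u) type_triple set set" where
  "types_over R K sub M = (\<Union>N\<in>{N. sub M N}. types_in R K sub M N)"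


definition tame ::
    "('r, 'm) ring_scheme \<Rightarrow> ('r, 'u) module set \<Rightarrow>
     (('r, 'u) module \<Rightarrow> ('r, 'u) module \<Rightarrow> bool) \<Rightarrow> 'u rel \<Rightarrow> bool" where
  "tame R K sub \<kappa> \<longleftrightarrow>
     (\<forall>M\<in>K. \<forall>p\<in>types_over R K sub M. \<forall>q\<in>types_over R K sub M. p \<noteq> q \<longrightarrow>
        (\<exists>M0\<in>K. sub M0 M \<and> |carrier M0| \<le>o \<kappa> \<and>
           ortp_restrict R K sub p (carrier M0) \<noteq> ortp_restrict R K sub q (carrier M0)))"

definition stable_at ::
    "('r, 'm) ring_scheme \<Rightarrow> ('r, 'u) module set \<Rightarrow>
     (('r, 'u) module \<Rightarrow> ('r, 'u) module \<Rightarrow> bool) \<Rightarrow> 'u rel \<Rightarrow> bool" where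
  "stable_at R K sub l \<longleftrightarrow>
     (\<forall>M\<in>K. |carrier M| =o l \<longrightarrow> |types_over R K sub M| \<le>o l)"

definition almost_stable_at ::
    "('r, 'm) ring_scheme \<Rightarrow> ('r, 'u) module set \<Rightarrow>
     (('r, 'u) module \<Rightarrow> ('r, 'u) module \<Rightarrow> bool) \<Rightarrow> 'u rel \<Rightarrow> bool" where
  "almost_stable_at R K sub l \<longleftrightarrow>
     (\<forall>M N. sub M N \<and> |carrier M| =o l \<longrightarrow> |types_in R K sub M N| \<le>o l)"

definition for_unboundedly_many_cards :: "('u rel \<Rightarrow> bool) \<Rightarrow> bool" where
  "for_unboundedly_many_cards P \<longleftrightarrow>
     (\<forall>\<alpha> :: 'u rel. small_card \<alpha> \<longrightarrow>
       (\<exists>l :: 'u rel. small_card l \<and> Cinfinite l \<and> \<alpha> \<le>o l \<and> P l))"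

definition AEC_stable ::
    "('r, 'm) ring_scheme \<Rightarrow> ('r, 'u) module set \<Rightarrow>
     (('r, 'u) module \<Rightarrow> ('r, 'u) module \<Rightarrow> bool) \<Rightarrow> bool" where
  "AEC_stable R K sub \<longleftrightarrow> for_unboundedly_many_cards (stable_at R K sub)"

definition AEC_almost_stable ::
    "('r, 'm) ring_scheme \<Rightarrow> ('r, 'u) module set \<Rightarrow>
     (('r, 'u) module \<Rightarrow> ('r, 'u) module \<Rightarrow> bool) \<Rightarrow> bool" where
  "AEC_almost_stable R K sub \<longleftrightarrow> for_unboundedly_many_cards (almost_stable_at R K sub)"

definition infinity_AP ::
    "('r, 'm) ring_scheme \<Rightarrow> ('r, 'u) module set \<Rightarrow>
     (('r, 'u) module \<Rightarrow> ('r, 'u) module \<Rightarrow> bool) \<Rightarrow> bool" where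
  "infinity_AP R K sub \<longleftrightarrow>
     (\<forall>(I :: 'u set) M Mi f. small I \<and> M \<in> K \<and> (\<forall>i\<in>I. K_embedding R K sub (f i) M (Mi i)) \<longrightarrow>
        (\<exists>N\<in>K. \<exists>g. (\<forall>i\<in>I. K_embedding R K sub (g i) (Mi i) N) \<and>
           (\<forall>i\<in>I. \<forall>j\<in>I. \<forall>x\<in>carrier M. g i (f i x) = g j (f j x))))"


(* Infinitary formulas.  Both the variables and the indices of conjunctions and disjunctions are
   elements of 'v (below 'v = 'u, so there are enough of them).  FAnd I F is the conjunction of the
   F i with i in I; the values of F outside I are irrelevant. *)

datatype ('r, 'v) mod_term =
    TVar 'v
  | TZero
  | TPlus "('r, 'v) mod_term" "('r, 'v) mod_term"
  | TMinus "('r, 'v) mod_term"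
  | TScalar 'r "('r, 'v) mod_term"

datatype ('r, 'v) mod_formula =
    FEq "('r, 'v) mod_term" "('r, 'v) mod_term"
  | FNot "('r, 'v) mod_formula"
  | FAnd "'v set" "'v \<Rightarrow> ('r, 'v) mod_formula"
  | FOr "'v set" "'v \<Rightarrow> ('r, 'v) mod_formula"
  | FEx "'v set" "('r, 'v) mod_formula"
  | FAll "'v set" "('r, 'v) mod_formula"

primrec is_term :: "('r, 'm) ring_scheme \<Rightarrow> ('r, 'v) mod_term \<Rightarrow> bool" where
  "is_term R (TVar v) = True"
| "is_term R TZero = True"
| "is_term R (TPlus s t) = (is_term R s \<and> is_term R t)"
| "is_term R (TMinus t) = is_term R t"
| "is_term R (TScalar r t) = (r \<in> carrier R \<and> is_term R t)"

primrec term_vars :: "('r, 'v) mod_term \<Rightarrow> 'v set" where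
  "term_vars (TVar v) = {v}"
| "term_vars TZero = {}"
| "term_vars (TPlus s t) = term_vars s \<union> term_vars t"
| "term_vars (TMinus t) = term_vars t"
| "term_vars (TScalar r t) = term_vars t"

primrec term_value :: "('r, 'u) module \<Rightarrow> ('r, 'v) mod_term \<Rightarrow> ('v \<Rightarrow> 'u) \<Rightarrow> 'u" where
  "term_value N (TVar v) a = a v"
| "term_value N TZero a = \<zero>\<^bsub>N\<^esub>"
| "term_value N (TPlus s t) a = term_value N s a \<oplus>\<^bsub>N\<^esub> term_value N t a"
| "term_value N (TMinus t) a = \<ominus>\<^bsub>N\<^esub> term_value N t a"
| "term_value N (TScalar r t) a = r \<odot>\<^bsub>N\<^esub> term_value N t a"

primrec free_vars :: "('r, 'v) mod_formula \<Rightarrow> 'v set" where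
  "free_vars (FEq s t) = term_vars s \<union> term_vars t"
| "free_vars (FNot \<phi>) = free_vars \<phi>"
| "free_vars (FAnd I F) = (\<Union>i\<in>I. free_vars (F i))"
| "free_vars (FOr I F) = (\<Union>i\<in>I. free_vars (F i))"
| "free_vars (FEx V \<phi>) = free_vars \<phi> - V"
| "free_vars (FAll V \<phi>) = free_vars \<phi> - V"

primrec in_logic ::
    "('r, 'm) ring_scheme \<Rightarrow> 'v rel \<Rightarrow> 'v rel \<Rightarrow> ('r, 'v) mod_formula \<Rightarrow> bool" where
  "in_logic R \<nu>0 \<nu>1 (FEq s t) =
     (is_term R s \<and> is_term R t \<and> |free_vars (FEq s t)| <o \<nu>1)"
| "in_logic R \<nu>0 \<nu>1 (FNot \<phi>) =
     (in_logic R \<nu>0 \<nu>1 \<phi> \<and> |free_vars (FNot \<phi>)| <o \<nu>1)"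
| "in_logic R \<nu>0 \<nu>1 (FAnd I F) =
     ( |I| <o \<nu>0 \<and> (\<forall>i\<in>I. in_logic R \<nu>0 \<nu>1 (F i)) \<and> |free_vars (FAnd I F)| <o \<nu>1)"
| "in_logic R \<nu>0 \<nu>1 (FOr I F) =
     ( |I| <o \<nu>0 \<and> (\<forall>i\<in>I. in_logic R \<nu>0 \<nu>1 (F i)) \<and> |free_vars (FOr I F)| <o \<nu>1)"
| "in_logic R \<nu>0 \<nu>1 (FEx V \<phi>) =
     ( |V| <o \<nu>1 \<and> in_logic R \<nu>0 \<nu>1 \<phi> \<and> |free_vars (FEx V \<phi>)| <o \<nu>1)"
| "in_logic R \<nu>0 \<nu>1 (FAll V \<phi>) =
     ( |V| <o \<nu>1 \<and> in_logic R \<nu>0 \<nu>1 \<phi> \<and> |free_vars (FAll V \<phi>)| <o \<nu>1)"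

definition reassigns :: "('r, 'u) module \<Rightarrow> 'v set \<Rightarrow> ('v \<Rightarrow> 'u) \<Rightarrow> ('v \<Rightarrow> 'u) \<Rightarrow> bool" where
  "reassigns N V a a' \<longleftrightarrow> (\<forall>v\<in>V. a' v \<in> carrier N) \<and> (\<forall>v. v \<notin> V \<longrightarrow> a' v = a v)"

primrec satisfies ::
    "('r, 'u) module \<Rightarrow> ('r, 'v) mod_formula \<Rightarrow> ('v \<Rightarrow> 'u) \<Rightarrow> bool" where
  "satisfies N (FEq s t) = (\<lambda>a. term_value N s a = term_value N t a)"
| "satisfies N (FNot \<phi>) = (\<lambda>a. \<not> satisfies N \<phi> a)"
| "satisfies N (FAnd I F) = (\<lambda>a. \<forall>i\<in>I. satisfies N (F i) a)"
| "satisfies N (FOr I F) = (\<lambda>a. \<exists>i\<in>I. satisfies N (F i) a)"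
| "satisfies N (FEx V \<phi>) = (\<lambda>a. \<exists>a'. reassigns N V a a' \<and> satisfies N \<phi> a')"
| "satisfies N (FAll V \<phi>) = (\<lambda>a. \<forall>a'. reassigns N V a a' \<longrightarrow> satisfies N \<phi> a')"

(* The kappa-tuple of free variables is given by a set X of variables of cardinality kappa, and a
   tuple from N indexed by it is an assignment mapping X into N; free_vars \<phi> \<subseteq> X makes its values
   outside X irrelevant. *)
definition syntactic ::
    "('r, 'm) ring_scheme \<Rightarrow> ('r, 'u) module set \<Rightarrow>
     (('r, 'u) module \<Rightarrow> ('r, 'u) module \<Rightarrow> bool) \<Rightarrow> 'u rel \<Rightarrow> bool" where
  "syntactic R K sub \<kappa> \<longleftrightarrow>
     (\<exists>(\<nu>0 :: 'u rel) (\<nu>1 :: 'u rel) (X :: 'u set) (\<phi> :: ('r, 'u) mod_formula).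
        small_card \<nu>0 \<and> Cinfinite \<nu>0 \<and> regularCard \<nu>0 \<and>
        small_card \<nu>1 \<and> Cinfinite \<nu>1 \<and> regularCard \<nu>1 \<and>
        \<nu>1 \<le>o \<nu>0 \<and> cardSuc \<kappa> \<le>o \<nu>1 \<and>
        in_logic R \<nu>0 \<nu>1 \<phi> \<and> |X| =o \<kappa> \<and> free_vars \<phi> \<subseteq> X \<and>
        (\<forall>N\<in>K. \<forall>a. a ` X \<subseteq> carrier N \<and> submodule (a ` X) R N \<longrightarrow>
           (N\<lparr>carrier := a ` X\<rparr> \<in> K \<and> sub (N\<lparr>carrier := a ` X\<rparr>) N \<longleftrightarrow> satisfies N \<phi> a)))"

end

(* A formula of the infinitary logic defines in a module N a set of assignments that is controlled
   by few subgroups of the group of all assignments.  To a formula one attaches, by recursion, a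
   small family of subgroups such that the truth value at x depends only on the cosets b + G that
   contain x, where G is in the family and b in a suitable subgroup B.  Atomic formulas define
   subgroups, and for quantifiers the family is closed under intersections, under intersection with
   the group W of assignments supported on the bound variables, and under adding W.  The infinite
   unions of cosets that obstruct the usual elimination of quantifiers are handled by groups that
   are not the union of at most l cosets of groups not containing them: these lie in one coset as
   soon as they are covered by l cosets.  If l = l^xi, every set of at most l assignments is
   contained in a suitable B with at most l elements.

   An element c of N then determines, up to l possibilities, the cosets that contain c placed at one
   variable.  If c and d give the same cosets, then for each small M0 below M the model around M0
   and c can be copied to one around M0 and d: the formula that makes the strong submodel relation
   syntactic and the equations of the diagram are transferred.  So c and d have the same types over
   all small submodels of M, and by tameness over M.  Under infinity-AP any small set of types over
   M is realized in one extension, so almost stability gives stability. *)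
theory Submission
  imports Defs "HOL-Algebra.AbelCoset"
begin

section \<open>Cosets in abelian groups\<close>

text \<open>In first-order logic a cover of a coset by finitely many cosets may be thinned out by
  Neumann's lemma, which drops the groups of infinite index; covers by \<open>l\<close> cosets admit
  no such reduction. Minimality replaces it: the group in question is the least one, of a certain
  form, that has a coset around a given element with representative in \<open>B\<close>, and a cover
  by groups that fail to contain it would, by saturation, yield a smaller one. \<open>B\<close> has
  to be a subgroup, not just a set. Sums of representatives must again be representatives, and
  translation by a parameter tuple in \<open>B\<close> must preserve \<open>B\<close>; the latter is
  why it suffices to compare the elements alone, placed at one variable, for all parameters at once.
  The bound xi depends on the formula and its variables only and is fixed before \<open>N\<close>
  and \<open>l\<close>: conjunctions add sizes, each quantifier takes a power set, and
  inaccessibility keeps the result small. The hypothesis \<open>l = l^xi\<close> says that a set of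
  size \<open>l\<close> has at most \<open>l\<close> subsets of size at most xi. This bounds the
  closure that produces \<open>B\<close>, the number of parameter tuples and the number of coset
  types.\<close>

context abelian_group
begin

lemma minus_diff: "x \<in> carrier G \<Longrightarrow> y \<in> carrier G \<Longrightarrow> \<ominus> (x \<ominus> y) = y \<ominus> x"
  by (simp add: a_minus_def minus_add a_comm)

lemma diff_add_diff:
  "x \<in> carrier G \<Longrightarrow> y \<in> carrier G \<Longrightarrow> z \<in> carrier G \<Longrightarrow> (x \<ominus> y) \<oplus> (y \<ominus> z) = x \<ominus> z"
  by (simp add: a_minus_def a_assoc r_neg1)

lemma add_diff_add:
  assumes "x \<in> carrier G" "y \<in> carrier G" "x' \<in> carrier G" "y' \<in> carrier G"
  shows "(x \<oplus> x') \<ominus> (y \<oplus> y') = (x \<ominus> y) \<oplus> (x' \<ominus> y')"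
  using assms by (simp add: a_minus_def minus_add a_assoc a_lcomm[of x' "\<ominus> y"])

lemma add_diff_cancel: "x \<in> carrier G \<Longrightarrow> y \<in> carrier G \<Longrightarrow> (x \<oplus> y) \<ominus> y = x"
  by (simp add: a_minus_def a_assoc r_neg)

lemma add_diff_cancel_left: "x \<in> carrier G \<Longrightarrow> y \<in> carrier G \<Longrightarrow> (x \<oplus> y) \<ominus> x = y"
  by (simp add: a_comm[of x] add_diff_cancel)

lemma diff_add_cancel: "x \<in> carrier G \<Longrightarrow> y \<in> carrier G \<Longrightarrow> (x \<ominus> y) \<oplus> y = x"
  by (simp add: a_minus_def a_assoc l_neg)

lemma diff_diff:
  "x \<in> carrier G \<Longrightarrow> y \<in> carrier G \<Longrightarrow> z \<in> carrier G \<Longrightarrow> (x \<ominus> y) \<ominus> z = x \<ominus> (y \<oplus> z)"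
  by (simp add: a_minus_def minus_add a_assoc)

lemma diff_zero: "x \<in> carrier G \<Longrightarrow> x \<ominus> \<zero> = x"
  by (simp add: a_minus_def)

lemma diff_self: "x \<in> carrier G \<Longrightarrow> x \<ominus> x = \<zero>"
  by (simp add: a_minus_def r_neg)

lemma coset_sym:
  assumes "additive_subgroup H G" "x \<in> carrier G" "y \<in> carrier G" "x \<ominus> y \<in> H"
  shows "y \<ominus> x \<in> H"
  using additive_subgroup.a_inv_closed[OF assms(1,4)] assms(2,3) by (simp add: minus_diff)

lemma coset_trans:
  assumes "additive_subgroup H G" "x \<in> carrier G" "y \<in> carrier G" "z \<in> carrier G"
    and "x \<ominus> y \<in> H" "y \<ominus> z \<in> H"
  shows "x \<ominus> z \<in> H"
  using additive_subgroup.a_closed[OF assms(1,5,6)] assms(2-4) by (simp add: diff_add_diff)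

lemma coset_add:
  assumes "additive_subgroup H G"
    and "x \<in> carrier G" "y \<in> carrier G" "x' \<in> carrier G" "y' \<in> carrier G"
    and "x \<ominus> y \<in> H" "x' \<ominus> y' \<in> H"
  shows "(x \<oplus> x') \<ominus> (y \<oplus> y') \<in> H"
  using additive_subgroup.a_closed[OF assms(1,6,7)] assms(2-5) by (simp add: add_diff_add)

end

text \<open>Cosets of \<open>G\<close> that miss \<open>B\<close> are not compared, so
  \<open>x\<close> and \<open>y\<close> may differ modulo \<open>G\<close>. The number of classes
  can therefore be bounded in terms of \<open>\<G>\<close> and \<open>B\<close>, whatever the size
  of the ambient group.\<close>

definition same_cosets :: "('a, 'm) ring_scheme \<Rightarrow> 'a set set \<Rightarrow> 'a set \<Rightarrow> 'a \<Rightarrow> 'a \<Rightarrow> bool" where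
  "same_cosets V \<G> B x y \<longleftrightarrow> (\<forall>G\<in>\<G>. \<forall>b\<in>B. x \<ominus>\<^bsub>V\<^esub> b \<in> G \<longleftrightarrow> y \<ominus>\<^bsub>V\<^esub> b \<in> G)"

text \<open>The first condition makes the groups of \<open>\<G>\<close> whose \<open>B\<close>-cosets contain a given element have a
  least member; the second puts into \<open>B\<close> the representatives of every cover of a group of \<open>\<G>\<close> by at
  most \<open>l\<close> cosets of other groups of \<open>\<G>\<close>.\<close>

definition saturated :: "('a, 'm) ring_scheme \<Rightarrow> 'b rel \<Rightarrow> 'a set set \<Rightarrow> 'a set \<Rightarrow> bool" where
  "saturated V l \<G> B \<longleftrightarrow>
     (\<forall>S\<subseteq>\<G>. \<forall>z\<in>carrier V. (\<forall>G\<in>S. \<exists>b\<in>B. z \<ominus>\<^bsub>V\<^esub> b \<in> G) \<longrightarrow>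
        (\<exists>b\<in>B. \<forall>G\<in>S. z \<ominus>\<^bsub>V\<^esub> b \<in> G)) \<and>
     (\<forall>A\<in>\<G>. \<forall>Q\<subseteq>\<G>.
        (\<exists>T\<subseteq>carrier V. |T| \<le>o l \<and> (\<forall>a\<in>A. \<exists>t\<in>T. \<exists>C\<in>Q. a \<ominus>\<^bsub>V\<^esub> t \<in> C)) \<longrightarrow>
        (\<forall>a\<in>A. \<exists>b\<in>B. \<exists>C\<in>Q. a \<ominus>\<^bsub>V\<^esub> b \<in> C))"

lemma saturatedD_coset:
  assumes "saturated V l \<G> B" "S \<subseteq> \<G>" "z \<in> carrier V" "\<forall>G\<in>S. \<exists>b\<in>B. z \<ominus>\<^bsub>V\<^esub> b \<in> G"
  shows "\<exists>b\<in>B. \<forall>G\<in>S. z \<ominus>\<^bsub>V\<^esub> b \<in> G"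
  using conjunct1[OF assms(1)[unfolded saturated_def], rule_format, of S z] assms(2-4) by simp

lemma saturatedD_cover:
  assumes sat: "saturated V l \<G> B" and "A \<in> \<G>" "Q \<subseteq> \<G>" "T \<subseteq> carrier V" "|T| \<le>o l"
    and "\<forall>a\<in>A. \<exists>t\<in>T. \<exists>C\<in>Q. a \<ominus>\<^bsub>V\<^esub> t \<in> C"
  shows "\<forall>a\<in>A. \<exists>b\<in>B. \<exists>C\<in>Q. a \<ominus>\<^bsub>V\<^esub> b \<in> C"
proof -
  have "\<exists>T\<subseteq>carrier V. |T| \<le>o l \<and> (\<forall>a\<in>A. \<exists>t\<in>T. \<exists>C\<in>Q. a \<ominus>\<^bsub>V\<^esub> t \<in> C)"
    using assms(4-6) by (intro exI[of _ T] conjI)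
  then show ?thesis
    using conjunct2[OF sat[unfolded saturated_def]] assms(2,3) by simp
qed

lemma saturated_mono:
  assumes "saturated V l \<G>' B" "\<G> \<subseteq> \<G>'"
  shows "saturated V l \<G> B"
  unfolding saturated_def
proof (intro conjI allI ballI impI)
  fix S z assume "S \<subseteq> \<G>" "z \<in> carrier V" "\<forall>G\<in>S. \<exists>b\<in>B. z \<ominus>\<^bsub>V\<^esub> b \<in> G"
  then show "\<exists>b\<in>B. \<forall>G\<in>S. z \<ominus>\<^bsub>V\<^esub> b \<in> G"
    using saturatedD_coset[OF assms(1), of S z] assms(2) by simp
next
  fix A Q a
  assume A: "A \<in> \<G>" and Q: "Q \<subseteq> \<G>" and a: "a \<in> A"
    and "\<exists>T\<subseteq>carrier V. |T| \<le>o l \<and> (\<forall>a\<in>A. \<exists>t\<in>T. \<exists>C\<in>Q. a \<ominus>\<^bsub>V\<^esub> t \<in> C)"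
  then obtain T where T: "T \<subseteq> carrier V" "|T| \<le>o l" "\<forall>a\<in>A. \<exists>t\<in>T. \<exists>C\<in>Q. a \<ominus>\<^bsub>V\<^esub> t \<in> C"
    by (elim exE conjE)
  show "\<exists>b\<in>B. \<exists>C\<in>Q. a \<ominus>\<^bsub>V\<^esub> b \<in> C"
    by (rule bspec[OF saturatedD_cover[OF assms(1) subsetD[OF assms(2) A]
            subset_trans[OF Q assms(2)] T] a])
qed

lemma same_cosets_mono: "same_cosets V \<G>' B x y \<Longrightarrow> \<G> \<subseteq> \<G>' \<Longrightarrow> same_cosets V \<G> B x y"
  unfolding same_cosets_def by blast

text \<open>Intersecting with \<open>carrier V\<close> makes the empty family yield the whole group
  instead of \<open>UNIV\<close>.\<close>

definition intersections :: "('a, 'm) ring_scheme \<Rightarrow> 'a set set \<Rightarrow> 'a set set" where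
  "intersections V \<G> = (\<lambda>S. carrier V \<inter> \<Inter>S) ` Pow \<G>"

text \<open>The groups \<open>G <+> W\<close> detect which cosets of \<open>G\<close> meet
  \<open>x + W\<close>, and the groups \<open>W \<inter> G\<close> describe how a coset of
  \<open>W\<close> is cut up by cosets of \<open>G\<close>. Arbitrary intersections occur because
  the back-and-forth step works with least groups around an element.\<close>

definition quant_closure :: "('a, 'm) ring_scheme \<Rightarrow> 'a set \<Rightarrow> 'a set set \<Rightarrow> 'a set set" where
  "quant_closure V W \<G> =
     intersections V \<G> \<union> (\<lambda>G. W \<inter> G) ` intersections V \<G> \<union>
     (\<lambda>G. G <+>\<^bsub>V\<^esub> W) ` intersections V \<G>"

context abelian_group
begin

lemma additive_subgroup_diffI:
  assumes "H \<subseteq> carrier G" "\<zero> \<in> H" "\<And>x y. x \<in> H \<Longrightarrow> y \<in> H \<Longrightarrow> x \<ominus> y \<in> H"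
  shows "additive_subgroup H G"
proof (rule additive_subgroupI, rule group.subgroupI[OF a_group])
  have neg: "\<ominus> x \<in> H" if "x \<in> H" for x
    using assms(3)[OF assms(2) that] that assms(1) by (auto simp: a_minus_def subset_iff)
  show "inv\<^bsub>add_monoid G\<^esub> a \<in> H" if "a \<in> H" for a using neg[OF that] by (simp add: a_inv_def)
  show "a \<otimes>\<^bsub>add_monoid G\<^esub> b \<in> H" if "a \<in> H" "b \<in> H" for a b
    using assms(3)[OF that(1) neg[OF that(2)]] that assms(1) by (auto simp: a_minus_def subset_iff)
qed (use assms in auto)

lemma additive_subgroup_Inter:
  assumes "\<And>H. H \<in> S \<Longrightarrow> additive_subgroup H G"
  shows "additive_subgroup (carrier G \<inter> \<Inter>S) G"
proof (rule additive_subgroupI, rule group.subgroupI)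
  show "group (add_monoid G)" by (rule a_group)
  show "carrier G \<inter> \<Inter>S \<subseteq> carrier (add_monoid G)" by auto
  have "\<zero> \<in> carrier G \<inter> \<Inter>S"
    using assms additive_subgroup.zero_closed by auto
  then show "carrier G \<inter> \<Inter>S \<noteq> {}" by blast
  show "inv\<^bsub>add_monoid G\<^esub> a \<in> carrier G \<inter> \<Inter>S" if "a \<in> carrier G \<inter> \<Inter>S" for a
    using that assms additive_subgroup.a_inv_closed[of _ G a] by (auto simp: a_inv_def[symmetric])
  show "a \<otimes>\<^bsub>add_monoid G\<^esub> b \<in> carrier G \<inter> \<Inter>S"
    if "a \<in> carrier G \<inter> \<Inter>S" "b \<in> carrier G \<inter> \<Inter>S" for a b
    using that assms additive_subgroup.a_closed[of _ G a b] by auto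
qed

lemma additive_subgroup_quant_closure:
  assumes "\<And>H. H \<in> \<G> \<Longrightarrow> additive_subgroup H G" "additive_subgroup W G"
    and "H \<in> quant_closure G W \<G>"
  shows "additive_subgroup H G"
proof -
  have int: "additive_subgroup J G" if "J \<in> intersections G \<G>" for J
    using that assms(1) additive_subgroup_Inter unfolding intersections_def by blast
  have "additive_subgroup (W \<inter> J) G" if "J \<in> intersections G \<G>" for J
  proof -
    have "W \<inter> J = carrier G \<inter> \<Inter>{W, J}"
      using additive_subgroup.a_subset[OF assms(2)] by auto
    then show ?thesis using additive_subgroup_Inter[of "{W, J}"] int[OF that] assms(2) by auto
  qed
  then show ?thesis
    using assms int add_additive_subgroups unfolding quant_closure_def by blast
qed

lemma intersectionsI: "S \<subseteq> \<G> \<Longrightarrow> carrier G \<inter> \<Inter>S \<in> intersections G \<G>"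
  unfolding intersections_def by blast

lemma subset_quant_closure:
  assumes "\<And>H. H \<in> \<G> \<Longrightarrow> additive_subgroup H G"
  shows "\<G> \<subseteq> quant_closure G W \<G>"
proof
  fix H assume H: "H \<in> \<G>"
  then have "H = carrier G \<inter> \<Inter>{H}" using additive_subgroup.a_subset[OF assms] by auto
  then show "H \<in> quant_closure G W \<G>"
    using intersectionsI[of "{H}" \<G>] H unfolding quant_closure_def by auto
qed

text \<open>Translates a coset of a sum into the meeting of two cosets: whether \<open>b + H\<close>
  can be reached from \<open>z\<close> inside \<open>z + W\<close> is visible from the cosets of
  \<open>H <+> W\<close> alone.\<close>

lemma mem_set_add_iff:
  assumes "additive_subgroup H G" "additive_subgroup W G" "z \<in> carrier G" "b \<in> carrier G"
  shows "z \<ominus> b \<in> H <+> W \<longleftrightarrow> (\<exists>z'\<in>carrier G. z' \<ominus> b \<in> H \<and> z \<ominus> z' \<in> W)"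
proof
  assume "z \<ominus> b \<in> H <+> W"
  then obtain h w where hw: "h \<in> H" "w \<in> W" "z \<ominus> b = h \<oplus> w"
    unfolding set_add_def set_mult_def by auto
  have c: "h \<in> carrier G" "w \<in> carrier G"
    using hw additive_subgroup.a_subset[OF assms(1)] additive_subgroup.a_subset[OF assms(2)] by blast+
  have "z = (h \<oplus> w) \<oplus> b" using diff_add_cancel[OF assms(3,4)] hw(3) by simp
  then have z: "z = (h \<oplus> b) \<oplus> w" using c assms(4) by (simp add: a_assoc a_comm[of w b])
  have "(h \<oplus> b) \<ominus> b = h" "z \<ominus> (h \<oplus> b) = w"
    using c assms(4) unfolding z by (simp_all add: add_diff_cancel add_diff_cancel_left)
  then show "\<exists>z'\<in>carrier G. z' \<ominus> b \<in> H \<and> z \<ominus> z' \<in> W"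
    using hw(1,2) c assms(4) by (intro bexI[of _ "h \<oplus> b"]) simp_all
next
  assume "\<exists>z'\<in>carrier G. z' \<ominus> b \<in> H \<and> z \<ominus> z' \<in> W"
  then obtain z' where z': "z' \<in> carrier G" "z' \<ominus> b \<in> H" "z \<ominus> z' \<in> W" by blast
  have "z \<ominus> b = (z' \<ominus> b) \<oplus> (z \<ominus> z')"
    using z'(1) assms(3,4) by (simp add: a_comm[of "z' \<ominus> b"] diff_add_diff)
  then show "z \<ominus> b \<in> H <+> W"
    using z' unfolding set_add_def set_mult_def by auto
qed

text \<open>The back-and-forth step. Let \<open>b0 + I x'\<close> be the least \<open>B\<close>-coset containing \<open>x'\<close>, and suppose that
  every \<open>y' \<in> y + W\<close> in it lies in a \<open>B\<close>-coset of some \<open>H \<notin> M x'\<close>. For \<open>q \<in> W \<inter> I x'\<close> the least group \<open>A q\<close>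
  with \<open>q \<in> B + A q\<close> is not covered by \<open>l\<close> cosets of groups not containing it, so \<open>y0 + A q\<close> lies in a
  single \<open>B\<close>-coset of such an \<open>H\<close>, and then \<open>H\<close> contains both \<open>A q\<close> and \<open>I y0\<close>. Moving \<open>y0\<close> to the side
  of \<open>x\<close> gives \<open>x1 \<in> x + W\<close> with \<open>x' \<in> x1 + W \<inter> I x'\<close>, and \<open>q = x' - x1\<close> puts \<open>x'\<close> itself into a
  \<open>B\<close>-coset of \<open>H \<notin> M x'\<close>, a contradiction.\<close>

proposition same_cosets_extend:
  fixes l :: "'l rel"
  assumes G: "\<And>H. H \<in> \<G> \<Longrightarrow> additive_subgroup H G"
    and W: "additive_subgroup W G"
    and B: "additive_subgroup B G"
    and sat: "saturated G l (quant_closure G W \<G>) B"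
    and l: "Cinfinite l" "|B| \<le>o l" "|\<G>| \<le>o l"
    and x: "x \<in> carrier G" and y: "y \<in> carrier G"
    and same: "same_cosets G (quant_closure G W \<G>) B x y"
    and x': "x' \<in> carrier G" "x' \<ominus> x \<in> W"
  shows "\<exists>y'\<in>carrier G. y' \<ominus> y \<in> W \<and> same_cosets G \<G> B x' y'"
proof (rule ccontr)
  assume none: "\<not> ?thesis"
  have Bc: "B \<subseteq> carrier G" and Wc: "W \<subseteq> carrier G"
    by (rule additive_subgroup.a_subset[OF B], rule additive_subgroup.a_subset[OF W])
  define meets where "meets z H \<longleftrightarrow> (\<exists>b\<in>B. z \<ominus> b \<in> H)" for z H
  have full: "\<exists>b\<in>B. \<forall>H\<in>S. z \<ominus> b \<in> H"
    if "S \<subseteq> quant_closure G W \<G>" "z \<in> carrier G" "\<forall>H\<in>S. meets z H" for S z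
    using saturatedD_coset[OF sat that(1,2)] that(3) unfolding meets_def by simp
  have cover: "\<forall>a\<in>A. \<exists>b\<in>B. \<exists>C\<in>Q. a \<ominus> b \<in> C"
    if "A \<in> quant_closure G W \<G>" "Q \<subseteq> quant_closure G W \<G>" "T \<subseteq> carrier G" "|T| \<le>o l"
      "\<forall>a\<in>A. \<exists>t\<in>T. \<exists>C\<in>Q. a \<ominus> t \<in> C" for A Q T
    by (rule saturatedD_cover[OF sat that])
  have Gc: "H \<subseteq> carrier G" if "H \<in> \<G>" for H
    by (rule additive_subgroup.a_subset[OF G[OF that]])
  have Gq: "\<G> \<subseteq> quant_closure G W \<G>" by (rule subset_quant_closure[OF G])
  have Wq: "W \<inter> H \<in> quant_closure G W \<G>" if "H \<in> \<G>" for H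
  proof -
    have "H = carrier G \<inter> \<Inter>{H}" using Gc that by auto
    then show ?thesis
      using intersectionsI[of "{H}" \<G>] that unfolding quant_closure_def by auto
  qed
  define M where "M z = {H \<in> \<G>. meets z H}" for z
  have Msub: "M z \<subseteq> \<G>" for z unfolding M_def by blast
  define I where "I z = carrier G \<inter> \<Inter>(M z)" for z
  have Isg: "additive_subgroup (I z) G" for z
    unfolding I_def by (rule additive_subgroup_Inter, rule G) (use Msub in blast)
  have Iq: "I z \<in> intersections G \<G>" for z
    using intersectionsI[OF Msub] unfolding I_def .
  \<comment> \<open>By the first half of saturation one \<open>b\<close> serves all groups of
    \<open>M z\<close>, so \<open>b + I z\<close> is the intersection of all cosets of members of
    \<open>\<G>\<close> that contain \<open>z\<close> and have a representative in
    \<open>B\<close>.\<close>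
  have base: "\<exists>b\<in>B. z \<ominus> b \<in> I z" if "z \<in> carrier G" for z
  proof -
    have "\<forall>H\<in>M z. meets z H" unfolding M_def by simp
    then obtain b where "b \<in> B" "\<forall>H\<in>M z. z \<ominus> b \<in> H"
      using full[OF subset_trans[OF Msub Gq] \<open>z \<in> carrier G\<close>] by blast
    moreover from this have "z \<ominus> b \<in> carrier G" using that Bc by blast
    ultimately show ?thesis unfolding I_def by blast
  qed
  obtain b0 where b0: "b0 \<in> B" "x' \<ominus> b0 \<in> I x'" using base x' by blast
  \<comment> \<open>The cosets of \<open>J <+> W\<close> carry over from \<open>u\<close> to
    \<open>v\<close> that \<open>b + J\<close> meets the coset of \<open>W\<close>. This is used in
    both directions, from \<open>x\<close> to \<open>y\<close> and back.\<close>
  have transfer: "\<exists>z'\<in>carrier G. z' \<ominus> b \<in> J \<and> v \<ominus> z' \<in> W"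
    if J: "J \<in> intersections G \<G>" "b \<in> B" and uv: "u \<in> carrier G" "v \<in> carrier G"
      "same_cosets G (quant_closure G W \<G>) B u v"
      and z: "z \<in> carrier G" "z \<ominus> b \<in> J" "u \<ominus> z \<in> W" for J b u v z
  proof -
    have Js: "additive_subgroup J G"
      using additive_subgroup_quant_closure[OF G W, of \<G> J] J unfolding quant_closure_def by blast
    have "J <+> W \<in> quant_closure G W \<G>" using J unfolding quant_closure_def by blast
    moreover have "u \<ominus> b \<in> J <+> W"
      using mem_set_add_iff[OF Js W uv(1)] z J Bc by blast
    ultimately have "v \<ominus> b \<in> J <+> W" using uv(3) J unfolding same_cosets_def by blast
    then show ?thesis using mem_set_add_iff[OF Js W uv(2)] J Bc by blast
  qed
  have same': "same_cosets G (quant_closure G W \<G>) B y x"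
    using same unfolding same_cosets_def by blast
  have "x \<ominus> x' \<in> W" using coset_sym[OF W] x x' by blast
  then obtain y0 where y0: "y0 \<in> carrier G" "y0 \<ominus> b0 \<in> I x'" "y \<ominus> y0 \<in> W"
    using transfer[OF Iq b0(1) x y same x'(1) b0(2)] by blast
  have b0c: "b0 \<in> carrier G" using b0 Bc by blast
  \<comment> \<open>For every group of \<open>M x'\<close> both \<open>x'\<close> and
    \<open>y'\<close> lie in the coset of \<open>b0\<close>. If \<open>y'\<close> met no further
    group, the two would have the same cosets, against \<open>none\<close>.\<close>
  have extra: "\<exists>H\<in>\<G> - M x'. meets y' H"
    if y': "y' \<in> carrier G" "y' \<ominus> y \<in> W" "y' \<ominus> b0 \<in> I x'" for y'
  proof (rule ccontr)
    assume no: "\<not> ?thesis"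
    have "x' \<ominus> b \<in> H \<longleftrightarrow> y' \<ominus> b \<in> H" if H: "H \<in> \<G>" and b: "b \<in> B" for H b
    proof (cases "H \<in> M x'")
      case True
      then have "x' \<ominus> b0 \<in> H" "y' \<ominus> b0 \<in> H" using b0 y' unfolding I_def by auto
      then show ?thesis
        using coset_sym[OF G[OF H]] coset_trans[OF G[OF H]]
          x' y' b0c b Bc by (meson subsetD)
    next
      case False
      then show ?thesis using no H b unfolding M_def meets_def by blast
    qed
    then have "same_cosets G \<G> B x' y'" unfolding same_cosets_def by blast
    then show False using none y' by blast
  qed
  \<comment> \<open>The factor \<open>W\<close> keeps \<open>y0 + A q\<close> in
    \<open>y + W\<close> and the groups of \<open>M x'\<close> keep it in \<open>b0 + I x'\<close>,
    so \<open>extra\<close> applies to all of it. The remaining groups make \<open>A q\<close>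
    minimal around \<open>q\<close>.\<close>
  define A where "A q = W \<inter> (carrier G \<inter> \<Inter>(M x' \<union> {H \<in> \<G>. meets q (W \<inter> H)}))" for q
  have AB: "\<exists>b\<in>B. q \<ominus> b \<in> A q" if q: "q \<in> W" "q \<in> I x'" for q
  proof -
    let ?T = "(\<lambda>H. W \<inter> H) ` insert (carrier G) (M x' \<union> {H \<in> \<G>. meets q (W \<inter> H)})"
    have q0: "q \<ominus> \<zero> = q" using q Wc by (auto simp: diff_zero)
    have zB: "\<zero> \<in> B" using additive_subgroup.zero_closed[OF B] .
    have "meets q (W \<inter> H)" if "H \<in> M x' \<or> H = carrier G" for H
    proof -
      have "q \<in> W \<inter> H" using q Wc that unfolding I_def by blast
      then show ?thesis using q0 zB unfolding meets_def by metis
    qed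
    then have "\<forall>H\<in>?T. meets q H" by auto
    moreover have "W \<inter> carrier G \<in> quant_closure G W \<G>"
      using intersectionsI[of "{}" \<G>] unfolding quant_closure_def by auto
    then have "?T \<subseteq> quant_closure G W \<G>" using Wq Msub by blast
    ultimately obtain b where "b \<in> B" "\<forall>H\<in>?T. q \<ominus> b \<in> H"
      using full[of ?T q] q Wc by blast
    then show ?thesis unfolding A_def by auto
  qed
  have A: "\<exists>H\<in>\<G> - M x'. A q \<subseteq> H \<and> meets y0 H" if q: "q \<in> W" "q \<in> I x'" for q
  proof (rule ccontr)
    assume no: "\<not> ?thesis"
    have Aq: "A q \<in> quant_closure G W \<G>"
      unfolding A_def quant_closure_def
      by (rule UnI1, rule UnI2, rule imageI, rule intersectionsI) (use Msub in blast)
    obtain bq where bq: "bq \<in> B" and qA: "q \<ominus> bq \<in> A q" using AB[OF q] by blast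
    \<comment> \<open>One representative \<open>t\<close> for each coset \<open>b + H\<close> that
      meets \<open>y0 + W\<close>, hence at most \<open>l\<close> of them. Taking \<open>t\<close>
      in \<open>W\<close> puts \<open>a \<ominus> t\<close> into \<open>W \<inter> H\<close>, a
      member of the closed family.\<close>
    define P where "P = B \<times> (\<G> - M x')"
    define t where "t p = (SOME t. t \<in> carrier G \<and> t \<in> W \<and> (y0 \<oplus> t) \<ominus> fst p \<in> snd p)" for p
    define T where "T = t ` P \<inter> carrier G"
    define Q where "Q = {W \<inter> H | H. H \<in> \<G> - M x' \<and> \<not> A q \<subseteq> H}"
    have "|T| \<le>o l"
    proof -
      have "|\<G> - M x'| \<le>o l" using ordLeq_transitive[OF card_of_mono1 l(3)] by blast
      then have "|P| \<le>o l"
        unfolding P_def using l(1) cinfinite_def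
        by (intro card_of_Times_ordLeq_infinite_Field l(2)) auto
      moreover have "|T| \<le>o |P|"
        unfolding T_def by (meson card_of_image card_of_mono1 inf_le1 ordLeq_transitive)
      ultimately show ?thesis by (rule ordLeq_transitive[rotated])
    qed
    moreover have "T \<subseteq> carrier G" unfolding T_def by blast
    moreover have "Q \<subseteq> quant_closure G W \<G>" using Wq unfolding Q_def by blast
    moreover have "\<exists>t\<in>T. \<exists>C\<in>Q. a \<ominus> t \<in> C" if a: "a \<in> A q" for a
    proof -
      have aW: "a \<in> W" "a \<in> carrier G" "a \<in> I x'" using a unfolding A_def I_def by auto
      have ya: "y0 \<oplus> a \<in> carrier G" using y0 aW by blast
      have az: "a \<ominus> \<zero> \<in> I x'" "a \<ominus> \<zero> \<in> W" using aW by (simp_all add: diff_zero)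
      have 1: "(y0 \<oplus> a) \<ominus> b0 \<in> I x'"
        using coset_add[OF Isg y0(1) b0c aW(2) zero_closed y0(2) az(1)] b0c by simp
      have "y0 \<ominus> y \<in> W" using coset_sym[OF W y y0(1,3)] .
      then have 2: "(y0 \<oplus> a) \<ominus> y \<in> W"
        using coset_add[OF W y0(1) y aW(2) zero_closed _ az(2)] y by simp
      obtain H b where H: "H \<in> \<G> - M x'" "b \<in> B" "(y0 \<oplus> a) \<ominus> b \<in> H"
        using extra[OF ya 2 1] unfolding meets_def by blast
      have Hs: "additive_subgroup H G" using G H by blast
      have bc: "b \<in> carrier G" using H Bc by blast
      have t: "t (b, H) \<in> carrier G" "t (b, H) \<in> W" "(y0 \<oplus> t (b, H)) \<ominus> b \<in> H"
        using someI[of "\<lambda>t. t \<in> carrier G \<and> t \<in> W \<and> (y0 \<oplus> t) \<ominus> b \<in> H" a] aW H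
        unfolding t_def by auto
      have "t (b, H) \<in> T" using t H unfolding T_def P_def by auto
      moreover have "a \<ominus> t (b, H) \<in> W"
        using aW t W by (simp add: a_minus_def additive_subgroup.a_closed additive_subgroup.a_inv_closed)
      moreover have "(y0 \<oplus> a) \<ominus> (y0 \<oplus> t (b, H)) \<in> H"
        using coset_trans[OF Hs ya bc _ H(3)]
          coset_sym[OF Hs _ bc t(3)] y0(1) t(1) by simp
      then have at: "a \<ominus> t (b, H) \<in> H"
        using aW(2) t(1) y0(1) by (simp add: add_diff_add diff_self)
      moreover have "\<not> A q \<subseteq> H"
      proof
        assume AH: "A q \<subseteq> H"
        have "y0 \<ominus> b = (y0 \<oplus> a) \<ominus> b \<ominus> a"
          using y0(1) aW(2) bc by (simp add: diff_diff add_diff_add diff_self)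
        moreover have "(y0 \<oplus> a) \<ominus> b \<ominus> a \<in> H"
          using H(3) AH a Hs unfolding a_minus_def
          by (meson additive_subgroup.a_closed additive_subgroup.a_inv_closed subsetD)
        ultimately have "meets y0 H" using H(2) unfolding meets_def by metis
        then show False using no H AH by blast
      qed
      ultimately show ?thesis using H(1) unfolding Q_def by blast
    qed
    \<comment> \<open>Saturation trades the representatives in \<open>T\<close> for some in
      \<open>B\<close>. It is applied to \<open>q \<ominus> bq\<close>, which lies in
      \<open>A q\<close>; since \<open>bq \<oplus> b\<close> is in \<open>B\<close> again,
      \<open>q\<close> itself lies in such a coset, and the definition of \<open>A q\<close> forces
      \<open>A q \<subseteq> H\<close>.\<close>
    ultimately obtain b C where C: "b \<in> B" "C \<in> Q" "(q \<ominus> bq) \<ominus> b \<in> C"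
      using cover[OF Aq, of Q T] qA by blast
    then obtain H where H: "H \<in> \<G> - M x'" "\<not> A q \<subseteq> H" "C = W \<inter> H" unfolding Q_def by blast
    have "q \<ominus> (bq \<oplus> b) = (q \<ominus> bq) \<ominus> b"
      using q Wc bq C(1) Bc by (simp add: diff_diff subset_iff)
    moreover have "bq \<oplus> b \<in> B" using additive_subgroup.a_closed[OF B bq C(1)] .
    ultimately have "meets q (W \<inter> H)" using C H unfolding meets_def by metis
    then have "A q \<subseteq> H" using H unfolding A_def by blast
    then show False using H by blast
  qed
  obtain b1 where b1: "b1 \<in> B" "y0 \<ominus> b1 \<in> I y0" using base y0 by blast
  have b1c: "b1 \<in> carrier G" using b1 Bc by blast
  \<comment> \<open>\<open>I y0\<close> may be smaller than \<open>I x'\<close>. Sharing the coset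
    \<open>b1 + I y0\<close> puts \<open>x1\<close> into every coset with representative in
    \<open>B\<close> that contains \<open>y0\<close>, in particular into that of the group
    \<open>H\<close> found below.\<close>
  obtain x1 where x1: "x1 \<in> carrier G" "x1 \<ominus> b1 \<in> I y0" "x \<ominus> x1 \<in> W"
    using transfer[OF Iq b1(1) y x same' y0(1) b1(2) y0(3)] by blast
  define q where "q = x' \<ominus> x1"
  have qc: "q \<in> carrier G" using x'(1) x1(1) unfolding q_def by simp
  have qW: "q \<in> W"
    unfolding q_def using coset_trans[OF W x'(1) x x1(1) x'(2) x1(3)] .
  have "M x' \<subseteq> M y0"
    using y0(2) b0(1) unfolding M_def I_def meets_def by blast
  then have sub: "I y0 \<subseteq> I x'" unfolding I_def by blast
  note tr = coset_trans[OF Isg[of x']]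
    and sy = coset_sym[OF Isg[of x']]
  have "x' \<ominus> y0 \<in> I x'" using tr[OF x'(1) b0c y0(1) b0(2)] sy[OF y0(1) b0c y0(2)] by blast
  then have "x' \<ominus> b1 \<in> I x'" using tr[OF x'(1) y0(1) b1c] b1(2) sub by blast
  then have qI: "q \<in> I x'"
    unfolding q_def using tr[OF x'(1) b1c x1(1)] sy[OF x1(1) b1c] x1(2) sub by blast
  obtain H where H: "H \<in> \<G> - M x'" "A q \<subseteq> H" "meets y0 H" using A[OF qW qI] by blast
  have Hs: "additive_subgroup H G" using G H by blast
  have "x1 \<ominus> b1 \<in> H" using x1(2) H unfolding I_def M_def by blast
  moreover obtain bq where bq: "bq \<in> B" "q \<ominus> bq \<in> A q" using AB[OF qW qI] by blast
  moreover have bqc: "bq \<in> carrier G" using bq Bc by blast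
  ultimately have "(x1 \<oplus> q) \<ominus> (b1 \<oplus> bq) \<in> H"
    using coset_add[OF Hs x1(1) b1c qc bqc] H(2) by blast
  moreover have "x1 \<oplus> q = x'"
    using x1(1) x'(1) unfolding q_def by (simp add: a_comm[of x1] diff_add_cancel)
  moreover have "b1 \<oplus> bq \<in> B" using additive_subgroup.a_closed[OF B b1(1) bq(1)] .
  ultimately have "meets x' H" unfolding meets_def by auto
  then show False using H(1) unfolding M_def by blast
qed

end

section \<open>Small saturated subgroups\<close>

lemma finite_ordLeq_Cinfinite:
  assumes "finite X" "Cinfinite l"
  shows "|X| \<le>o l"
proof -
  have "Well_order l" "infinite (Field l)"
    using assms(2) card_order_on_well_order_on by (auto simp: cinfinite_def)
  then have "|X| <o l"
    by (intro finite_ordLess_infinite) (use assms(1) card_of_Well_order in \<open>auto simp: Field_card_of\<close>)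
  then show ?thesis by (rule ordLess_imp_ordLeq)
qed

lemma card_image_le: "|X| \<le>o l \<Longrightarrow> |f ` X| \<le>o l"
  by (rule ordLeq_transitive[OF card_of_image])

lemma card_subset_le: "X \<subseteq> Y \<Longrightarrow> |Y| \<le>o l \<Longrightarrow> |X| \<le>o l"
  by (rule ordLeq_transitive[OF card_of_mono1])

lemma card_Times_le: "Cinfinite l \<Longrightarrow> |X| \<le>o l \<Longrightarrow> |Y| \<le>o l \<Longrightarrow> |X \<times> Y| \<le>o l"
  by (rule card_of_Times_ordLeq_infinite_Field) (auto simp: cinfinite_def)

text \<open>A nonempty subset of size at most \<open>xi\<close> is the range of a map from
  \<open>Field xi\<close> to \<open>D\<close>, and there are at most \<open>l ^c xi\<close> such
  maps. The empty set is no such range and is added by hand.\<close>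

lemma card_bounded_subsets:
  assumes xi: "Cinfinite xi" and l: "Cinfinite l" "l ^c xi \<le>o l" and D: "|D| \<le>o l"
  shows "|{X. X \<subseteq> D \<and> |X| \<le>o xi}| \<le>o l"
proof -
  let ?Fn = "Func (Field xi) D"
  have "|?Fn| =o |D| ^c xi" unfolding cexp_def Field_card_of by (rule card_of_refl)
  also have "|D| ^c xi \<le>o l ^c xi" using cexp_mono1[OF D] xi by blast
  also note l(2)
  finally have Fn: "|?Fn| \<le>o l" .
  have "X \<in> insert {} ((\<lambda>f. f ` Field xi) ` ?Fn)" if X: "X \<subseteq> D" "|X| \<le>o xi" for X
  proof (cases "X = {}")
    case False
    have "|X| \<le>o |Field xi|"
      by (rule ordLeq_ordIso_trans[OF X(2) ordIso_symmetric[OF card_of_Field_ordIso]]) (simp add: xi)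
    then obtain g where g: "g ` Field xi = X" using iffD2[OF card_of_ordLeq2[OF False]] by blast
    let ?f = "\<lambda>a. if a \<in> Field xi then g a else undefined"
    have "?f \<in> ?Fn" using g X(1) unfolding Func_def by auto
    moreover have "?f ` Field xi = X" using g by auto
    ultimately show ?thesis by blast
  qed simp
  then have "{X. X \<subseteq> D \<and> |X| \<le>o xi} \<subseteq> insert {} ((\<lambda>f. f ` Field xi) ` ?Fn)" by blast
  then have 1: "|{X. X \<subseteq> D \<and> |X| \<le>o xi}| \<le>o |{{}} \<union> (\<lambda>f. f ` Field xi) ` ?Fn|"
    using card_of_mono1 by auto
  have "|{{} :: 'c set}| \<le>o l"
    by (rule finite_ordLeq_Cinfinite) (use l(1) in simp_all)
  moreover have "|(\<lambda>f. f ` Field xi) ` ?Fn| \<le>o l" using Fn card_of_image ordLeq_transitive by blast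
  ultimately have "|{{}} \<union> (\<lambda>f. f ` Field xi) ` ?Fn| \<le>o l"
    using Un_Cinfinite_bound l(1) by blast
  then show ?thesis using 1 ordLeq_transitive by blast
qed

lemma ordLess_of_cexp:
  assumes "Cinfinite xi" "Cinfinite l" "l ^c xi \<le>o l"
  shows "xi <o l"
proof -
  have "xi <o ctwo ^c xi" using assms(1) ordLess_ctwo_cexp by blast
  also have "ctwo ^c xi \<le>o l ^c xi" using cexp_mono1 ctwo_ordLeq_Cinfinite assms by blast
  also note assms(3)
  finally show ?thesis .
qed

lemma card_Pow_le:
  assumes "Cinfinite xi" "Cinfinite l" "l ^c xi \<le>o l" "|X| \<le>o xi"
  shows "|Pow X| \<le>o l"
proof -
  have "|Y| \<le>o xi" if "Y \<subseteq> X" for Y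
    using ordLeq_transitive[OF card_of_mono1[OF that] assms(4)] .
  then have "Pow X = {Y. Y \<subseteq> X \<and> |Y| \<le>o xi}" by blast
  moreover have "|X| \<le>o l"
    using ordLess_of_cexp[OF assms(1-3)] assms(4) ordLeq_ordLess_trans ordLess_imp_ordLeq by blast
  ultimately show ?thesis using card_bounded_subsets[OF assms(1-3), of X] by metis
qed

text \<open>The closure is reached after \<open>cardSuc xi\<close> steps, because a set of size \<open>xi\<close> is contained in an
  earlier stage; iterating \<open>\<omega>\<close> times would not suffice.\<close>

lemma closure_exists:
  fixes F :: "'a set \<Rightarrow> 'a set" and xi :: "'b rel" and l :: "'c rel"
  assumes xi: "Cinfinite xi" and l: "Cinfinite l" "l ^c xi \<le>o l"
    and F: "\<And>X. |X| \<le>o xi \<Longrightarrow> |F X| \<le>o l" and FU: "\<And>X. F X \<subseteq> U"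
    and A: "|A| \<le>o l" "A \<subseteq> U"
  shows "\<exists>B. A \<subseteq> B \<and> B \<subseteq> U \<and> |B| \<le>o l \<and> (\<forall>X\<subseteq>B. |X| \<le>o xi \<longrightarrow> F X \<subseteq> B)"
proof -
  let ?r = "cardSuc xi"
  have r: "Card_order ?r" "Cinfinite ?r" "Well_order ?r"
    using xi cardSuc_Card_order Cinfinite_cardSuc cardSuc_Well_order by blast+
  interpret r: wo_rel ?r using r(3) unfolding wo_rel_def .
  have "?r \<le>o l" using cardSuc_least[OF _ _ ordLess_of_cexp[OF xi l]] xi l by blast
  then have Fr: "|Field ?r| \<le>o l"
    using card_of_Field_ordIso r(1) ordIso_ordLeq_trans by blast
  define H where "H D i = A \<union> (\<Union>X\<in>{X. X \<subseteq> (\<Union>j\<in>underS ?r i. D j) \<and> |X| \<le>o xi}. F X)" for D i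
  define D where "D = r.worec H"
  have "r.adm_wo H"
    unfolding r.adm_wo_def
  proof (intro allI impI)
    fix f g :: "'b set \<Rightarrow> 'a set" and i assume "\<forall>j\<in>underS ?r i. f j = g j"
    then have "(\<Union>j\<in>underS ?r i. f j) = (\<Union>j\<in>underS ?r i. g j)" by simp
    then show "H f i = H g i" unfolding H_def by simp
  qed
  then have D: "D i = A \<union> (\<Union>X\<in>{X. X \<subseteq> (\<Union>j\<in>underS ?r i. D j) \<and> |X| \<le>o xi}. F X)" for i
    using r.worec_fixpoint[of H] unfolding D_def[symmetric] by (metis H_def)
  have chain: "relChain ?r D"
    unfolding relChain_def
  proof (intro allI impI)
    fix i j assume ij: "(i, j) \<in> ?r"
    have "underS ?r i \<subseteq> underS ?r j"
      using underS_incr[OF r.TRANS r.ANTISYM ij] .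
    then have E: "(\<Union>k\<in>underS ?r i. D k) \<subseteq> (\<Union>k\<in>underS ?r j. D k)" by (rule UN_mono) simp
    show "D i \<subseteq> D j"
      unfolding D[of i] D[of j] by (intro Un_mono UN_mono subset_refl) (use E in blast)
  qed
  have Dl: "|D i| \<le>o l" for i
  proof (induction i rule: r.well_order_induct)
    case (1 i)
    let ?E = "\<Union>j\<in>underS ?r i. D j"
    have "|underS ?r i| \<le>o l"
      by (rule ordLeq_transitive[OF card_of_mono1 Fr]) (auto simp: underS_Field)
    moreover have "\<forall>j\<in>underS ?r i. |D j| \<le>o l" using 1 unfolding underS_def by blast
    ultimately have "|?E| \<le>o l" using UNION_Cinfinite_bound l(1) by blast
    then have "|{X. X \<subseteq> ?E \<and> |X| \<le>o xi}| \<le>o l" using card_bounded_subsets[OF xi l] by blast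
    moreover have "\<forall>X\<in>{X. X \<subseteq> ?E \<and> |X| \<le>o xi}. |F X| \<le>o l" using F by blast
    ultimately have "|\<Union>X\<in>{X. X \<subseteq> ?E \<and> |X| \<le>o xi}. F X| \<le>o l"
      using UNION_Cinfinite_bound l(1) by blast
    then show ?case unfolding D[of i] using Un_Cinfinite_bound[OF A(1) _ l(1)] by blast
  qed
  define B where "B = (\<Union>i\<in>Field ?r. D i)"
  have "Field ?r \<noteq> {}" using r(2) by (auto simp: cinfinite_def)
  moreover have "A \<subseteq> D i" for i unfolding D[of i] by blast
  ultimately have "A \<subseteq> B" unfolding B_def by blast
  moreover have "D i \<subseteq> U" for i unfolding D[of i] using A(2) FU by blast
  then have "B \<subseteq> U" unfolding B_def by blast
  moreover have "|B| \<le>o l" unfolding B_def using UNION_Cinfinite_bound Fr Dl l(1) by blast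
  moreover have "F X \<subseteq> B" if X: "X \<subseteq> B" "|X| \<le>o xi" for X
  proof -
    obtain i where i: "i \<in> Field ?r" "X \<subseteq> D i"
      using cardSuc_UNION[OF _ _ chain X(1)[unfolded B_def] X(2)] xi by (auto simp: cinfinite_def)
    \<comment> \<open>\<open>D i\<close> absorbs the values of \<open>F\<close> on subsets of
      strictly earlier stages only, so a later stage is needed to absorb \<open>F X\<close>.\<close>
    obtain j where j: "j \<in> Field ?r" "i \<noteq> j" "(i, j) \<in> ?r"
      using infinite_Card_order_limit[OF r(1) _ i(1)] r(2) by (auto simp: cinfinite_def)
    have "X \<subseteq> (\<Union>k\<in>underS ?r j. D k)" using i j unfolding underS_def by blast
    then have "F X \<subseteq> D j" unfolding D[of j] using X(2) by blast
    then show ?thesis using j unfolding B_def by blast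
  qed
  ultimately show ?thesis by blast
qed

context abelian_group
begin

text \<open>Covers are demanded for at most \<open>l\<close> pairs from
  \<open>\<G> \<times> Pow \<G>\<close>, which do not involve \<open>B\<close>; chosen covers can go
  into the starting set. The common point of a system of cosets depends on representatives from
  \<open>B\<close> itself, so it is supplied by the closure, along with differences. A system
  involves at most \<open>xi\<close> representatives.\<close>

lemma saturated_exists:
  fixes xi :: "'x rel" and l :: "'l rel"
  assumes xi: "Cinfinite xi" and l: "Cinfinite l" "l ^c xi \<le>o l"
    and \<G>: "|\<G>| \<le>o xi" "\<And>H. H \<in> \<G> \<Longrightarrow> additive_subgroup H G"
    and A: "A \<subseteq> carrier G" "|A| \<le>o l"
  shows "\<exists>B. A \<subseteq> B \<and> |B| \<le>o l \<and> additive_subgroup B G \<and> saturated G l \<G> B"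
proof -
  have xl: "xi \<le>o l" using ordLess_of_cexp[OF xi l] ordLess_imp_ordLeq by blast
  define cov where "cov p T \<longleftrightarrow> T \<subseteq> carrier G \<and> |T| \<le>o l \<and>
    (\<forall>a\<in>fst p. \<exists>t\<in>T. \<exists>C\<in>snd p. a \<ominus> t \<in> C)" for p :: "'a set \<times> 'a set set" and T
  \<comment> \<open>Where no cover of size \<open>l\<close> exists, the empty set keeps
    \<open>T p\<close> small and inside the group.\<close>
  define T where "T p = (if \<exists>T. cov p T then SOME T. cov p T else {})" for p
  have T: "cov p (T p)" if "cov p T'" for p T'
    using that someI[of "cov p" T'] unfolding T_def by auto
  have emp: "|{}::'a set| \<le>o l"
    by (rule finite_ordLeq_Cinfinite) (use l(1) in simp_all)
  have Tl: "|T p| \<le>o l \<and> T p \<subseteq> carrier G" for p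
  proof (cases "\<exists>T. cov p T")
    case True
    then show ?thesis using T unfolding cov_def by blast
  next
    case False
    then have "T p = {}" unfolding T_def by (rule if_not_P)
    then show ?thesis using emp by simp
  qed
  have P\<G>: "|Pow \<G>| \<le>o l" using card_Pow_le[OF xi l \<G>(1)] .
  have "|\<G> \<times> Pow \<G>| \<le>o l"
    by (rule card_Times_le[OF l(1) ordLeq_transitive[OF \<G>(1) xl] P\<G>])
  then have TT: "|\<Union>p\<in>\<G> \<times> Pow \<G>. T p| \<le>o l" using UNION_Cinfinite_bound Tl l(1) by blast
  define A' where "A' = A \<union> (\<Union>p\<in>\<G> \<times> Pow \<G>. T p) \<union> {\<zero>}"
  have "|{\<zero>}| \<le>o l"
    by (rule finite_ordLeq_Cinfinite) (use l(1) in simp_all)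
  then have A': "|A'| \<le>o l"
    unfolding A'_def by (intro Un_Cinfinite_bound A(2) TT l(1))
  have A'c: "A' \<subseteq> carrier G" using A(1) Tl unfolding A'_def by blast
  \<comment> \<open>\<open>P\<close> codes a system of cosets \<open>b + H\<close>, and
    \<open>f P\<close> is a point common to all of them if there is one.\<close>
  define f where "f P = (if \<exists>z\<in>carrier G. \<forall>(b, H)\<in>P. z \<ominus> b \<in> H
    then SOME z. z \<in> carrier G \<and> (\<forall>(b, H)\<in>P. z \<ominus> b \<in> H) else \<zero>)" for P
  have f: "f P \<in> carrier G \<and> (\<forall>(b, H)\<in>P. f P \<ominus> b \<in> H)"
    if "z \<in> carrier G" "\<forall>(b, H)\<in>P. z \<ominus> b \<in> H" for z P
    using that someI[of "\<lambda>z. z \<in> carrier G \<and> (\<forall>(b, H)\<in>P. z \<ominus> b \<in> H)" z]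
    unfolding f_def by auto
  have fc: "f P \<in> carrier G" for P
  proof (cases "\<exists>z\<in>carrier G. \<forall>(b, H)\<in>P. z \<ominus> b \<in> H")
    case False
    then have "f P = \<zero>" unfolding f_def by (rule if_not_P)
    then show ?thesis by simp
  qed (use f in blast)
  define F where "F X = (\<lambda>(x, y). x \<ominus> y) ` ((X \<inter> carrier G) \<times> (X \<inter> carrier G)) \<union> f ` Pow (X \<times> \<G>)" for X
  have "|F X| \<le>o l" if X: "|X| \<le>o xi" for X
  proof -
    have "|X \<inter> carrier G| \<le>o l" by (rule card_subset_le[OF Int_lower1 ordLeq_transitive[OF X xl]])
    then have "|(X \<inter> carrier G) \<times> (X \<inter> carrier G)| \<le>o l" by (intro card_Times_le l(1))
    moreover have "|Pow (X \<times> \<G>)| \<le>o l" by (rule card_Pow_le[OF xi l card_Times_le[OF xi X \<G>(1)]])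
    ultimately show ?thesis unfolding F_def by (intro Un_Cinfinite_bound card_image_le l(1))
  qed
  moreover have "F X \<subseteq> carrier G" for X using fc unfolding F_def by auto
  ultimately obtain B where B: "A' \<subseteq> B" "B \<subseteq> carrier G" "|B| \<le>o l"
    and cl: "\<And>X. X \<subseteq> B \<Longrightarrow> |X| \<le>o xi \<Longrightarrow> F X \<subseteq> B"
    using closure_exists[OF xi l, of F "carrier G" A', OF _ _ A' A'c] by blast
  have zB: "\<zero> \<in> B" using B(1) unfolding A'_def by blast
  have diff: "x \<ominus> y \<in> B" if "x \<in> B" "y \<in> B" for x y
  proof -
    have "|{x, y}| \<le>o xi"
      by (rule finite_ordLeq_Cinfinite) (use xi in simp_all)
    then have "F {x, y} \<subseteq> B" using cl[of "{x, y}"] that by simp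
    moreover have "x \<in> carrier G" "y \<in> carrier G" using that B(2) by blast+
    then have "x \<ominus> y \<in> F {x, y}" unfolding F_def by (intro UnI1 image_eqI[of _ _ "(x, y)"]) simp_all
    ultimately show ?thesis by blast
  qed
  have "additive_subgroup B G" by (rule additive_subgroup_diffI[OF B(2) zB diff])
  moreover have "saturated G l \<G> B"
    unfolding saturated_def
  proof (intro conjI allI ballI impI)
    fix S z assume S: "S \<subseteq> \<G>" and z: "z \<in> carrier G" and m: "\<forall>H\<in>S. \<exists>b\<in>B. z \<ominus> b \<in> H"
    then obtain g where g: "\<And>H. H \<in> S \<Longrightarrow> g H \<in> B \<and> z \<ominus> g H \<in> H" by metis
    \<comment> \<open>\<open>z\<close> shows that the chosen cosets have a common point. So
      \<open>f P\<close> is another one; it lies in \<open>B\<close> and is congruent to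
      \<open>z\<close> modulo every \<open>H\<close> in \<open>S\<close>.\<close>
    define P where "P = (\<lambda>H. (g H, H)) ` S"
    have "|g ` S| \<le>o xi"
      using ordLeq_transitive[OF card_of_image ordLeq_transitive[OF card_of_mono1[OF S] \<G>(1)]] .
    moreover have "g ` S \<subseteq> B" using g by blast
    ultimately have "F (g ` S) \<subseteq> B" using cl by simp
    moreover have "P \<subseteq> g ` S \<times> \<G>" using S unfolding P_def by blast
    then have "f P \<in> F (g ` S)" unfolding F_def by blast
    ultimately have fB: "f P \<in> B" by blast
    have "\<forall>(b, H)\<in>P. z \<ominus> b \<in> H" using g unfolding P_def by auto
    then have fP: "\<forall>(b, H)\<in>P. f P \<ominus> b \<in> H" using f z by blast
    have "z \<ominus> f P \<in> H" if H: "H \<in> S" for H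
    proof -
      have Hs: "additive_subgroup H G" using H S \<G>(2) by blast
      have gc: "g H \<in> carrier G" using g H B(2) by blast
      have "f P \<ominus> g H \<in> H" using fP H unfolding P_def by auto
      then have "g H \<ominus> f P \<in> H" using coset_sym[OF Hs fc gc] by blast
      then show ?thesis using coset_trans[OF Hs z gc fc] g[OF H] by blast
    qed
    then show "\<exists>b\<in>B. \<forall>H\<in>S. z \<ominus> b \<in> H" using fB by blast
  next
    fix A0 Q a
    assume A0: "A0 \<in> \<G>" and Q: "Q \<subseteq> \<G>" and a: "a \<in> A0"
      and ex: "\<exists>T\<subseteq>carrier G. |T| \<le>o l \<and> (\<forall>a\<in>A0. \<exists>t\<in>T. \<exists>C\<in>Q. a \<ominus> t \<in> C)"
    then have c: "cov (A0, Q) (T (A0, Q))" using T[of "(A0, Q)"] unfolding cov_def by auto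
    moreover have "T (A0, Q) \<subseteq> B" using B(1) A0 Q unfolding A'_def by blast
    moreover obtain t C where "t \<in> T (A0, Q)" "C \<in> Q" "a \<ominus> t \<in> C"
      using a c unfolding cov_def by auto
    ultimately show "\<exists>b\<in>B. \<exists>C\<in>Q. a \<ominus> b \<in> C" by blast
  qed
  moreover have "A \<subseteq> B" using B(1) unfolding A'_def by simp
  ultimately show ?thesis using B(3) by (intro exI[of _ B]) simp
qed

end

section \<open>Subgroups controlling infinitary formulas\<close>

text \<open>Tuples are indexed by all variables, so that subformulas with different free variables
  live in one group. The ring record is the format to which \<open>abelian_group\<close> and
  \<open>additive_subgroup\<close> apply.\<close>

definition assignments :: "('r, 'u) module \<Rightarrow> ('v \<Rightarrow> 'u) ring" where
  "assignments N = \<lparr>carrier = {a. range a \<subseteq> carrier N},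
     mult = (\<lambda>a b v. a v \<otimes>\<^bsub>N\<^esub> b v), one = (\<lambda>_. \<one>\<^bsub>N\<^esub>),
     zero = (\<lambda>_. \<zero>\<^bsub>N\<^esub>), add = (\<lambda>a b v. a v \<oplus>\<^bsub>N\<^esub> b v)\<rparr>"

lemma carrier_assignments: "a \<in> carrier (assignments N) \<longleftrightarrow> (\<forall>v. a v \<in> carrier N)"
  by (auto simp: assignments_def)

lemma zero_assignments: "\<zero>\<^bsub>assignments N\<^esub> = (\<lambda>_. \<zero>\<^bsub>N\<^esub>)"
  by (simp add: assignments_def)

lemma add_assignments: "a \<oplus>\<^bsub>assignments N\<^esub> b = (\<lambda>v. a v \<oplus>\<^bsub>N\<^esub> b v)"
  by (simp add: assignments_def)

context left_module
begin

lemma smult_diff: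
  assumes "r \<in> carrier R" "x \<in> carrier M" "y \<in> carrier M"
  shows "r \<odot>\<^bsub>M\<^esub> (x \<ominus>\<^bsub>M\<^esub> y) = r \<odot>\<^bsub>M\<^esub> x \<ominus>\<^bsub>M\<^esub> r \<odot>\<^bsub>M\<^esub> y"
proof -
  have "r \<odot>\<^bsub>M\<^esub> x = r \<odot>\<^bsub>M\<^esub> (x \<ominus>\<^bsub>M\<^esub> y) \<oplus>\<^bsub>M\<^esub> r \<odot>\<^bsub>M\<^esub> y"
    using smult_r_distr[of r "x \<ominus>\<^bsub>M\<^esub> y" y] assms by (simp add: M.diff_add_cancel)
  then show ?thesis using assms smult_closed by (simp add: M.add_diff_cancel)
qed

end

lemma abelian_group_assignments:
  fixes N :: "('r, 'u) module"
  assumes "left_module R N"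
  shows "abelian_group (assignments N)"
proof -
  interpret N: left_module R N by fact
  show ?thesis
  proof (rule abelian_groupI)
    fix a :: "'v \<Rightarrow> 'u" assume a: "a \<in> carrier (assignments N)"
    show "\<exists>b\<in>carrier (assignments N). b \<oplus>\<^bsub>assignments N\<^esub> a = \<zero>\<^bsub>assignments N\<^esub>"
      using a by (intro bexI[of _ "\<lambda>v. \<ominus>\<^bsub>N\<^esub> a v"])
        (auto simp: carrier_assignments add_assignments zero_assignments N.M.l_neg)
  qed (auto simp: carrier_assignments add_assignments zero_assignments
      intro!: ext N.M.a_assoc N.M.a_comm)
qed

lemma diff_assignments:
  fixes N :: "('r, 'u) module" and a :: "'v \<Rightarrow> 'u"
  assumes N: "left_module R N"
    and ab: "a \<in> carrier (assignments N)" "b \<in> carrier (assignments N)"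
  shows "(a \<ominus>\<^bsub>assignments N\<^esub> b) v = a v \<ominus>\<^bsub>N\<^esub> b v"
proof -
  interpret N: left_module R N by fact
  interpret V: abelian_group "assignments N :: ('v \<Rightarrow> 'u) ring" by (rule abelian_group_assignments[OF N])
  have "a \<ominus>\<^bsub>assignments N\<^esub> b \<in> carrier (assignments N)" using ab by simp
  moreover have "((a \<ominus>\<^bsub>assignments N\<^esub> b) \<oplus>\<^bsub>assignments N\<^esub> b) v = a v"
    using ab by (simp add: V.diff_add_cancel)
  ultimately show ?thesis
    using ab N.M.add_diff_cancel[of "(a \<ominus>\<^bsub>assignments N\<^esub> b) v" "b v"]
    by (simp add: carrier_assignments add_assignments)
qed

lemma term_value_closed:
  assumes "left_module R N" "a \<in> carrier (assignments N)" "is_term R t"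
  shows "term_value N t a \<in> carrier N"
proof -
  interpret N: left_module R N by fact
  show ?thesis using assms(2,3) by (induction t) (auto simp: carrier_assignments N.smult_closed)
qed

lemma term_value_diff:
  assumes N: "left_module R N"
    and ab: "a \<in> carrier (assignments N)" "b \<in> carrier (assignments N)" and "is_term R t"
  shows "term_value N t (a \<ominus>\<^bsub>assignments N\<^esub> b) = term_value N t a \<ominus>\<^bsub>N\<^esub> term_value N t b"
  using assms(4)
proof (induction t)
  interpret N: left_module R N by fact
  note cl = term_value_closed[OF N ab(1)] term_value_closed[OF N ab(2)]
  {
    case (TVar v)
    then show ?case using diff_assignments[OF N ab] by simp
  next
    case TZero
    then show ?case by (simp add: N.M.diff_self)
  next
    case (TPlus s t)
    then show ?case using cl[of s] cl[of t] by (simp add: N.M.add_diff_add)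
  next
    case (TMinus t)
    then show ?case
      using cl[of t] by (simp add: N.M.minus_diff) (simp add: a_minus_def N.M.a_comm)
  next
    case (TScalar r t)
    then show ?case using cl[of t] by (simp add: N.smult_diff)
  }
qed

text \<open>All operations are additive and zero is the only constant, so terms are additive
  functions of the assignment and an equation cuts out a subgroup, not merely a coset.\<close>

lemma additive_subgroup_solutions:
  fixes N :: "('r, 'u) module" and s t :: "('r, 'v) mod_term"
  assumes N: "left_module R N" and st: "is_term R s" "is_term R t"
  shows "additive_subgroup {a \<in> carrier (assignments N). term_value N s a = term_value N t a}
    (assignments N)"
proof -
  interpret N: left_module R N by fact
  interpret V: abelian_group "assignments N :: ('v \<Rightarrow> 'u) ring" by (rule abelian_group_assignments[OF N])
  have "term_value N u \<zero>\<^bsub>assignments N\<^esub> = \<zero>\<^bsub>N\<^esub>" if "is_term R u" for u :: "('r, 'v) mod_term"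
    using term_value_diff[OF N V.zero_closed V.zero_closed that]
      term_value_closed[OF N V.zero_closed that] by (simp add: V.diff_self N.M.diff_self)
  then show ?thesis
    using st by (intro V.additive_subgroup_diffI) (auto simp: term_value_diff[OF N])
qed

lemma additive_subgroup_vanishing:
  fixes N :: "('r, 'u) module" and V :: "'v set"
  assumes N: "left_module R N"
  shows "additive_subgroup {a \<in> carrier (assignments N). \<forall>v. v \<notin> V \<longrightarrow> a v = \<zero>\<^bsub>N\<^esub>} (assignments N)"
proof -
  interpret N: left_module R N by fact
  interpret V: abelian_group "assignments N :: ('v \<Rightarrow> 'u) ring" by (rule abelian_group_assignments[OF N])
  show ?thesis
  proof (rule V.additive_subgroup_diffI)
    show "\<zero>\<^bsub>assignments N\<^esub> \<in> {a \<in> carrier (assignments N). \<forall>v. v \<notin> V \<longrightarrow> a v = \<zero>\<^bsub>N\<^esub>}"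
      using V.zero_closed by (simp add: zero_assignments)
  qed (auto simp: diff_assignments[OF N] N.M.diff_self)
qed

text \<open>Turns quantification over the variables \<open>V\<close> into motion within a coset of
  the group \<open>W\<close>, the form in which \<open>same_cosets_extend\<close> handles
  it.\<close>

lemma reassigns_iff:
  fixes N :: "('r, 'u) module" and a :: "'v \<Rightarrow> 'u"
  assumes N: "left_module R N" and a: "a \<in> carrier (assignments N)"
  shows "reassigns N V a a' \<longleftrightarrow> a' \<in> carrier (assignments N) \<and>
    a' \<ominus>\<^bsub>assignments N\<^esub> a \<in> {a \<in> carrier (assignments N). \<forall>v. v \<notin> V \<longrightarrow> a v = \<zero>\<^bsub>N\<^esub>}"
    (is "?l \<longleftrightarrow> ?r")
proof -
  interpret N: left_module R N by fact
  interpret V: abelian_group "assignments N :: ('v \<Rightarrow> 'u) ring" by (rule abelian_group_assignments[OF N])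
  have eq: "x \<ominus>\<^bsub>N\<^esub> y = \<zero>\<^bsub>N\<^esub> \<longleftrightarrow> x = y" if "x \<in> carrier N" "y \<in> carrier N" for x y
    using that N.M.diff_add_cancel[of x y] N.M.diff_self[of y] by auto
  show ?thesis
  proof
    assume l: ?l
    then have "a' v \<in> carrier N" for v
      using assms(2) unfolding reassigns_def carrier_assignments by (cases "v \<in> V") auto
    then have "a' \<in> carrier (assignments N)" by (simp add: carrier_assignments)
    then show ?r using l assms(2) eq unfolding reassigns_def
      by (simp add: diff_assignments[OF N]) (simp add: carrier_assignments)
  next
    assume r: ?r
    then show ?l using assms(2) eq unfolding reassigns_def
      by (auto simp: diff_assignments[OF N] carrier_assignments)
  qed
qed

text \<open>The family comes before \<open>l\<close> and \<open>B\<close>, so one family serves all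
  of them. Enlarging \<open>\<G>\<close> strengthens the conditions on \<open>l\<close>,
  \<open>B\<close>, \<open>x\<close> and \<open>y\<close>; hence the families of the members of a
  conjunction may be merged.\<close>

definition controls ::
    "('r, 'u) module \<Rightarrow> ('v \<Rightarrow> 'u) set set \<Rightarrow> ('r, 'v) mod_formula \<Rightarrow> bool" where
  "controls N \<G> \<phi> \<longleftrightarrow>
     (\<forall>(l :: 'u rel) B x y. Cinfinite l \<and> |\<G>| \<le>o l \<and> additive_subgroup B (assignments N) \<and>
        |B| \<le>o l \<and> saturated (assignments N) l \<G> B \<and> x \<in> carrier (assignments N) \<and>
        y \<in> carrier (assignments N) \<and> same_cosets (assignments N) \<G> B x y \<longrightarrow>
        (satisfies N \<phi> x \<longleftrightarrow> satisfies N \<phi> y))"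

lemma controlsD:
  fixes N :: "('r, 'u) module" and l :: "'u rel"
  assumes "controls N \<G> \<phi>" "Cinfinite l" "|\<G>| \<le>o l" "additive_subgroup B (assignments N)"
    "|B| \<le>o l" "saturated (assignments N) l \<G> B" "x \<in> carrier (assignments N)"
    "y \<in> carrier (assignments N)" "same_cosets (assignments N) \<G> B x y"
  shows "satisfies N \<phi> x \<longleftrightarrow> satisfies N \<phi> y"
  using assms(1)[unfolded controls_def, rule_format, OF conjI, of l B x y] assms(2-9) by blast

lemma controlsI:
  fixes N :: "('r, 'u) module"
  assumes "\<And>(l :: 'u rel) B x y. Cinfinite l \<Longrightarrow> |\<G>| \<le>o l \<Longrightarrow>
    additive_subgroup B (assignments N) \<Longrightarrow> |B| \<le>o l \<Longrightarrow> saturated (assignments N) l \<G> B \<Longrightarrow>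
    x \<in> carrier (assignments N) \<Longrightarrow> y \<in> carrier (assignments N) \<Longrightarrow>
    same_cosets (assignments N) \<G> B x y \<Longrightarrow> satisfies N \<phi> x \<Longrightarrow> satisfies N \<phi> y"
  shows "controls N \<G> \<phi>"
  unfolding controls_def
proof (intro allI impI, elim conjE)
  fix l :: "'u rel" and B x y
  assume a: "cinfinite l" "Card_order l" "|\<G>| \<le>o l" "additive_subgroup B (assignments N)"
    "|B| \<le>o l" "saturated (assignments N) l \<G> B" "x \<in> carrier (assignments N)"
    "y \<in> carrier (assignments N)" "same_cosets (assignments N) \<G> B x y"
  have "same_cosets (assignments N) \<G> B y x" using a(9) unfolding same_cosets_def by simp
  then show "satisfies N \<phi> x \<longleftrightarrow> satisfies N \<phi> y"
    using assms[OF conjI[OF a(1,2)] a(3-6)] a(7-9) by (intro iffI) simp_all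
qed

lemma controls_mono:
  fixes N :: "('r, 'u) module"
  assumes "controls N \<G> \<phi>" "\<G> \<subseteq> \<G>'"
  shows "controls N \<G>' \<phi>"
proof (rule controlsI)
  fix l :: "'u rel" and B x y
  assume a: "Cinfinite l" "|\<G>'| \<le>o l" "additive_subgroup B (assignments N)"
    "|B| \<le>o l" "saturated (assignments N) l \<G>' B" "x \<in> carrier (assignments N)"
    "y \<in> carrier (assignments N)" "same_cosets (assignments N) \<G>' B x y" "satisfies N \<phi> x"
  from controlsD[OF assms(1) a(1) card_subset_le[OF assms(2) a(2)] a(3,4)
      saturated_mono[OF a(5) assms(2)] a(6,7) same_cosets_mono[OF a(8) assms(2)]] a(9)
  show "satisfies N \<phi> y" by simp
qed

lemma controls_FNot: "controls N \<G> \<phi> \<Longrightarrow> controls N \<G> (FNot \<phi>)"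
  unfolding controls_def satisfies.simps by meson

lemma controls_FAnd:
  fixes N :: "('r, 'u) module"
  assumes "\<And>i. i \<in> I \<Longrightarrow> controls N \<G> (F i)"
  shows "controls N \<G> (FAnd I F)"
proof (rule controlsI)
  fix l :: "'u rel" and B x y
  assume a: "Cinfinite l" "|\<G>| \<le>o l" "additive_subgroup B (assignments N)"
    "|B| \<le>o l" "saturated (assignments N) l \<G> B" "x \<in> carrier (assignments N)"
    "y \<in> carrier (assignments N)" "same_cosets (assignments N) \<G> B x y" "satisfies N (FAnd I F) x"
  show "satisfies N (FAnd I F) y" using controlsD[OF assms a(1-8)] a(9) by simp
qed

lemma controls_cong:
  assumes "controls N \<G> \<phi>" "satisfies N \<phi> = satisfies N \<psi>"
  shows "controls N \<G> \<psi>"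
  using assms unfolding controls_def by simp

lemma controls_FOr:
  assumes "\<And>i. i \<in> I \<Longrightarrow> controls N \<G> (F i)"
  shows "controls N \<G> (FOr I F)"
proof (rule controls_cong)
  show "controls N \<G> (FNot (FAnd I (\<lambda>i. FNot (F i))))"
    by (intro controls_FNot controls_FAnd assms)
qed auto

text \<open>A witness at \<open>x\<close> is a point of \<open>x + W\<close>. The back-and-forth
  step turns agreement of \<open>x\<close> and \<open>y\<close> on the closed family into a point of
  \<open>y + W\<close> that agrees with the witness on \<open>\<G>\<close>, and \<open>\<G>\<close>
  controls the body.\<close>

lemma controls_FEx:
  fixes N :: "('r, 'u) module" and V :: "'v set"
  assumes N: "left_module R N" and ctr: "controls N \<G> \<phi>"
    and \<G>: "\<And>H. H \<in> \<G> \<Longrightarrow> additive_subgroup H (assignments N)"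
  defines "W \<equiv> {a \<in> carrier (assignments N). \<forall>v. v \<notin> V \<longrightarrow> a v = \<zero>\<^bsub>N\<^esub>}"
  shows "controls N (quant_closure (assignments N) W \<G>) (FEx V \<phi>)"
proof (rule controlsI)
  interpret N: left_module R N by fact
  interpret V: abelian_group "assignments N :: ('v \<Rightarrow> 'u) ring" by (rule abelian_group_assignments[OF N])
  have W: "additive_subgroup W (assignments N)" unfolding W_def by (rule additive_subgroup_vanishing[OF N])
  have sub: "\<G> \<subseteq> quant_closure (assignments N) W \<G>" by (rule V.subset_quant_closure[OF \<G>])
  fix l :: "'u rel" and B x y
  assume l: "Cinfinite l" "|quant_closure (assignments N) W \<G>| \<le>o l"
    and B: "additive_subgroup B (assignments N)" "|B| \<le>o l"
    and sat: "saturated (assignments N) l (quant_closure (assignments N) W \<G>) B"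
    and xy: "x \<in> carrier (assignments N)" "y \<in> carrier (assignments N)"
    and same: "same_cosets (assignments N) (quant_closure (assignments N) W \<G>) B x y"
    and ex: "satisfies N (FEx V \<phi>) x"
  have \<G>l: "|\<G>| \<le>o l" by (rule card_subset_le[OF sub l(2)])
  obtain x' where x': "reassigns N V x x'" "satisfies N \<phi> x'" using ex by auto
  have x'c: "x' \<in> carrier (assignments N)" "x' \<ominus>\<^bsub>assignments N\<^esub> x \<in> W"
    using reassigns_iff[OF N xy(1)] x'(1) unfolding W_def by simp_all
  obtain y' where y': "y' \<in> carrier (assignments N)" "y' \<ominus>\<^bsub>assignments N\<^esub> y \<in> W"
    "same_cosets (assignments N) \<G> B x' y'"
    using V.same_cosets_extend[OF \<G> W B(1) sat l(1) B(2) \<G>l xy same x'c] by blast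
  have "reassigns N V y y'" using reassigns_iff[OF N xy(2)] y' unfolding W_def by simp
  moreover have "satisfies N \<phi> y'"
    using controlsD[OF ctr l(1) \<G>l B saturated_mono[OF sat sub] x'c(1) y'(1,3)] x'(2) by simp
  ultimately show "satisfies N (FEx V \<phi>) y" by auto
qed

lemma controls_FAll:
  fixes N :: "('r, 'u) module" and V :: "'v set"
  assumes "left_module R N" "controls N \<G> \<phi>"
    and "\<And>H. H \<in> \<G> \<Longrightarrow> additive_subgroup H (assignments N)"
  shows "controls N (quant_closure (assignments N)
    {a \<in> carrier (assignments N). \<forall>v. v \<notin> V \<longrightarrow> a v = \<zero>\<^bsub>N\<^esub>} \<G>) (FAll V \<phi>)"
proof (rule controls_cong)
  show "controls N (quant_closure (assignments N)
      {a \<in> carrier (assignments N). \<forall>v. v \<notin> V \<longrightarrow> a v = \<zero>\<^bsub>N\<^esub>} \<G>) (FNot (FEx V (FNot \<phi>)))"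
    by (rule controls_FNot, rule controls_FEx[OF assms(1) controls_FNot[OF assms(2)] assms(3)])
qed auto

section \<open>Sets below an inaccessible cardinal and bounds uniform in the module\<close>

lemma small_copy:
  assumes "|X| <o |UNIV :: 'u set|"
  shows "\<exists>Z :: 'u set. |X| =o |Z| \<and> small Z"
proof -
  obtain f :: "_ \<Rightarrow> 'u" where f: "inj_on f X"
    using iffD2[OF card_of_ordLeq ordLess_imp_ordLeq[OF assms]] by blast
  have iso: "|X| =o |f ` X|" by (rule card_of_ordIsoI[of f]) (rule inj_on_imp_bij_betw[OF f])
  moreover have "small (f ` X)"
    unfolding small_def by (rule ordIso_ordLess_trans[OF ordIso_symmetric[OF iso] assms])
  ultimately show ?thesis by blast
qed

lemma inaccessible_Cinfinite: "strongly_inaccessible k \<Longrightarrow> Cinfinite k"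
proof -
  assume k: "strongly_inaccessible k"
  then have "natLeq \<le>o k" "Card_order k"
    unfolding strongly_inaccessible_def using ordLess_imp_ordLeq by auto
  then show ?thesis using cinfinite_mono[OF _ natLeq_cinfinite] by blast
qed

lemma small_infinite_exists:
  assumes "strongly_inaccessible |UNIV :: 'u set|"
  shows "\<exists>Z :: 'u set. small Z \<and> infinite Z"
proof -
  have "natLeq <o |UNIV :: 'u set|" using assms unfolding strongly_inaccessible_def by simp
  moreover have "|UNIV :: nat set| =o natLeq"
    using card_of_Field_ordIso[OF natLeq_Card_order] by (simp add: Field_natLeq)
  ultimately have "|UNIV :: nat set| <o |UNIV :: 'u set|" using ordIso_ordLess_trans by blast
  then obtain Z :: "'u set" where Z: "|UNIV :: nat set| =o |Z|" "small Z" using small_copy by blast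
  then have "infinite Z" using card_of_ordIso_finite[OF Z(1)] by simp
  then show ?thesis using Z by blast
qed

lemma small_Pow:
  assumes "strongly_inaccessible |UNIV :: 'u set|" "small (Z :: 'u set)"
  shows "|Pow Z| <o |UNIV :: 'u set|"
  using assms unfolding strongly_inaccessible_def small_def by simp

lemma small_Sigma:
  fixes I :: "'u set" and F :: "'u \<Rightarrow> 'u set"
  assumes "strongly_inaccessible |UNIV :: 'u set|" "small I" "\<And>i. i \<in> I \<Longrightarrow> small (F i)"
  shows "|SIGMA i:I. F i| <o |UNIV :: 'u set|"
proof (rule stable_elim)
  show "stable |UNIV :: 'u set|"
    using assms(1) inaccessible_Cinfinite[OF assms(1)] unfolding strongly_inaccessible_def
    by (intro regularCard_stable) (auto simp: cinfinite_def)
qed (use assms in \<open>auto simp: small_def\<close>)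

lemma small_Un:
  fixes A B :: "'u set"
  assumes "strongly_inaccessible |UNIV :: 'u set|" "small A" "small B"
  shows "small (A \<union> B)"
  using Un_Cinfinite_bound_strict[OF _ _ inaccessible_Cinfinite[OF assms(1)]] assms(2,3)
  unfolding small_def by blast

lemma card_Pow_mono:
  assumes "|A| \<le>o |B|"
  shows "|Pow A| \<le>o |Pow B|"
proof -
  obtain f where f: "inj_on f A" "f ` A \<subseteq> B" using iffD2[OF card_of_ordLeq assms] by blast
  show ?thesis
  proof (rule card_of_ordLeqI)
    show "inj_on (\<lambda>X. f ` X) (Pow A)" by (rule inj_on_image_Pow[OF f(1)])
    show "f ` X \<in> Pow B" if "X \<in> Pow A" for X using that f(2) by blast
  qed
qed

lemma Cinfinite_card_of: "infinite Z \<Longrightarrow> Cinfinite |Z|"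
  by (intro conjI card_of_Card_order) (simp add: cinfinite_def Field_card_of)

lemma card_quant_closure:
  assumes "|\<G>| \<le>o |Z|" "infinite Z"
  shows "|quant_closure V W \<G>| \<le>o |Pow Z|"
proof -
  have "Cinfinite |Pow Z|" using assms(2) by (intro Cinfinite_card_of) (simp add: finite_Pow_iff)
  moreover have "|intersections V \<G>| \<le>o |Pow Z|"
    unfolding intersections_def by (rule card_image_le[OF card_Pow_mono[OF assms(1)]])
  ultimately show ?thesis
    unfolding quant_closure_def by (intro Un_Cinfinite_bound card_image_le)
qed

text \<open>The family may vary with \<open>N\<close>, but \<open>Z\<close> may not, because xi has
  to be chosen before the models. Sizes are measured by a set of type \<open>'u set\<close>, since
  the families themselves live in a higher type.\<close>

definition uniformly_controlled ::
    "('r, 'm) ring_scheme \<Rightarrow> 'u set \<Rightarrow> ('r, 'u) mod_formula \<Rightarrow> bool" where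
  "uniformly_controlled R Z \<phi> \<longleftrightarrow>
     (\<forall>N :: ('r, 'u) module. left_module R N \<longrightarrow>
        (\<exists>\<G>. (\<forall>H\<in>\<G>. additive_subgroup H (assignments N)) \<and> |\<G>| \<le>o |Z| \<and> controls N \<G> \<phi>))"

text \<open>A quantifier costs one power set, as \<open>quant_closure\<close> forms all
  intersections, and inaccessibility absorbs it. The assumption \<open>step\<close> lets both
  quantifiers share the argument.\<close>

lemma uniformly_controlled_quantifier:
  fixes \<phi> \<psi> :: "('r, 'u) mod_formula"
  assumes inacc: "strongly_inaccessible |UNIV :: 'u set|"
    and Z: "small Z" "infinite Z" "uniformly_controlled R Z \<phi>"
    and step: "\<And>(N :: ('r, 'u) module) \<G>. left_module R N \<Longrightarrow> controls N \<G> \<phi> \<Longrightarrow>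
      (\<And>H. H \<in> \<G> \<Longrightarrow> additive_subgroup H (assignments N)) \<Longrightarrow>
      controls N (quant_closure (assignments N)
        {a \<in> carrier (assignments N). \<forall>v. v \<notin> V \<longrightarrow> a v = \<zero>\<^bsub>N\<^esub>} \<G>) \<psi>"
  shows "\<exists>Z. small Z \<and> infinite Z \<and> uniformly_controlled R Z \<psi>"
proof -
  obtain Z' :: "'u set" where Z': "|Pow Z| =o |Z'|" "small Z'"
    using small_copy[OF small_Pow[OF inacc Z(1)]] by blast
  have "infinite Z'" using card_of_ordIso_finite[OF Z'(1)] Z(2) by (simp add: finite_Pow_iff)
  moreover have "uniformly_controlled R Z' \<psi>"
    unfolding uniformly_controlled_def
  proof (intro allI impI)
    fix N :: "('r, 'u) module" assume N: "left_module R N"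
    obtain \<G> where \<G>: "\<forall>H\<in>\<G>. additive_subgroup H (assignments N)" "|\<G>| \<le>o |Z|" "controls N \<G> \<phi>"
      using Z(3) N unfolding uniformly_controlled_def by blast
    let ?W = "{a \<in> carrier (assignments N). \<forall>v. v \<notin> V \<longrightarrow> a v = \<zero>\<^bsub>N\<^esub>}"
    let ?Q = "quant_closure (assignments N) ?W \<G>"
    interpret V: abelian_group "assignments N :: ('u \<Rightarrow> 'u) ring"
      by (rule abelian_group_assignments[OF N])
    have "\<forall>H\<in>?Q. additive_subgroup H (assignments N)"
      using V.additive_subgroup_quant_closure[OF _ additive_subgroup_vanishing[OF N]] \<G>(1) by blast
    moreover have "|?Q| \<le>o |Z'|"
      by (rule ordLeq_ordIso_trans[OF card_quant_closure[OF \<G>(2) Z(2)] Z'(1)])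
    moreover have "controls N ?Q \<psi>" using step[OF N \<G>(3)] \<G>(1) by simp
    ultimately show "\<exists>\<G>. (\<forall>H\<in>\<G>. additive_subgroup H (assignments N)) \<and> |\<G>| \<le>o |Z'| \<and>
      controls N \<G> \<psi>" by blast
  qed
  ultimately show ?thesis using Z'(2) by blast
qed

text \<open>The union of the families controls every member by monotonicity, and regularity of the
  universe keeps the disjoint union of a small collection of bounds small.\<close>

lemma uniformly_controlled_family:
  fixes F :: "'u \<Rightarrow> ('r, 'u) mod_formula"
  assumes inacc: "strongly_inaccessible |UNIV :: 'u set|" and I: "small I"
    and F: "\<And>i. i \<in> I \<Longrightarrow> \<exists>Z. small Z \<and> infinite Z \<and> uniformly_controlled R Z (F i)"
    and step: "\<And>(N :: ('r, 'u) module) \<G>. (\<And>i. i \<in> I \<Longrightarrow> controls N \<G> (F i)) \<Longrightarrow> controls N \<G> \<psi>"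
  shows "\<exists>Z. small Z \<and> infinite Z \<and> uniformly_controlled R Z \<psi>"
proof -
  obtain Zf where Zf: "\<And>i. i \<in> I \<Longrightarrow> small (Zf i) \<and> infinite (Zf i) \<and> uniformly_controlled R (Zf i) (F i)"
    using F by metis
  \<comment> \<open>\<open>Z0\<close> keeps the bound infinite when \<open>I\<close> is
    empty.\<close>
  obtain Z0 :: "'u set" where Z0: "small Z0" "infinite Z0"
    using small_infinite_exists[OF inacc] by blast
  have "|SIGMA i:I. Zf i| <o |UNIV :: 'u set|"
    by (rule small_Sigma[OF inacc I]) (simp add: Zf)
  then obtain Z1 :: "'u set" where Z1: "|SIGMA i:I. Zf i| =o |Z1|" "small Z1"
    using small_copy by blast
  have "uniformly_controlled R (Z0 \<union> Z1) \<psi>"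
    unfolding uniformly_controlled_def
  proof (intro allI impI)
    fix N :: "('r, 'u) module" assume N: "left_module R N"
    have "\<exists>\<G>. (\<forall>H\<in>\<G>. additive_subgroup H (assignments N)) \<and> |\<G>| \<le>o |Zf i| \<and> controls N \<G> (F i)"
      if "i \<in> I" for i using Zf[OF that] N unfolding uniformly_controlled_def by blast
    then obtain Gf where Gf: "\<And>i. i \<in> I \<Longrightarrow> (\<forall>H\<in>Gf i. additive_subgroup H (assignments N)) \<and>
        |Gf i| \<le>o |Zf i| \<and> controls N (Gf i) (F i)" by metis
    let ?G = "\<Union>i\<in>I. Gf i"
    have "|?G| \<le>o |SIGMA i:I. Gf i|" by (rule card_of_UNION_Sigma)
    also have "|SIGMA i:I. Gf i| \<le>o |SIGMA i:I. Zf i|"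
      by (rule card_of_Sigma_mono1) (simp add: Gf)
    also note Z1(1)
    also have "|Z1| \<le>o |Z0 \<union> Z1|" by (rule card_of_mono1) simp
    finally have "|?G| \<le>o |Z0 \<union> Z1|" .
    moreover have "controls N ?G \<psi>"
    proof (rule step)
      fix i assume i: "i \<in> I"
      show "controls N ?G (F i)" by (rule controls_mono[of _ "Gf i"]) (use Gf[OF i] i in auto)
    qed
    moreover have "\<forall>H\<in>?G. additive_subgroup H (assignments N)" using Gf by blast
    ultimately show "\<exists>\<G>. (\<forall>H\<in>\<G>. additive_subgroup H (assignments N)) \<and> |\<G>| \<le>o |Z0 \<union> Z1| \<and>
      controls N \<G> \<psi>" by blast
  qed
  moreover have "small (Z0 \<union> Z1)" by (rule small_Un[OF inacc Z0(1) Z1(2)])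
  ultimately show ?thesis using Z0(2) by blast
qed

proposition formula_uniformly_controlled:
  fixes \<phi> :: "('r, 'u) mod_formula"
  assumes inacc: "strongly_inaccessible |UNIV :: 'u set|" and \<nu>0: "small_card \<nu>0"
    and "in_logic R \<nu>0 \<nu>1 \<phi>"
  shows "\<exists>Z. small Z \<and> infinite Z \<and> uniformly_controlled R Z \<phi>"
  using assms(3)
proof (induction \<phi>)
  case (FEq s t)
  obtain Z :: "'u set" where Z: "small Z" "infinite Z" using small_infinite_exists[OF inacc] by blast
  have "uniformly_controlled R Z (FEq s t)"
    unfolding uniformly_controlled_def
  proof (intro allI impI)
    fix N :: "('r, 'u) module" assume N: "left_module R N"
    let ?H = "{a \<in> carrier (assignments N). term_value N s a = term_value N t a}"
    have "additive_subgroup ?H (assignments N)"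
      by (rule additive_subgroup_solutions[OF N]) (use FEq in simp_all)
    moreover have "|{?H}| \<le>o |Z|"
      by (rule finite_ordLeq_Cinfinite[OF _ Cinfinite_card_of[OF Z(2)]]) simp
    moreover have "controls N {?H} (FEq s t)"
    proof (rule controlsI)
      fix l :: "'u rel" and B x y
      assume B: "additive_subgroup B (assignments N)" and xy: "x \<in> carrier (assignments N)"
        "y \<in> carrier (assignments N)" and same: "same_cosets (assignments N) {?H} B x y"
        and sat: "satisfies N (FEq s t) x"
      interpret V: abelian_group "assignments N :: ('u \<Rightarrow> 'u) ring"
        by (rule abelian_group_assignments[OF N])
      \<comment> \<open>The equation holds at \<open>x\<close> exactly when \<open>x\<close> lies in
        the coset of zero, which is among the compared cosets because the subgroup \<open>B\<close>
        contains zero.\<close>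
      have "x \<ominus>\<^bsub>assignments N\<^esub> \<zero>\<^bsub>assignments N\<^esub> \<in> ?H"
        using V.diff_zero[OF xy(1)] xy(1) sat by simp
      then have "y \<ominus>\<^bsub>assignments N\<^esub> \<zero>\<^bsub>assignments N\<^esub> \<in> ?H"
        using same[unfolded same_cosets_def, rule_format, OF singletonI
            additive_subgroup.zero_closed[OF B]] by simp
      then show "satisfies N (FEq s t) y" using V.diff_zero[OF xy(2)] by simp
    qed
    ultimately show "\<exists>\<G>. (\<forall>H\<in>\<G>. additive_subgroup H (assignments N)) \<and> |\<G>| \<le>o |Z| \<and>
      controls N \<G> (FEq s t)" by (intro exI[of _ "{?H}"]) simp
  qed
  then show ?case using Z by blast
next
  case (FNot \<phi>)
  then obtain Z where "small Z" "infinite Z" "uniformly_controlled R Z \<phi>" by auto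
  then show ?case using controls_FNot unfolding uniformly_controlled_def by metis
next
  case (FAnd I F)
  have I: "small I"
    using FAnd.prems ordLess_transitive \<nu>0 unfolding small_def small_card_def by auto
  show ?case
  proof (rule uniformly_controlled_family[OF inacc I])
    show "\<exists>Z. small Z \<and> infinite Z \<and> uniformly_controlled R Z (F i)" if "i \<in> I" for i
      using FAnd.IH[of "F i"] FAnd.prems that by simp
  qed (rule controls_FAnd)
next
  case (FOr I F)
  have I: "small I"
    using FOr.prems ordLess_transitive \<nu>0 unfolding small_def small_card_def by auto
  show ?case
  proof (rule uniformly_controlled_family[OF inacc I])
    show "\<exists>Z. small Z \<and> infinite Z \<and> uniformly_controlled R Z (F i)" if "i \<in> I" for i
      using FOr.IH[of "F i"] FOr.prems that by simp
  qed (rule controls_FOr)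
next
  case (FEx V \<phi>)
  then obtain Z where Z: "small Z" "infinite Z" "uniformly_controlled R Z \<phi>" by auto
  show ?case
    by (rule uniformly_controlled_quantifier[OF inacc Z, where V = V]) (rule controls_FEx; simp)
next
  case (FAll V \<phi>)
  then obtain Z where Z: "small Z" "infinite Z" "uniformly_controlled R Z \<phi>" by auto
  show ?case
    by (rule uniformly_controlled_quantifier[OF inacc Z, where V = V]) (rule controls_FAll; simp)
qed

section \<open>Orbital types\<close>

lemma substructure_submodule:
  assumes "left_module R M" "left_module R N" "substructure R M N"
  shows "submodule (carrier M) R N"
proof -
  interpret M: left_module R M by fact
  interpret N: left_module R N by fact
  note sub = assms(3)[unfolded substructure_def]
  show ?thesis
  proof (intro submodule.intro group.subgroupI submodule_axioms.intro)
    show "group (add_monoid N)" by (rule N.M.a_group)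
    show "carrier M \<subseteq> carrier (add_monoid N)" using sub by simp
    show "carrier M \<noteq> {}" using M.M.zero_closed by blast
    show "inv\<^bsub>add_monoid N\<^esub> a \<in> carrier M" if "a \<in> carrier M" for a
      using M.M.a_inv_closed[OF that] sub that by (simp add: a_inv_def[of N, symmetric])
    show "a \<otimes>\<^bsub>add_monoid N\<^esub> b \<in> carrier M" if "a \<in> carrier M" "b \<in> carrier M" for a b
      using M.M.a_closed[OF that] sub that by simp
    show "r \<odot>\<^bsub>N\<^esub> x \<in> carrier M" if "r \<in> carrier R" "x \<in> carrier M" for r x
      using M.smult_closed[OF that] sub that by simp
  qed
qed

lemma submodule_substructure:
  assumes "left_module R N" "submodule H R N"
  shows "substructure R (N\<lparr>carrier := H\<rparr>) N"
proof -
  interpret N: left_module R N by fact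
  interpret H: submodule H R N by fact
  have "\<ominus>\<^bsub>N\<lparr>carrier := H\<rparr>\<^esub> x = \<ominus>\<^bsub>N\<^esub> x" if "x \<in> H" for x
    using group.m_inv_consistent[OF N.M.a_group H.subgroup_axioms that] by (simp add: a_inv_def)
  then show ?thesis using H.subset unfolding substructure_def by auto
qed

context
  fixes R :: "('r, 'm) ring_scheme" and K :: "('r, 'u) module set" and sub
  assumes ac: "abstract_class R K sub"
begin

lemmas abstract_class_conjuncts = ac[unfolded abstract_class_def, THEN conjunct2]

lemma abstract_class_module: "M \<in> K \<Longrightarrow> left_module R M"
  and abstract_class_small: "M \<in> K \<Longrightarrow> small (carrier M)"
  by (rule conjunct1[OF bspec[OF conjunct1[OF abstract_class_conjuncts]]], assumption)
    (rule conjunct2[OF bspec[OF conjunct1[OF abstract_class_conjuncts]]])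

lemma abstract_class_sub:
  assumes "sub M N"
  shows "M \<in> K" "N \<in> K" "substructure R M N"
proof -
  have "M \<in> K \<and> N \<in> K \<and> substructure R M N"
    using abstract_class_conjuncts[THEN conjunct2, THEN conjunct1, THEN spec, THEN spec, THEN mp, OF assms] .
  then show "M \<in> K" "N \<in> K" "substructure R M N" by blast+
qed

lemma abstract_class_refl: "M \<in> K \<Longrightarrow> sub M M"
  by (rule abstract_class_conjuncts[THEN conjunct2, THEN conjunct2, THEN conjunct1, THEN bspec])

lemma abstract_class_trans: "sub M N \<Longrightarrow> sub N P \<Longrightarrow> sub M P"
  by (rule abstract_class_conjuncts[THEN conjunct2, THEN conjunct2, THEN conjunct2, THEN conjunct1,
        THEN spec, THEN spec, THEN spec, THEN mp, OF conjI])

lemma abstract_class_iso: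
  assumes "N \<in> K" "mod_isomorphism R f N N'"
  shows "N' \<in> K"
    and "sub M N \<Longrightarrow> substructure R M' N' \<Longrightarrow> carrier M' = f ` carrier M \<Longrightarrow> sub M' N'"
proof -
  note iso = abstract_class_conjuncts[THEN conjunct2, THEN conjunct2, THEN conjunct2, THEN conjunct2,
      THEN bspec, OF assms(1), THEN spec, THEN spec, THEN mp, OF assms(2)]
  show "N' \<in> K" by (rule conjunct1[OF iso])
  assume "sub M N" "substructure R M' N'" "carrier M' = f ` carrier M"
  then have "M' \<in> K \<and> sub M' N'"
    by (intro conjunct2[OF iso, THEN spec, THEN spec, THEN mp] conjI)
  then show "sub M' N'" by (rule conjunct2)
qed

lemma sub_submodule:
  assumes "sub M N"
  shows "submodule (carrier M) R N"
  by (intro substructure_submodule abstract_class_module abstract_class_sub[OF assms])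

text \<open>\<open>M\<close> and the restricted record may differ outside the carrier. Closure under
  isomorphism, applied to the identity of \<open>N\<close>, passes from one to the other.\<close>

lemma sub_restrict:
  assumes MN: "sub M N"
  shows "sub (N\<lparr>carrier := carrier M\<rparr>) N"
proof (rule abstract_class_iso(2))
  note M = abstract_class_sub[OF MN]
  show "N \<in> K" by (rule M(2))
  show "mod_isomorphism R (\<lambda>x. x) N N"
    unfolding mod_isomorphism_def mod_embedding_def by simp
  show "substructure R (N\<lparr>carrier := carrier M\<rparr>) N"
    by (rule submodule_substructure[OF abstract_class_module[OF M(2)] sub_submodule[OF MN]])
qed (use MN in simp_all)

lemma K_embedding_inclusion:
  assumes MN: "sub M N"
  shows "K_embedding R K sub (\<lambda>x. x) M N"
proof -
  note M = abstract_class_sub[OF MN]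
  then have "mod_embedding R (\<lambda>x. x) M N"
    unfolding substructure_def mod_embedding_def by auto
  then show ?thesis
    using M sub_restrict[OF MN] unfolding K_embedding_def by simp
qed

lemma E_at_embedding:
  assumes f: "K_embedding R K sub f N N'"
    and b: "b \<in> carrier N" and A: "A \<subseteq> carrier N" "\<forall>a\<in>A. f a = a"
  shows "((b, A, N), (f b, A, N')) \<in> E_at R K sub"
proof -
  have N: "N \<in> K" "N' \<in> K" "f ` carrier N \<subseteq> carrier N'"
    using f unfolding K_embedding_def mod_embedding_def by auto
  have id: "K_embedding R K sub (\<lambda>x. x) N' N'"
    by (rule K_embedding_inclusion[OF abstract_class_refl[OF N(2)]])
  have "A \<subseteq> carrier N'" using N(3) A by force
  moreover have "f b \<in> carrier N'" using N(3) b by blast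
  moreover have "\<exists>P f1 f2. K_embedding R K sub f1 N P \<and> K_embedding R K sub f2 N' P \<and>
      f1 b = f2 (f b) \<and> (\<forall>a\<in>A. f1 a = a \<and> f2 a = a)"
    using f id A(2) by (intro exI[of _ N'] exI[of _ f] exI[of _ "\<lambda>x. x"]) simp
  ultimately show ?thesis
    using N(1,2) b A(1) unfolding E_at_def type_triples_def by simp
qed

end

lemma E_at_sym: "sym (E_at R K sub)"
  unfolding sym_def E_at_def by (auto, metis)

lemma ortp_eqI:
  assumes "((b, A, N), (b', A', N')) \<in> (E_at R K sub)\<^sup>+"
  shows "ortp R K sub b A N = ortp R K sub b' A' N'"
proof -
  have "sym ((E_at R K sub)\<^sup>+)" by (rule sym_trancl[OF E_at_sym])
  then show ?thesis
    using assms unfolding ortp_def by (auto dest: symD intro: trancl_trans)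
qed

text \<open>Each link of the chain restricts by shrinking the set on which the two embeddings have
  to be the identity. The conjunct on the middle component carries the induction.\<close>

lemma E_at_restrict:
  assumes "((b, A, N), t) \<in> (E_at R K sub)\<^sup>+" "B \<subseteq> A"
  shows "((b, B, N), (fst t, B, snd (snd t))) \<in> (E_at R K sub)\<^sup>+ \<and> fst (snd t) = A"
proof -
  have one: "((b, B, N), (b', B, N')) \<in> E_at R K sub \<and> A' = A"
    if at: "((b, A, N), (b', A', N')) \<in> E_at R K sub" for b N b' A' N'
  proof -
    obtain P f1 f2 where "A' = A" "N \<in> K" "N' \<in> K" "A \<subseteq> carrier N" "A \<subseteq> carrier N'"
        "b \<in> carrier N" "b' \<in> carrier N'" "K_embedding R K sub f1 N P" "K_embedding R K sub f2 N' P"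
        "f1 b = f2 b'" "\<forall>a\<in>A. f1 a = a \<and> f2 a = a"
      using at unfolding E_at_def type_triples_def by auto
    moreover from this have "\<exists>P f1 f2. K_embedding R K sub f1 N P \<and> K_embedding R K sub f2 N' P \<and>
        f1 b = f2 b' \<and> (\<forall>a\<in>B. f1 a = a \<and> f2 a = a)"
      using assms(2) by (intro exI[of _ P] exI[of _ f1] exI[of _ f2]) auto
    ultimately show ?thesis using assms(2) unfolding E_at_def type_triples_def by auto
  qed
  show ?thesis
    using assms(1)
  proof (induction rule: trancl_induct)
    case (base t)
    then show ?case using one[of b N "fst t" "fst (snd t)" "snd (snd t)"] by auto
  next
    case (step t u)
    obtain b1 A1 N1 where t: "t = (b1, A1, N1)" by (cases t)
    obtain b2 A2 N2 where u: "u = (b2, A2, N2)" by (cases u)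
    have "((b1, B, N1), (b2, B, N2)) \<in> E_at R K sub \<and> A2 = A"
      using one[of b1 N1 b2 A2 N2] step(2,3) t u by simp
    then show ?case using step(3) trancl.trancl_into_trancl t u by auto
  qed
qed

text \<open>\<open>the_elem\<close> needs a singleton: reflexivity of \<open>E_at\<close> makes the
  class nonempty, and restriction along chains makes the image constant.\<close>

lemma ortp_restrict_ortp:
  assumes ac: "abstract_class R K sub" and N: "N \<in> K" and b: "b \<in> carrier N"
    and A: "A \<subseteq> carrier N" "B \<subseteq> A"
  shows "ortp_restrict R K sub (ortp R K sub b A N) B = ortp R K sub b B N"
proof -
  let ?p = "ortp R K sub b A N"
  have "((b, A, N), (b, A, N)) \<in> E_at R K sub"
    using E_at_embedding[OF ac K_embedding_inclusion[OF ac abstract_class_refl[OF ac N]] b A(1)] by simp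
  then have ne: "(b, A, N) \<in> ?p" unfolding ortp_def by auto
  have eq: "ortp R K sub b' B N' = ortp R K sub b B N" if "(b', A', N') \<in> ?p" for b' A' N'
  proof -
    have "((b, A, N), (b', A', N')) \<in> (E_at R K sub)\<^sup>+" using that unfolding ortp_def by simp
    then have "((b, B, N), (b', B, N')) \<in> (E_at R K sub)\<^sup>+"
      using E_at_restrict[OF _ A(2), of b N "(b', A', N')" R K sub] by simp
    then show ?thesis using ortp_eqI by metis
  qed
  have "(\<lambda>(b, A, N). ortp R K sub b B N) ` ?p = {ortp R K sub b B N}"
  proof
    show "(\<lambda>(b, A, N). ortp R K sub b B N) ` ?p \<subseteq> {ortp R K sub b B N}" using eq by auto
    show "{ortp R K sub b B N} \<subseteq> (\<lambda>(b, A, N). ortp R K sub b B N) ` ?p"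
      using imageI[OF ne, of "\<lambda>(b, A, N). ortp R K sub b B N"] by simp
  qed
  then show ?thesis unfolding ortp_restrict_def by simp
qed

text \<open>The equations \<open>u = atomic_rhs s v w\<close> are the diagram of a tuple; \<open>u = v\<close> occurs among them as
  \<open>u = 1 v\<close>.\<close>

fun atomic_rhs :: "'r mod_symbol \<Rightarrow> 'v \<Rightarrow> 'v \<Rightarrow> ('r, 'v) mod_term" where
  "atomic_rhs SZero v w = TZero"
| "atomic_rhs SPlus v w = TPlus (TVar v) (TVar w)"
| "atomic_rhs SMinus v w = TMinus (TVar v)"
| "atomic_rhs (SScalar r) v w = TScalar r (TVar v)"

text \<open>With these groups in the family, agreement on the cosets of zero means that two
  assignments satisfy the same diagram equations on \<open>X\<close>.\<close>

definition atomic_solutions ::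
    "('r, 'm) ring_scheme \<Rightarrow> ('r, 'u) module \<Rightarrow> 'v set \<Rightarrow> ('v \<Rightarrow> 'u) set set" where
  "atomic_solutions R N X =
     (\<lambda>(s, u, v, w). {a \<in> carrier (assignments N). term_value N (TVar u) a = term_value N (atomic_rhs s v w) a}) `
       (mod_language R \<times> X \<times> X \<times> X)"

lemma additive_subgroup_atomic_solutions:
  assumes "left_module R N" "H \<in> atomic_solutions R N X"
  shows "additive_subgroup H (assignments N)"
proof -
  obtain s u v w where s: "s \<in> mod_language R"
    and H: "H = {a \<in> carrier (assignments N). term_value N (TVar u) a = term_value N (atomic_rhs s v w) a}"
    using assms(2) unfolding atomic_solutions_def by auto
  have "is_term R (atomic_rhs s v w)" using s by (cases s) (auto simp: mod_language_def)
  then show ?thesis unfolding H by (intro additive_subgroup_solutions[OF assms(1)]) simp_all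
qed

text \<open>The image of \<open>X\<close> under \<open>a\<close> is closed under the operations, so
  the value of an operation on entries is again an entry, and equations with one operation determine
  the structure. The same indices show that the image under \<open>a'\<close> is closed. Sending
  \<open>a v\<close> to \<open>a' v\<close> is well defined and injective by
  \<open>eq\<close>.\<close>

lemma diagram_isomorphism:
  assumes N: "left_module R N" and X: "a ` X \<subseteq> carrier N" "a' ` X \<subseteq> carrier N"
    and sm: "submodule (a ` X) R N"
    and diag: "\<And>s u v w. s \<in> mod_language R \<Longrightarrow> u \<in> X \<Longrightarrow> v \<in> X \<Longrightarrow> w \<in> X \<Longrightarrow>
      a u = term_value N (atomic_rhs s v w) a \<longleftrightarrow> a' u = term_value N (atomic_rhs s v w) a'"
  shows "submodule (a' ` X) R N"
    and "\<exists>f. mod_isomorphism R f (N\<lparr>carrier := a ` X\<rparr>) (N\<lparr>carrier := a' ` X\<rparr>) \<and> (\<forall>v\<in>X. f (a v) = a' v)"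
proof -
  interpret N: left_module R N by fact
  interpret S: submodule "a ` X" R N by fact
  have one: "SScalar \<one>\<^bsub>R\<^esub> \<in> mod_language R" unfolding mod_language_def by simp
  have eq: "a u = a v \<longleftrightarrow> a' u = a' v" if "u \<in> X" "v \<in> X" for u v
    using diag[OF one that that(2)] X that by (simp add: N.smult_one image_subset_iff)
  obtain v0 where v0: "v0 \<in> X" using S.one_closed by auto
  have zero: "\<exists>u\<in>X. a u = \<zero>\<^bsub>N\<^esub> \<and> a' u = \<zero>\<^bsub>N\<^esub>"
  proof -
    obtain u where u: "u \<in> X" "a u = \<zero>\<^bsub>N\<^esub>" using S.one_closed by auto
    then show ?thesis using diag[of SZero u v0 v0] v0 by (auto simp: mod_language_def)
  qed
  have add: "\<exists>u\<in>X. a u = a v \<oplus>\<^bsub>N\<^esub> a w \<and> a' u = a' v \<oplus>\<^bsub>N\<^esub> a' w" if "v \<in> X" "w \<in> X" for v w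
  proof -
    have "a v \<oplus>\<^bsub>N\<^esub> a w \<in> a ` X" using S.m_closed[of "a v" "a w"] that by simp
    then obtain u where u: "u \<in> X" "a u = a v \<oplus>\<^bsub>N\<^esub> a w" by auto
    then show ?thesis using diag[of SPlus u v w] that by (auto simp: mod_language_def)
  qed
  have neg: "\<exists>u\<in>X. a u = \<ominus>\<^bsub>N\<^esub> a v \<and> a' u = \<ominus>\<^bsub>N\<^esub> a' v" if "v \<in> X" for v
  proof -
    have "\<ominus>\<^bsub>N\<^esub> a v \<in> a ` X" using S.m_inv_closed[of "a v"] that by (simp add: a_inv_def)
    then obtain u where u: "u \<in> X" "a u = \<ominus>\<^bsub>N\<^esub> a v" by auto
    then show ?thesis using diag[of SMinus u v v] that by (auto simp: mod_language_def)
  qed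
  have smult: "\<exists>u\<in>X. a u = r \<odot>\<^bsub>N\<^esub> a v \<and> a' u = r \<odot>\<^bsub>N\<^esub> a' v" if "v \<in> X" "r \<in> carrier R" for v r
  proof -
    have "r \<odot>\<^bsub>N\<^esub> a v \<in> a ` X" using S.smult_closed[of r "a v"] that by simp
    then obtain u where u: "u \<in> X" "a u = r \<odot>\<^bsub>N\<^esub> a v" by auto
    then show ?thesis using diag[of "SScalar r" u v v] that by (auto simp: mod_language_def)
  qed
  show sm': "submodule (a' ` X) R N"
  proof (intro submodule.intro group.subgroupI submodule_axioms.intro)
    show "group (add_monoid N)" by (rule N.M.a_group)
    show "a' ` X \<subseteq> carrier (add_monoid N)" using X by simp
    show "a' ` X \<noteq> {}" using v0 by blast
    show "inv\<^bsub>add_monoid N\<^esub> x \<in> a' ` X" if "x \<in> a' ` X" for x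
      using that neg by (auto simp: a_inv_def[of N, symmetric]) (metis imageI)
    show "x \<otimes>\<^bsub>add_monoid N\<^esub> y \<in> a' ` X" if "x \<in> a' ` X" "y \<in> a' ` X" for x y
      using that add by auto (metis imageI)
    show "r \<odot>\<^bsub>N\<^esub> x \<in> a' ` X" if "r \<in> carrier R" "x \<in> a' ` X" for r x
      using that smult by auto (metis imageI)
  qed
  define f where "f x = a' (SOME v. v \<in> X \<and> a v = x)" for x
  have f: "f (a v) = a' v" if v: "v \<in> X" for v
  proof -
    have "(SOME w. w \<in> X \<and> a w = a v) \<in> X \<and> a (SOME w. w \<in> X \<and> a w = a v) = a v"
      by (rule someI[of "\<lambda>w. w \<in> X \<and> a w = a v" v]) (simp add: v)
    then show ?thesis unfolding f_def using eq v by blast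
  qed
  have inv: "\<ominus>\<^bsub>N\<lparr>carrier := a ` X\<rparr>\<^esub> a v = \<ominus>\<^bsub>N\<^esub> a v" "\<ominus>\<^bsub>N\<lparr>carrier := a' ` X\<rparr>\<^esub> a' v = \<ominus>\<^bsub>N\<^esub> a' v"
    if "v \<in> X" for v
    using submodule_substructure[OF N sm] submodule_substructure[OF N sm'] that
    unfolding substructure_def by simp_all
  have "mod_isomorphism R f (N\<lparr>carrier := a ` X\<rparr>) (N\<lparr>carrier := a' ` X\<rparr>)"
    unfolding mod_isomorphism_def mod_embedding_def
  proof (intro conjI)
    show img: "f ` carrier (N\<lparr>carrier := a ` X\<rparr>) = carrier (N\<lparr>carrier := a' ` X\<rparr>)"
      using f by (force simp: image_iff)
    then show "f ` carrier (N\<lparr>carrier := a ` X\<rparr>) \<subseteq> carrier (N\<lparr>carrier := a' ` X\<rparr>)" by simp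
    show "inj_on f (carrier (N\<lparr>carrier := a ` X\<rparr>))" using f eq by (auto simp: inj_on_def)
    obtain u where "u \<in> X" "a u = \<zero>\<^bsub>N\<^esub>" "a' u = \<zero>\<^bsub>N\<^esub>" using zero by blast
    then show "f \<zero>\<^bsub>N\<lparr>carrier := a ` X\<rparr>\<^esub> = \<zero>\<^bsub>N\<lparr>carrier := a' ` X\<rparr>\<^esub>" using f[of u] by simp
    have "f (a v \<oplus>\<^bsub>N\<^esub> a w) = f (a v) \<oplus>\<^bsub>N\<^esub> f (a w)" if "v \<in> X" "w \<in> X" for v w
      using add[OF that] f that by metis
    then show "\<forall>x\<in>carrier (N\<lparr>carrier := a ` X\<rparr>). \<forall>y\<in>carrier (N\<lparr>carrier := a ` X\<rparr>).
        f (x \<oplus>\<^bsub>N\<lparr>carrier := a ` X\<rparr>\<^esub> y) = f x \<oplus>\<^bsub>N\<lparr>carrier := a' ` X\<rparr>\<^esub> f y" by simp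
    have "f (\<ominus>\<^bsub>N\<^esub> a v) = \<ominus>\<^bsub>N\<^esub> f (a v)" if "v \<in> X" for v
      using neg[OF that] f that by metis
    then show "\<forall>x\<in>carrier (N\<lparr>carrier := a ` X\<rparr>).
        f (\<ominus>\<^bsub>N\<lparr>carrier := a ` X\<rparr>\<^esub> x) = \<ominus>\<^bsub>N\<lparr>carrier := a' ` X\<rparr>\<^esub> f x" using inv f by simp
    have "f (r \<odot>\<^bsub>N\<^esub> a v) = r \<odot>\<^bsub>N\<^esub> f (a v)" if "v \<in> X" "r \<in> carrier R" for v r
      using smult[OF that] f that by metis
    then show "\<forall>r\<in>carrier R. \<forall>x\<in>carrier (N\<lparr>carrier := a ` X\<rparr>).
        f (r \<odot>\<^bsub>N\<lparr>carrier := a ` X\<rparr>\<^esub> x) = r \<odot>\<^bsub>N\<lparr>carrier := a' ` X\<rparr>\<^esub> f x" by simp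
  qed
  then show "\<exists>f. mod_isomorphism R f (N\<lparr>carrier := a ` X\<rparr>) (N\<lparr>carrier := a' ` X\<rparr>) \<and>
      (\<forall>v\<in>X. f (a v) = a' v)" using f by blast
qed

text \<open>No amalgamation is available, so the types are linked by a chain: from \<open>N\<close>
  down to \<open>M\<close>, across \<open>f\<close> to \<open>M'\<close>, and up to \<open>N\<close>
  again.\<close>

lemma ortp_eq_if_isomorphic:
  assumes ac: "abstract_class R K sub" and M: "sub M N" "sub M' N"
    and f: "mod_isomorphism R f M M'"
    and A: "A \<subseteq> carrier M" "\<forall>x\<in>A. f x = x" and c: "c \<in> carrier M"
  shows "ortp R K sub c A N = ortp R K sub (f c) A N"
proof -
  have K: "M \<in> K" "M' \<in> K" using abstract_class_sub[OF ac] M by blast+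
  have img: "f ` carrier M = carrier M'" using f unfolding mod_isomorphism_def by blast
  have "K_embedding R K sub f M M'"
    using f K img abstract_class_refl[OF ac K(2)] unfolding K_embedding_def mod_isomorphism_def by simp
  then have 1: "((c, A, M), (f c, A, M')) \<in> E_at R K sub" using E_at_embedding[OF ac _ c A] by blast
  have 2: "((c, A, M), (c, A, N)) \<in> E_at R K sub"
    using E_at_embedding[OF ac K_embedding_inclusion[OF ac M(1)] c A(1)] by simp
  have "A \<subseteq> carrier M'" using A img by force
  moreover have "f c \<in> carrier M'" using img c by blast
  ultimately have 3: "((f c, A, M'), (f c, A, N)) \<in> E_at R K sub"
    using E_at_embedding[OF ac K_embedding_inclusion[OF ac M(2)]] by simp
  have "ortp R K sub c A N = ortp R K sub c A M"
    by (rule ortp_eqI[symmetric]) (rule r_into_trancl[OF 2])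
  also have "\<dots> = ortp R K sub (f c) A M'" by (rule ortp_eqI) (rule r_into_trancl[OF 1])
  also have "\<dots> = ortp R K sub (f c) A N" by (rule ortp_eqI) (rule r_into_trancl[OF 3])
  finally show ?thesis .
qed

text \<open>Parameters are added to this assignment only later, so its cosets do not depend on the
  small submodel over which types are compared.\<close>

definition single :: "('r, 'u) module \<Rightarrow> 'v \<Rightarrow> 'u \<Rightarrow> 'v \<Rightarrow> 'u" where
  "single N v0 c = (\<lambda>v. if v = v0 then c else \<zero>\<^bsub>N\<^esub>)"

lemma surj_assignment:
  assumes "|A| \<le>o |Y|" "A \<noteq> {}"
  obtains m where "m ` Y = A"
  using iffD2[OF card_of_ordLeq2[OF assms(2)] assms(1)] by blast

text \<open>\<open>v0\<close> holds the element, \<open>Y\<close> the parameters, and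
  \<open>V\<close> an enumeration of a model around both. A shift by the parameter tuple and one
  back-and-forth step along \<open>W\<close> turn the enumeration for \<open>c\<close> into one for
  \<open>d\<close>. The transferred formula and diagram make its range a strong submodel, isomorphic
  to the given one over \<open>A0\<close>.\<close>

lemma ortp_eq_if_same_cosets:
  fixes R :: "('r, 'm) ring_scheme" and K :: "('r, 'u) module set" and N :: "('r, 'u) module"
    and l :: "'u rel" and V X Y :: "'v set"
  assumes ac: "abstract_class R K sub" and N: "N \<in> K"
    and syn: "\<And>a. a ` X \<subseteq> carrier N \<Longrightarrow> submodule (a ` X) R N \<Longrightarrow>
      N\<lparr>carrier := a ` X\<rparr> \<in> K \<and> sub (N\<lparr>carrier := a ` X\<rparr>) N \<longleftrightarrow> satisfies N \<phi> a"
    and X: "insert v0 Y \<union> V \<subseteq> X" "v0 \<notin> Y" "v0 \<notin> V" "Y \<inter> V = {}"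
    and ctr: "controls N \<G> \<phi>" and \<G>: "\<And>H. H \<in> \<G> \<Longrightarrow> additive_subgroup H (assignments N)"
    and atoms: "atomic_solutions R N X \<subseteq> \<G>"
  defines "W \<equiv> {a \<in> carrier (assignments N). \<forall>v. v \<notin> V \<longrightarrow> a v = \<zero>\<^bsub>N\<^esub>}"
  assumes l: "Cinfinite l" "|quant_closure (assignments N) W \<G>| \<le>o l"
    and B: "additive_subgroup B (assignments N)" "|B| \<le>o l"
      "saturated (assignments N) l (quant_closure (assignments N) W \<G>) B"
    and params: "{m \<in> carrier (assignments N). m ` Y \<subseteq> A \<and> (\<forall>v. v \<notin> Y \<longrightarrow> m v = \<zero>\<^bsub>N\<^esub>)} \<subseteq> B"
    and A0: "A0 \<subseteq> A" "A0 \<noteq> {}" "|A0| \<le>o |Y|"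
    and M: "sub M N" "A0 \<subseteq> carrier M" "c \<in> carrier M" "|carrier M| \<le>o |V|"
    and d: "d \<in> carrier N"
    and same: "same_cosets (assignments N) (quant_closure (assignments N) W \<G>) B
      (single N v0 c) (single N v0 d)"
  shows "ortp R K sub c A0 N = ortp R K sub d A0 N"
proof -
  have mN: "left_module R N" by (rule abstract_class_module[OF ac N])
  interpret N: left_module R N by (rule mN)
  interpret V: abelian_group "assignments N :: ('v \<Rightarrow> 'u) ring" by (rule abelian_group_assignments[OF mN])
  interpret M: submodule "carrier M" R N by (rule sub_submodule[OF ac M(1)])
  let ?V = "assignments N :: ('v \<Rightarrow> 'u) ring" and ?Q = "quant_closure (assignments N) W \<G>"
  have McN: "carrier M \<subseteq> carrier N" using M.subset by simp
  have zM: "\<zero>\<^bsub>N\<^esub> \<in> carrier M" using M.one_closed by simp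
  obtain m0 where m0: "m0 ` Y = A0" using surj_assignment[OF A0(3,2)] .
  obtain h where h: "h ` V = carrier M" using surj_assignment[OF M(4)] zM by blast
  \<comment> \<open>Extended by zero, the parameter tuple is one of those that \<open>params\<close>
    puts into \<open>B\<close>.\<close>
  define m where "m v = (if v \<in> Y then m0 v else \<zero>\<^bsub>N\<^esub>)" for v
  have mM: "m v \<in> carrier M" for v using m0 M(2) zM unfolding m_def by auto
  have m: "m \<in> carrier ?V" using mM McN by (auto simp: carrier_assignments)
  have "m ` Y \<subseteq> A" "\<forall>v. v \<notin> Y \<longrightarrow> m v = \<zero>\<^bsub>N\<^esub>" using m0 A0(1) unfolding m_def by auto
  then have mB: "m \<in> B" using m by (intro subsetD[OF params]) simp
  have W: "additive_subgroup W ?V" unfolding W_def by (rule additive_subgroup_vanishing[OF mN])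
  have Qs: "additive_subgroup H ?V" if "H \<in> ?Q" for H
    by (rule V.additive_subgroup_quant_closure[OF \<G> W that])
  have c: "c \<in> carrier N" using M(3) McN by blast
  have sc: "single N v0 c \<in> carrier ?V" "single N v0 d \<in> carrier ?V"
    using c d by (auto simp: carrier_assignments single_def)
  define x where "x = single N v0 c \<oplus>\<^bsub>?V\<^esub> m"
  define y where "y = single N v0 d \<oplus>\<^bsub>?V\<^esub> m"
  have xy: "x \<in> carrier ?V" "y \<in> carrier ?V" using sc m unfolding x_def y_def by simp_all
  \<comment> \<open>Translation by \<open>m\<close> maps \<open>B\<close> to itself, so the
    agreement of the two \<open>single\<close> assignments survives the addition of the
    parameters.\<close>
  have shift: "(e \<oplus>\<^bsub>?V\<^esub> m) \<ominus>\<^bsub>?V\<^esub> b = e \<ominus>\<^bsub>?V\<^esub> (b \<ominus>\<^bsub>?V\<^esub> m)"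
    if "e \<in> carrier ?V" "b \<in> B" for e b
  proof -
    have b: "b \<in> carrier ?V" using additive_subgroup.a_subset[OF B(1)] that(2) by blast
    show ?thesis
      using that(1) b m V.add_diff_add[of e "b \<ominus>\<^bsub>?V\<^esub> m" m m]
      by (simp add: V.diff_add_cancel V.diff_self)
  qed
  have sameQ: "same_cosets ?V ?Q B x y"
    unfolding same_cosets_def
  proof (intro ballI)
    fix H b assume H: "H \<in> ?Q" and b: "b \<in> B"
    have "b \<ominus>\<^bsub>?V\<^esub> m \<in> B"
      using additive_subgroup.a_closed[OF B(1) b additive_subgroup.a_inv_closed[OF B(1) mB]]
      by (simp add: a_minus_def)
    then show "x \<ominus>\<^bsub>?V\<^esub> b \<in> H \<longleftrightarrow> y \<ominus>\<^bsub>?V\<^esub> b \<in> H"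
      using same H unfolding same_cosets_def x_def y_def shift[OF sc(1) b] shift[OF sc(2) b] by blast
  qed
  have xM: "x v \<in> carrier M" for v
    using mM[of v] M(3) zM M.m_closed unfolding x_def single_def by (simp add: add_assignments)
  \<comment> \<open>\<open>a\<close> exhausts the model already on \<open>V\<close>; elsewhere it
    takes the values of \<open>x\<close>, which lie in the model too. So its range on
    \<open>X\<close> is exactly \<open>carrier M\<close>.\<close>
  define a where "a v = (if v \<in> V then h v else x v)" for v
  have aM: "a v \<in> carrier M" for v using xM h unfolding a_def by auto
  have "reassigns N V x a"
    using h McN unfolding reassigns_def a_def by auto
  then have a: "a \<in> carrier ?V" "a \<ominus>\<^bsub>?V\<^esub> x \<in> W"
    using reassigns_iff[OF mN xy(1)] unfolding W_def by simp_all
  have GQ: "\<G> \<subseteq> ?Q" by (rule V.subset_quant_closure[OF \<G>])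
  have Gl: "|\<G>| \<le>o l" by (rule card_subset_le[OF GQ l(2)])
  obtain a' where a': "a' \<in> carrier ?V" "a' \<ominus>\<^bsub>?V\<^esub> y \<in> W" "same_cosets ?V \<G> B a a'"
    using V.same_cosets_extend[OF \<G> W B(1,3) l(1) B(2) Gl xy sameQ a] by blast
  \<comment> \<open>Only the variables in \<open>V\<close> have moved: \<open>a'\<close> still has
    \<open>d\<close> at \<open>v0\<close> and the old parameters on \<open>Y\<close>.\<close>
  have off: "a' v = y v" if "v \<notin> V" for v
    using reassigns_iff[OF mN xy(2), of V a'] a' that unfolding W_def reassigns_def by simp
  have "a ` V = carrier M" using h unfolding a_def by auto
  then have img: "a ` X = carrier M" using aM X(1) by blast
  have sm: "submodule (a ` X) R N" unfolding img by (rule M.submodule_axioms)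
  have aX: "a ` X \<subseteq> carrier N" "a' ` X \<subseteq> carrier N"
    using a(1) a'(1) by (auto simp: carrier_assignments)
  have zB: "\<zero>\<^bsub>?V\<^esub> \<in> B" by (rule additive_subgroup.zero_closed[OF B(1)])
  have diag: "a u = term_value N (atomic_rhs s v w) a \<longleftrightarrow> a' u = term_value N (atomic_rhs s v w) a'"
    if "s \<in> mod_language R" "u \<in> X" "v \<in> X" "w \<in> X" for s u v w
  proof -
    let ?H = "{a \<in> carrier ?V. term_value N (TVar u) a = term_value N (atomic_rhs s v w) a}"
    have "?H \<in> atomic_solutions R N X"
      using that unfolding atomic_solutions_def by (intro image_eqI[of _ _ "(s, u, v, w)"]) auto
    then have "?H \<in> \<G>" using atoms by blast
    then have "a \<ominus>\<^bsub>?V\<^esub> \<zero>\<^bsub>?V\<^esub> \<in> ?H \<longleftrightarrow> a' \<ominus>\<^bsub>?V\<^esub> \<zero>\<^bsub>?V\<^esub> \<in> ?H"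
      by (intro a'(3)[unfolded same_cosets_def, rule_format, OF _ zB])
    then show ?thesis using V.diff_zero[OF a(1)] V.diff_zero[OF a'(1)] a(1) a'(1) by simp
  qed
  note iso = diagram_isomorphism[OF mN aX sm diag]
  obtain f where f: "mod_isomorphism R f (N\<lparr>carrier := a ` X\<rparr>) (N\<lparr>carrier := a' ` X\<rparr>)"
      "\<forall>v\<in>X. f (a v) = a' v" using iso(2) by blast
  have subM: "sub (N\<lparr>carrier := a ` X\<rparr>) N" unfolding img by (rule sub_restrict[OF ac M(1)])
  then have "satisfies N \<phi> a" using syn[OF aX(1) sm] abstract_class_sub[OF ac subM] by blast
  then have "satisfies N \<phi> a'"
    using controlsD[OF ctr l(1) Gl B(1,2) saturated_mono[OF B(3) GQ] a(1) a'(1,3)] by blast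
  then have subM': "sub (N\<lparr>carrier := a' ` X\<rparr>) N" using syn[OF aX(2) iso(1)] by blast
  have v0: "v0 \<in> X" "v0 \<notin> V" using X by auto
  have "a v0 = c" using v0 X(2) c unfolding a_def x_def m_def single_def
    by (simp add: add_assignments)
  moreover have "a' v0 = d" using off[OF v0(2)] X(2) d unfolding y_def m_def single_def
    by (simp add: add_assignments)
  ultimately have fc: "f c = d" using f(2) v0(1) by auto
  have fA: "f z = z" if z: "z \<in> A0" for z
  proof -
    obtain v where v: "v \<in> Y" "z = m0 v" using m0 z by blast
    have v': "v \<in> X" "v \<notin> V" "v \<noteq> v0" using v X by auto
    have zN: "z \<in> carrier N" using z M(2) McN by blast
    have "a v = z" using v v' zN unfolding a_def x_def m_def single_def by (simp add: add_assignments)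
    moreover have "a' v = z"
      using off[OF v'(2)] v v' zN unfolding y_def m_def single_def by (simp add: add_assignments)
    ultimately show ?thesis using f(2) v'(1) by auto
  qed
  show ?thesis
    using ortp_eq_if_isomorphic[OF ac subM subM' f(1), of A0 c] M(2,3) fA fc img by simp
qed

section \<open>Almost stability\<close>

text \<open>\<open>sig c\<close> is the graph of a partial map from \<open>\<G>\<close> to
  \<open>B\<close> that picks a representative of the coset of \<open>e c\<close> whenever
  \<open>B\<close> contains one. A shared representative puts \<open>e c\<close> and
  \<open>e d\<close> into one coset, so the signature determines the class; being a subset of
  \<open>\<G> \<times> B\<close> of size at most \<open>xi\<close>, it takes at most
  \<open>l\<close> values.\<close>

lemma (in abelian_group) few_coset_types:
  fixes xi :: "'x rel" and l :: "'l rel" and e :: "'c \<Rightarrow> 'a"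
  assumes xi: "Cinfinite xi" and l: "Cinfinite l" "l ^c xi \<le>o l"
    and \<G>: "|\<G>| \<le>o xi" "\<And>H. H \<in> \<G> \<Longrightarrow> additive_subgroup H G"
    and B: "B \<subseteq> carrier G" "|B| \<le>o l" and e: "e ` C \<subseteq> carrier G"
    and g: "\<And>c d. c \<in> C \<Longrightarrow> d \<in> C \<Longrightarrow> same_cosets G \<G> B (e c) (e d) \<Longrightarrow> g c = g d"
  shows "|g ` C| \<le>o l"
proof -
  define rep where "rep c H = (SOME b. b \<in> B \<and> e c \<ominus> b \<in> H)" for c H
  define sig where "sig c = (\<lambda>H. (H, rep c H)) ` {H \<in> \<G>. \<exists>b\<in>B. e c \<ominus> b \<in> H}" for c
  have rep: "rep c H \<in> B \<and> e c \<ominus> rep c H \<in> H" if "b \<in> B" "e c \<ominus> b \<in> H" for b c H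
    unfolding rep_def by (rule someI[of "\<lambda>b. b \<in> B \<and> e c \<ominus> b \<in> H" b]) (use that in simp)
  have imp: "e d \<ominus> b \<in> H"
    if "sig c = sig d" "H \<in> \<G>" "b \<in> B" "e c \<ominus> b \<in> H" "c \<in> C" "d \<in> C" for c d H b
  proof -
    have "(H, rep c H) \<in> sig c" using that(2-4) unfolding sig_def by blast
    then have "(H, rep c H) \<in> sig d" using that(1) by simp
    then obtain b' where b': "b' \<in> B" "e d \<ominus> b' \<in> H" "rep c H = rep d H" unfolding sig_def by auto
    note rc = rep[OF that(3,4)] and rd = rep[OF b'(1,2), folded b'(3)]
    have cc: "e c \<in> carrier G" "e d \<in> carrier G" "b \<in> carrier G" "rep c H \<in> carrier G"
      using e B(1) that rc by blast+
    note Hs = \<G>(2)[OF that(2)]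
    have "rep c H \<ominus> e c \<in> H" by (rule coset_sym[OF Hs cc(1,4) conjunct2[OF rc]])
    then have "e d \<ominus> e c \<in> H" by (rule coset_trans[OF Hs cc(2,4,1) conjunct2[OF rd]])
    then show ?thesis by (rule coset_trans[OF Hs cc(2,1,3) _ that(4)])
  qed
  have sig: "g c = g d" if "c \<in> C" "d \<in> C" "sig c = sig d" for c d
  proof (rule g[OF that(1,2)])
    show "same_cosets G \<G> B (e c) (e d)"
      unfolding same_cosets_def using imp[OF that(3) _ _ _ that(1,2)]
        imp[OF that(3)[symmetric] _ _ _ that(2,1)] by blast
  qed
  have "sig ` C \<subseteq> {X. X \<subseteq> \<G> \<times> B \<and> |X| \<le>o xi}"
  proof safe
    fix c x y assume "(x, y) \<in> sig c"
    then show "x \<in> \<G>" "y \<in> B" using rep unfolding sig_def by blast+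
  next
    fix c show "|sig c| \<le>o xi"
      unfolding sig_def by (rule card_image_le[OF card_subset_le[OF _ \<G>(1)]]) blast
  qed
  moreover have "|\<G> \<times> B| \<le>o l"
    by (rule card_Times_le[OF l(1) ordLeq_transitive[OF \<G>(1)] B(2)])
      (rule ordLess_imp_ordLeq[OF ordLess_of_cexp[OF xi l]])
  ultimately have 1: "|sig ` C| \<le>o l" by (rule card_subset_le[OF _ card_bounded_subsets[OF xi l]])
  have "g ` C \<subseteq> (\<lambda>s. g (SOME c. c \<in> C \<and> sig c = s)) ` (sig ` C)"
  proof safe
    fix c assume c: "c \<in> C"
    let ?d = "SOME d. d \<in> C \<and> sig d = sig c"
    have "?d \<in> C \<and> sig ?d = sig c" by (rule someI[of "\<lambda>d. d \<in> C \<and> sig d = sig c" c]) (simp add: c)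
    then have "g c = g ?d" using sig c by metis
    then show "g c \<in> (\<lambda>s. g (SOME c. c \<in> C \<and> sig c = s)) ` (sig ` C)" using c by blast
  qed
  then show ?thesis by (rule card_subset_le[OF _ card_image_le[OF 1]])
qed

text \<open>Three copies of \<open>X\<close> fit into \<open>X\<close>. Two of them become
  \<open>Y\<close> and \<open>V\<close>, and a point of the third becomes \<open>v0\<close>. This
  divides the variables of the formula among parameters, model and element.\<close>

lemma infinite_split:
  assumes "infinite X"
  obtains v0 Y V where "insert v0 Y \<union> V \<subseteq> X" "v0 \<notin> Y" "v0 \<notin> V" "Y \<inter> V = {}"
    "|X| \<le>o |Y|" "|X| \<le>o |V|"
proof -
  have "|X <+> X| =o |X|" by (rule card_of_Plus_infinite1[OF assms card_of_mono1]) simp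
  then have "|X <+> (X <+> X)| =o |X|"
    by (rule card_of_Plus_infinite1[OF assms ordIso_imp_ordLeq])
  then obtain g where g: "bij_betw g (X <+> (X <+> X)) X"
    using card_of_ordIso by blast
  obtain x0 where x0: "x0 \<in> X" using assms by (metis finite.emptyI ex_in_conv)
  let ?v0 = "g (Inr (Inr x0))" and ?Y = "g ` (Inl ` X)" and ?V = "g ` (Inr ` Inl ` X)"
  have inj: "inj_on g (X <+> (X <+> X))" and img: "g ` (X <+> (X <+> X)) = X"
    using g unfolding bij_betw_def by blast+
  have sub: "Inl ` X \<subseteq> X <+> (X <+> X)" "Inr ` Inl ` X \<subseteq> X <+> (X <+> X)"
    "Inr (Inr x0) \<in> X <+> (X <+> X)" using x0 by auto
  have "insert ?v0 ?Y \<union> ?V \<subseteq> X" using img sub by blast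
  moreover have "?v0 \<notin> ?Y" "?v0 \<notin> ?V"
    unfolding inj_on_image_mem_iff[OF inj sub(3,1)] inj_on_image_mem_iff[OF inj sub(3,2)] by auto
  moreover have "?Y \<inter> ?V = {}" unfolding inj_on_image_Int[OF inj sub(1,2), symmetric] by auto
  moreover have "|X| \<le>o |?Y|"
  proof (rule card_of_ordLeqI[of "\<lambda>x. g (Inl x)"])
    show "inj_on (\<lambda>x. g (Inl x)) X" using inj sub(1) unfolding inj_on_def by auto
  qed blast
  moreover have "|X| \<le>o |?V|"
  proof (rule card_of_ordLeqI[of "\<lambda>x. g (Inr (Inl x))"])
    show "inj_on (\<lambda>x. g (Inr (Inl x))) X" using inj sub(2) unfolding inj_on_def by auto
  qed blast
  ultimately show ?thesis by (rule that)
qed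

text \<open>Such an assignment is determined by its graph on \<open>Y\<close>, a subset of
  \<open>Y \<times> A\<close> of size at most \<open>xi\<close>.\<close>

lemma card_parameters:
  fixes A :: "'u set"
  assumes xi: "Cinfinite xi" and l: "Cinfinite l" "l ^c xi \<le>o l"
    and Y: "|Y| \<le>o xi" and A: "|A| \<le>o l"
  shows "|{m. m ` Y \<subseteq> A \<and> (\<forall>v. v \<notin> Y \<longrightarrow> m v = z)}| \<le>o l"
proof -
  have "|{m. m ` Y \<subseteq> A \<and> (\<forall>v. v \<notin> Y \<longrightarrow> m v = z)}| \<le>o |{S. S \<subseteq> Y \<times> A \<and> |S| \<le>o xi}|"
  proof (rule card_of_ordLeqI[of "\<lambda>m. (\<lambda>v. (v, m v)) ` Y"])
    show "inj_on (\<lambda>m. (\<lambda>v. (v, m v)) ` Y) {m. m ` Y \<subseteq> A \<and> (\<forall>v. v \<notin> Y \<longrightarrow> m v = z)}"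
    proof (rule inj_onI)
      fix m m' assume m: "m \<in> {m. m ` Y \<subseteq> A \<and> (\<forall>v. v \<notin> Y \<longrightarrow> m v = z)}"
        "m' \<in> {m. m ` Y \<subseteq> A \<and> (\<forall>v. v \<notin> Y \<longrightarrow> m v = z)}"
        and eq: "(\<lambda>v. (v, m v)) ` Y = (\<lambda>v. (v, m' v)) ` Y"
      show "m = m'"
      proof
        fix v show "m v = m' v" using m eq by (cases "v \<in> Y") auto
      qed
    qed
    show "(\<lambda>v. (v, m v)) ` Y \<in> {S. S \<subseteq> Y \<times> A \<and> |S| \<le>o xi}"
      if "m \<in> {m. m ` Y \<subseteq> A \<and> (\<forall>v. v \<notin> Y \<longrightarrow> m v = z)}" for m
      using that card_image_le[OF Y] by auto
  qed
  also have "|{S. S \<subseteq> Y \<times> A \<and> |S| \<le>o xi}| \<le>o l"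
    by (rule card_bounded_subsets[OF xi l card_Times_le[OF l(1) ordLeq_transitive[OF Y] A]])
      (rule ordLess_imp_ordLeq[OF ordLess_of_cexp[OF xi l]])
  finally show ?thesis .
qed

lemma card_atomic_solutions:
  assumes "infinite X" "|mod_language R| \<le>o |X|"
  shows "|atomic_solutions R N X| \<le>o |X|"
proof -
  note X = Cinfinite_card_of[OF assms(1)]
  have "|X| \<le>o |X|" by (rule card_of_mono1) simp
  then show ?thesis
    unfolding atomic_solutions_def by (intro card_image_le card_Times_le[OF X] assms(2))
qed

lemma ortp_eq_if_tame:
  assumes ac: "abstract_class R K sub" and tame: "tame R K sub \<kappa>" and MN: "sub M N"
    and cd: "c \<in> carrier N" "d \<in> carrier N"
    and eq: "\<And>M0. sub M0 M \<Longrightarrow> |carrier M0| \<le>o \<kappa> \<Longrightarrow>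
      ortp R K sub c (carrier M0) N = ortp R K sub d (carrier M0) N"
  shows "ortp R K sub c (carrier M) N = ortp R K sub d (carrier M) N" (is "?p = ?q")
proof (rule ccontr)
  assume ne: "?p \<noteq> ?q"
  note MN' = abstract_class_sub[OF ac MN]
  have MsubN: "carrier M \<subseteq> carrier N" using MN'(3) unfolding substructure_def by blast
  have "?p \<in> types_over R K sub M" "?q \<in> types_over R K sub M"
    using MN cd unfolding types_over_def types_in_def by blast+
  then obtain M0 where M0: "sub M0 M" "|carrier M0| \<le>o \<kappa>"
      "ortp_restrict R K sub ?p (carrier M0) \<noteq> ortp_restrict R K sub ?q (carrier M0)"
    using tame ne MN'(1) unfolding tame_def by blast
  have "carrier M0 \<subseteq> carrier M"
    using abstract_class_sub(3)[OF ac M0(1)] unfolding substructure_def by blast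
  then show False
    using M0(3) eq[OF M0(1,2)] ortp_restrict_ortp[OF ac MN'(2) cd(1) MsubN]
      ortp_restrict_ortp[OF ac MN'(2) cd(2) MsubN] by simp
qed

proposition almost_stable_at_if_syntactic:
  fixes R :: "('r, 'm) ring_scheme" and K :: "('r, 'u) module set" and \<kappa> :: "'u rel"
  assumes inacc: "strongly_inaccessible |UNIV :: 'u set|"
    and ac: "abstract_class R K sub"
    and \<kappa>: "small_card \<kappa>" "Cinfinite \<kappa>" "|mod_language R| \<le>o \<kappa>"
    and LS: "\<And>N A. N \<in> K \<Longrightarrow> A \<subseteq> carrier N \<Longrightarrow> |A| \<le>o \<kappa> \<Longrightarrow>
      \<exists>M. A \<subseteq> carrier M \<and> sub M N \<and> |carrier M| \<le>o \<kappa>"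
    and tame: "tame R K sub \<kappa>" and syn: "syntactic R K sub \<kappa>"
  shows "\<exists>\<xi> :: 'u rel. small_card \<xi> \<and> \<kappa> \<le>o \<xi> \<and>
    (\<forall>l :: 'u rel. Cinfinite l \<and> l =o l ^c \<xi> \<longrightarrow> almost_stable_at R K sub l)"
proof -
  obtain \<nu>0 \<nu>1 :: "'u rel" and X :: "'u set" and \<phi> :: "('r, 'u) mod_formula"
    where \<nu>: "small_card \<nu>0" "in_logic R \<nu>0 \<nu>1 \<phi>" and X: "|X| =o \<kappa>"
      and \<phi>: "\<And>N a. N \<in> K \<Longrightarrow> a ` X \<subseteq> carrier N \<Longrightarrow> submodule (a ` X) R N \<Longrightarrow>
        N\<lparr>carrier := a ` X\<rparr> \<in> K \<and> sub (N\<lparr>carrier := a ` X\<rparr>) N \<longleftrightarrow> satisfies N \<phi> a"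
    using syn unfolding syntactic_def by blast
  have \<kappa>X: "\<kappa> \<le>o |X|" using X by (rule ordIso_imp_ordLeq[OF ordIso_symmetric])
  have infX: "infinite X"
    using cinfinite_mono[OF \<kappa>X] \<kappa>(2) by (simp add: cinfinite_def Field_card_of)
  have smX: "small X"
    using ordIso_ordLess_trans[OF X] \<kappa>(1) unfolding small_def small_card_def by blast
  obtain v0 Y V where split: "insert v0 Y \<union> V \<subseteq> X" "v0 \<notin> Y" "v0 \<notin> V" "Y \<inter> V = {}"
      "|X| \<le>o |Y|" "|X| \<le>o |V|"
    using infinite_split[OF infX] .
  obtain Z :: "'u set" where Z: "small Z" "infinite Z" "uniformly_controlled R Z \<phi>"
    using formula_uniformly_controlled[OF inacc \<nu>] by blast
  \<comment> \<open>Origin of xi: \<open>X \<union> Z\<close> bounds the equations of the diagram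
    together with the family for the formula. Its power set accounts for one more quantifier, over
    the variables \<open>V\<close> that enumerate a model. The witness is
    \<open>|P|\<close>.\<close>
  have infXZ: "infinite (X \<union> Z)" using Z(2) by simp
  have "small (X \<union> Z)" by (rule small_Un[OF inacc smX Z(1)])
  then obtain P :: "'u set" where P: "|Pow (X \<union> Z)| =o |P|" "small P"
    using small_copy[OF small_Pow[OF inacc]] by blast
  have infP: "infinite P"
    using card_of_ordIso_finite[OF P(1)] infXZ by (simp add: finite_Pow_iff)
  have XP: "|X| \<le>o |P|"
  proof -
    have "|X| \<le>o |X \<union> Z|" by (rule card_of_mono1) simp
    also have "|X \<union> Z| \<le>o |Pow (X \<union> Z)|" by (rule ordLess_imp_ordLeq[OF card_of_Pow])
    also note P(1)
    finally show ?thesis .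
  qed
  have "almost_stable_at R K sub l" if l: "Cinfinite l" "l =o l ^c |P|" for l :: "'u rel"
    unfolding almost_stable_at_def
  proof (intro allI impI, elim conjE)
    fix M N assume MN: "sub M N" and Ml: "|carrier M| =o l"
    note xi = Cinfinite_card_of[OF infP]
    note l' = l(1) ordIso_imp_ordLeq[OF ordIso_symmetric[OF l(2)]]
    have xl: "|P| \<le>o l" by (rule ordLess_imp_ordLeq[OF ordLess_of_cexp[OF xi l']])
    note MN' = abstract_class_sub[OF ac MN]
    have mN: "left_module R N" by (rule abstract_class_module[OF ac MN'(2)])
    interpret N: left_module R N by (rule mN)
    interpret V: abelian_group "assignments N :: ('u \<Rightarrow> 'u) ring"
      by (rule abelian_group_assignments[OF mN])
    have MsubN: "carrier M \<subseteq> carrier N" using MN'(3) unfolding substructure_def by blast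
    obtain \<G>0 where \<G>0: "\<forall>H\<in>\<G>0. additive_subgroup H (assignments N)" "|\<G>0| \<le>o |Z|"
        "controls N \<G>0 \<phi>"
      using Z(3) mN unfolding uniformly_controlled_def by blast
    \<comment> \<open>The equations of the diagram join the family of the formula, so that a single
      agreement transfers both.\<close>
    let ?G = "\<G>0 \<union> atomic_solutions R N X"
    let ?W = "{a \<in> carrier (assignments N). \<forall>v. v \<notin> V \<longrightarrow> a v = \<zero>\<^bsub>N\<^esub>}"
    let ?Q = "quant_closure (assignments N) ?W ?G"
    have G: "additive_subgroup H (assignments N)" if "H \<in> ?G" for H
      using that \<G>0(1) additive_subgroup_atomic_solutions[OF mN] by blast
    have ctr: "controls N ?G \<phi>" by (rule controls_mono[OF \<G>0(3)]) simp
    have "|atomic_solutions R N X| \<le>o |X|"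
      by (rule card_atomic_solutions[OF infX ordLeq_transitive[OF \<kappa>(3) \<kappa>X]])
    then have aXZ: "|atomic_solutions R N X| \<le>o |X \<union> Z|"
      by (rule ordLeq_transitive[OF _ card_of_mono1]) simp
    have "|\<G>0| \<le>o |X \<union> Z|" by (rule ordLeq_transitive[OF \<G>0(2) card_of_mono1]) simp
    then have "|?G| \<le>o |X \<union> Z|"
      by (rule Un_Cinfinite_bound[OF _ aXZ Cinfinite_card_of[OF infXZ]])
    then have Qxi: "|?Q| \<le>o |P|"
      by (rule ordLeq_ordIso_trans[OF card_quant_closure[OF _ infXZ] P(1)])
    then have Ql: "|?Q| \<le>o l" by (rule ordLeq_transitive[OF _ xl])
    have Q: "additive_subgroup H (assignments N)" if "H \<in> ?Q" for H
      by (rule V.additive_subgroup_quant_closure[OF G additive_subgroup_vanishing[OF mN] that])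
    \<comment> \<open>All parameter tuples from \<open>M\<close> enter \<open>B\<close> in advance,
      so one \<open>B\<close> serves every small submodel \<open>M0\<close>.\<close>
    let ?par = "{m \<in> carrier (assignments N). m ` Y \<subseteq> carrier M \<and> (\<forall>v. v \<notin> Y \<longrightarrow> m v = \<zero>\<^bsub>N\<^esub>)}"
    have YX: "|Y| \<le>o |X|" by (rule card_of_mono1) (use split(1) in blast)
    have "|?par| \<le>o l"
      by (rule card_subset_le[OF _ card_parameters[OF xi l' ordLeq_transitive[OF YX XP]
              ordIso_imp_ordLeq[OF Ml], where z = "\<zero>\<^bsub>N\<^esub>"]]) blast
    then obtain B where B: "?par \<subseteq> B" "|B| \<le>o l" "additive_subgroup B (assignments N)"
        "saturated (assignments N) l ?Q B"
      using V.saturated_exists[OF xi l' Qxi Q, of ?par] by blast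
    show "|types_in R K sub M N| \<le>o l"
      unfolding types_in_def
    proof (rule V.few_coset_types[OF xi l' Qxi Q additive_subgroup.a_subset[OF B(3)] B(2)])
      show "single N v0 ` carrier N \<subseteq> carrier (assignments N)"
        by (auto simp: single_def carrier_assignments)
      fix c d assume cd: "c \<in> carrier N" "d \<in> carrier N"
        and same: "same_cosets (assignments N) ?Q B (single N v0 c) (single N v0 d)"
      show "ortp R K sub c (carrier M) N = ortp R K sub d (carrier M) N"
      proof (rule ortp_eq_if_tame[OF ac tame MN cd])
        fix M0 assume M0: "sub M0 M" "|carrier M0| \<le>o \<kappa>"
        have M0M: "carrier M0 \<subseteq> carrier M"
          using abstract_class_sub(3)[OF ac M0(1)] unfolding substructure_def by blast
        have "|{c}| \<le>o \<kappa>" by (rule finite_ordLeq_Cinfinite[OF _ \<kappa>(2)]) simp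
        then have "|carrier M0 \<union> {c}| \<le>o \<kappa>" by (rule Un_Cinfinite_bound[OF M0(2) _ \<kappa>(2)])
        \<comment> \<open>The model is taken inside \<open>N\<close>, as \<open>c\<close> need not
          belong to \<open>M\<close>. \<open>Mc\<close> is what the variables \<open>V\<close>
          enumerate.\<close>
        then obtain Mc where Mc: "carrier M0 \<union> {c} \<subseteq> carrier Mc" "sub Mc N" "|carrier Mc| \<le>o \<kappa>"
          using LS[OF MN'(2), of "carrier M0 \<union> {c}"] M0M MsubN cd(1) by blast
        have ne: "carrier M0 \<noteq> {}"
        proof -
          interpret M0: left_module R M0
            by (rule abstract_class_module[OF ac abstract_class_sub(1)[OF ac M0(1)]])
          show ?thesis using M0.M.zero_closed by blast
        qed
        show "ortp R K sub c (carrier M0) N = ortp R K sub d (carrier M0) N"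
          by (rule ortp_eq_if_same_cosets[OF ac MN'(2) \<phi>[OF MN'(2)] split(1-4) ctr G Un_upper2 l(1) Ql
                B(3,2,4,1) M0M ne ordLeq_transitive[OF M0(2) ordLeq_transitive[OF \<kappa>X split(5)]]
                Mc(2) _ _ ordLeq_transitive[OF Mc(3) ordLeq_transitive[OF \<kappa>X split(6)]] cd(2) same])
            (use Mc(1) in auto)
      qed
    qed
  qed
  moreover have "small_card |P|"
    using P(2) card_of_Card_order unfolding small_card_def small_def by blast
  moreover have "\<kappa> \<le>o |P|" by (rule ordLeq_transitive[OF \<kappa>X XP])
  ultimately show ?thesis by blast
qed

section \<open>Cardinal powers and Loewenheim-Skolem numbers\<close>

lemma small_Field:
  fixes r :: "'u rel"
  assumes "small_card r"
  shows "small (Field r)"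
  using assms card_of_Field_ordIso ordIso_ordLess_trans unfolding small_card_def small_def by blast

lemma small_card_of: "small A \<Longrightarrow> small_card |A|"
  unfolding small_card_def small_def by (simp only: card_of_Card_order)

lemma small_cexp:
  fixes r e :: "'u rel"
  assumes inacc: "strongly_inaccessible |UNIV :: 'u set|" and "small_card r" "small_card e"
  shows "r ^c e <o |UNIV :: 'u set|"
proof -
  have "|Field e \<times> Field r| <o |UNIV :: 'u set|"
    by (rule small_Sigma[OF inacc]) (use assms small_Field in auto)
  then obtain Z :: "'u set" where Z: "|Field e \<times> Field r| =o |Z|" "small Z" using small_copy by blast
  have "|Func (Field e) (Field r)| \<le>o |Pow (Field e \<times> Field r)|"
  proof (rule card_of_ordLeqI[of "\<lambda>f. {(x, f x) | x. x \<in> Field e}"])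
    show "inj_on (\<lambda>f. {(x, f x) | x. x \<in> Field e}) (Func (Field e) (Field r))"
    proof (rule inj_onI)
      fix f g assume f: "f \<in> Func (Field e) (Field r)" and g: "g \<in> Func (Field e) (Field r)"
        and eq: "{(x, f x) | x. x \<in> Field e} = {(x, g x) | x. x \<in> Field e}"
      show "f = g"
      proof
        fix x show "f x = g x"
        proof (cases "x \<in> Field e")
          case True
          then have "(x, f x) \<in> {(x, g x) | x. x \<in> Field e}" unfolding eq[symmetric] by blast
          then show ?thesis by blast
        next
          case False
          then show ?thesis using f g unfolding Func_def by simp
        qed
      qed
    qed
    show "{(x, f x) | x. x \<in> Field e} \<in> Pow (Field e \<times> Field r)" if "f \<in> Func (Field e) (Field r)" for f
      using that unfolding Func_def by blast
  qed
  also have "|Pow (Field e \<times> Field r)| \<le>o |Pow Z|"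
    by (rule card_Pow_mono[OF ordIso_imp_ordLeq[OF Z(1)]])
  also have "|Pow Z| <o |UNIV :: 'u set|" by (rule small_Pow[OF inacc Z(2)])
  finally show ?thesis unfolding cexp_def .
qed

text \<open>\<open>powlt\<close> is a choice, so a least bound has to exist: by inaccessibility the
  cardinal of the universe bounds all the powers, and a nonempty collection of cardinals has a least
  member.\<close>

lemma powlt_least:
  fixes r m :: "'u rel"
  assumes inacc: "strongly_inaccessible |UNIV :: 'u set|" and rm: "small_card r" "small_card m"
  shows "powlt_bound r m (powlt r m) \<and> (\<forall>d. powlt_bound r m d \<longrightarrow> powlt r m \<le>o d)"
proof -
  have "powlt_bound r m |UNIV :: 'u set|"
    unfolding powlt_bound_def
  proof (intro conjI allI impI card_of_Card_order)
    fix e :: "'u rel" assume e: "Card_order e \<and> e <o m"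
    then have "small_card e" using rm(2) ordLess_transitive unfolding small_card_def by blast
    then show "r ^c e \<le>o |UNIV :: 'u set|" using small_cexp[OF inacc rm(1)] ordLess_imp_ordLeq by blast
  qed
  moreover have "\<forall>c\<in>{c. powlt_bound r m c}. Card_order c" unfolding powlt_bound_def by blast
  ultimately obtain c where "powlt_bound r m c" "\<forall>d. powlt_bound r m d \<longrightarrow> c \<le>o d"
    using exists_minim_Card_order[of "{c. powlt_bound r m c}"] by blast
  then show ?thesis
    unfolding powlt_def using someI[of "\<lambda>c. powlt_bound r m c \<and> (\<forall>d. powlt_bound r m d \<longrightarrow> c \<le>o d)" c]
    by blast
qed

lemma LS_witness_LS_number:
  assumes "mu_AEC R \<mu> K sub"
  shows "LS_witness R \<mu> K sub (LS_number R \<mu> K sub)"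
proof -
  have "{\<theta>. LS_witness R \<mu> K sub \<theta>} \<noteq> {}" using assms unfolding mu_AEC_def by simp
  moreover have "\<forall>\<theta>\<in>{\<theta>. LS_witness R \<mu> K sub \<theta>}. Card_order \<theta>"
    unfolding LS_witness_def small_card_def by simp
  ultimately obtain \<theta> where "LS_witness R \<mu> K sub \<theta>" "\<forall>\<theta>'. LS_witness R \<mu> K sub \<theta>' \<longrightarrow> \<theta> \<le>o \<theta>'"
    using exists_minim_Card_order[of "{\<theta>. LS_witness R \<mu> K sub \<theta>}"] by blast
  then show ?thesis
    unfolding LS_number_def
    using someI[of "\<lambda>\<theta>. LS_witness R \<mu> K sub \<theta> \<and> (\<forall>\<theta>'. LS_witness R \<mu> K sub \<theta>' \<longrightarrow> \<theta> \<le>o \<theta>')" \<theta>]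
    by blast
qed

text \<open>The equation for \<open>\<kappa>\<close> bounds both of its summands by
  \<open>\<kappa>\<close>. A bound for the powers of \<open>\<kappa>\<close> also bounds those of
  \<open>|A|\<close>, so the size in the Loewenheim-Skolem property collapses to
  \<open>\<kappa>\<close>.\<close>

lemma Loewenheim_Skolem_kappa:
  fixes R :: "('r, 'm) ring_scheme" and K :: "('r, 'u) module set" and \<mu> \<kappa> :: "'u rel"
  assumes inacc: "strongly_inaccessible |UNIV :: 'u set|" and \<mu>: "small_card \<mu>"
    and aec: "mu_AEC R \<mu> K sub" and \<kappa>: "small_card \<kappa>" "Cinfinite \<kappa>"
    and eq: "\<kappa> =o powlt \<kappa> \<mu> +c LS_number R \<mu> K sub"
  shows "|mod_language R| \<le>o \<kappa>"
    and "N \<in> K \<Longrightarrow> A \<subseteq> carrier N \<Longrightarrow> |A| \<le>o \<kappa> \<Longrightarrow>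
      \<exists>M. A \<subseteq> carrier M \<and> sub M N \<and> |carrier M| \<le>o \<kappa>"
proof -
  let ?\<theta> = "LS_number R \<mu> K sub"
  note LS = LS_witness_LS_number[OF aec, unfolded LS_witness_def]
  have \<theta>: "Card_order ?\<theta>" using LS unfolding small_card_def by simp
  note pk = powlt_least[OF inacc \<kappa>(1) \<mu>]
  have cpk: "Card_order (powlt \<kappa> \<mu>)" using pk unfolding powlt_bound_def by simp
  have \<theta>\<kappa>: "?\<theta> \<le>o \<kappa>" by (rule ordLeq_ordIso_trans[OF ordLeq_csum2[OF \<theta>] ordIso_symmetric[OF eq]])
  have p\<kappa>: "powlt \<kappa> \<mu> \<le>o \<kappa>"
    by (rule ordLeq_ordIso_trans[OF ordLeq_csum1[OF cpk] ordIso_symmetric[OF eq]])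
  have "|mod_language R| \<le>o |mod_language R| +c \<mu>" by (rule ordLeq_csum1[OF card_of_Card_order])
  also have "|mod_language R| +c \<mu> \<le>o ?\<theta>" using LS by simp
  also note \<theta>\<kappa>
  finally show "|mod_language R| \<le>o \<kappa>" .
  assume N: "N \<in> K" and A: "A \<subseteq> carrier N" "|A| \<le>o \<kappa>"
  have smA: "small_card |A|"
    using ordLeq_ordLess_trans[OF A(2)] \<kappa>(1) card_of_Card_order unfolding small_card_def by blast
  note pA = powlt_least[OF inacc smA \<mu>]
  have "powlt_bound |A| \<mu> (powlt \<kappa> \<mu>)"
    unfolding powlt_bound_def
  proof (intro conjI allI impI cpk)
    fix e :: "'u rel" assume e: "Card_order e \<and> e <o \<mu>"
    have "|A| ^c e \<le>o \<kappa> ^c e" by (rule cexp_mono1[OF A(2)]) (use e in blast)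
    also have "\<kappa> ^c e \<le>o powlt \<kappa> \<mu>" using pk e unfolding powlt_bound_def by blast
    finally show "|A| ^c e \<le>o powlt \<kappa> \<mu>" .
  qed
  then have pA\<kappa>: "powlt |A| \<mu> \<le>o \<kappa>" using pA ordLeq_transitive[OF _ p\<kappa>] by blast
  have cpA: "Card_order (powlt |A| \<mu>)" using pA unfolding powlt_bound_def by simp
  obtain M where M: "A \<subseteq> carrier M" "sub M N" "|carrier M| \<le>o powlt |A| \<mu> +c ?\<theta>"
    using LS N A(1) by meson
  have "|carrier M| \<le>o \<kappa>"
    by (rule ordLeq_transitive[OF M(3) csum_cinfinite_bound[OF pA\<kappa> \<theta>\<kappa> cpA \<theta> \<kappa>(2)]])
  then show "\<exists>M. A \<subseteq> carrier M \<and> sub M N \<and> |carrier M| \<le>o \<kappa>" using M by blast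
qed

text \<open>If \<open>S\<close> is at least as large as \<open>\<alpha>\<close> and
  \<open>\<xi>\<close>, then \<open>ctwo ^c |S|\<close> is its own power with exponent
  \<open>\<xi>\<close>, because exponents multiply and \<open>|S| *c \<xi> =o |S|\<close>.\<close>

lemma unboundedly_many_powers:
  fixes \<xi> :: "'u rel"
  assumes inacc: "strongly_inaccessible |UNIV :: 'u set|" and \<xi>: "small_card \<xi>" "Cinfinite \<xi>"
    and P: "\<And>l :: 'u rel. small_card l \<Longrightarrow> Cinfinite l \<Longrightarrow> l =o l ^c \<xi> \<Longrightarrow> P l"
  shows "for_unboundedly_many_cards P"
  unfolding for_unboundedly_many_cards_def
proof (intro allI impI)
  fix \<alpha> :: "'u rel" assume \<alpha>: "small_card \<alpha>"
  define S where "S = Field \<alpha> \<union> Field \<xi>"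
  have S: "small S" unfolding S_def by (rule small_Un[OF inacc small_Field[OF \<alpha>] small_Field[OF \<xi>(1)]])
  have infS: "infinite S" using \<xi>(2) unfolding S_def by (simp add: cinfinite_def)
  have \<alpha>S: "\<alpha> \<le>o |S|"
  proof -
    have "\<alpha> =o |Field \<alpha>|"
      using \<alpha> card_of_Field_ordIso ordIso_symmetric unfolding small_card_def by blast
    then show ?thesis by (rule ordIso_ordLeq_trans) (simp add: S_def card_of_mono1)
  qed
  have \<xi>S: "\<xi> \<le>o |S|"
  proof -
    have "\<xi> =o |Field \<xi>|" using \<xi>(2) card_of_Field_ordIso ordIso_symmetric by blast
    then show ?thesis by (rule ordIso_ordLeq_trans) (simp add: S_def card_of_mono1)
  qed
  obtain L :: "'u set" where L: "|Pow S| =o |L|" "small L"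
    using small_copy[OF small_Pow[OF inacc S]] by blast
  have infL: "infinite L" using card_of_ordIso_finite[OF L(1)] infS by (simp add: finite_Pow_iff)
  have SL: "|S| \<le>o |L|" by (rule ordLeq_ordIso_trans[OF ordLess_imp_ordLeq[OF card_of_Pow] L(1)])
  have "|Pow S| =o ctwo ^c |S|"
    using card_of_Pow_Func[of S] unfolding ctwo_def cexp_def Field_card_of .
  then have L2: "|L| =o ctwo ^c |S|" by (rule ordIso_transitive[OF ordIso_symmetric[OF L(1)]])
  have "|L| ^c \<xi> =o (ctwo ^c |S| ) ^c \<xi>" using cexp_cong1[OF L2] \<xi>(2) by blast
  also have "(ctwo ^c |S| ) ^c \<xi> =o ctwo ^c ( |S| *c \<xi>)" by (rule cexp_cprod[OF Card_order_ctwo])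
  also have "ctwo ^c ( |S| *c \<xi>) =o ctwo ^c |S|"
  proof (rule cexp_cong2)
    show "|S| *c \<xi> =o |S|"
      by (rule cprod_infinite1'[OF Cinfinite_card_of[OF infS] Cinfinite_Cnotzero[OF \<xi>(2)] \<xi>S])
  qed (rule Card_order_ctwo Card_order_cprod)+
  also have "ctwo ^c |S| =o |L|" by (rule ordIso_symmetric[OF L2])
  finally have "|L| =o |L| ^c \<xi>" by (rule ordIso_symmetric)
  then have "P |L|" by (rule P[OF small_card_of[OF L(2)] Cinfinite_card_of[OF infL]])
  then show "\<exists>l. small_card l \<and> Cinfinite l \<and> \<alpha> \<le>o l \<and> P l"
    using small_card_of[OF L(2)] Cinfinite_card_of[OF infL] ordLeq_transitive[OF \<alpha>S SL] by blast
qed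

section \<open>Amalgamating types\<close>

lemma module_copy:
  fixes N :: "('r, 'u) module"
  assumes N: "left_module R N" and e: "inj_on e (carrier N)"
  shows "\<exists>N' :: ('r, 'u) module. mod_isomorphism R e N N'"
proof -
  interpret N: left_module R N by fact
  define d where "d = inv_into (carrier N) e"
  have d: "d (e x) = x" if "x \<in> carrier N" for x
    unfolding d_def using inv_into_f_f[OF e that] .
  define N' :: "('r, 'u) module" where "N' = \<lparr>carrier = e ` carrier N,
     mult = (\<lambda>x y. e (d x \<otimes>\<^bsub>N\<^esub> d y)), one = e \<one>\<^bsub>N\<^esub>, zero = e \<zero>\<^bsub>N\<^esub>,
     add = (\<lambda>x y. e (d x \<oplus>\<^bsub>N\<^esub> d y)), smult = (\<lambda>r x. e (r \<odot>\<^bsub>N\<^esub> d x))\<rparr>"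
  \<comment> \<open>The inverse in a record is a definite description, so it is identified through
    uniqueness.\<close>
  have inv: "\<ominus>\<^bsub>N'\<^esub> (e x) = e (\<ominus>\<^bsub>N\<^esub> x)" if x: "x \<in> carrier N" for x
    unfolding a_inv_def[of N'] m_inv_def
  proof (rule the_equality)
    show "e (\<ominus>\<^bsub>N\<^esub> x) \<in> carrier (add_monoid N') \<and>
        e x \<otimes>\<^bsub>add_monoid N'\<^esub> e (\<ominus>\<^bsub>N\<^esub> x) = \<one>\<^bsub>add_monoid N'\<^esub> \<and>
        e (\<ominus>\<^bsub>N\<^esub> x) \<otimes>\<^bsub>add_monoid N'\<^esub> e x = \<one>\<^bsub>add_monoid N'\<^esub>"
      using x by (simp add: N'_def d N.M.r_neg N.M.l_neg)
    fix y assume y: "y \<in> carrier (add_monoid N') \<and> e x \<otimes>\<^bsub>add_monoid N'\<^esub> y = \<one>\<^bsub>add_monoid N'\<^esub> \<and>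
        y \<otimes>\<^bsub>add_monoid N'\<^esub> e x = \<one>\<^bsub>add_monoid N'\<^esub>"
    then obtain z where z: "z \<in> carrier N" "y = e z" unfolding N'_def by auto
    have "e (z \<oplus>\<^bsub>N\<^esub> x) = e \<zero>\<^bsub>N\<^esub>" using y z x by (simp add: N'_def d)
    then have "z \<oplus>\<^bsub>N\<^esub> x = \<zero>\<^bsub>N\<^esub>" using inj_onD[OF e] z x by simp
    then have "\<ominus>\<^bsub>N\<^esub> x = z" using N.M.minus_equality z(1) x by simp
    then show "y = e (\<ominus>\<^bsub>N\<^esub> x)" using z(2) by simp
  qed
  have "mod_isomorphism R e N N'"
    unfolding mod_isomorphism_def mod_embedding_def using inv e by (auto simp: N'_def d)
  then show ?thesis by blast
qed

text \<open>Serves to rename an amalgam so that it contains the base literally. \<open>e\<close>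
  undoes \<open>h\<close> on its image and sends the rest of \<open>B\<close> outside
  \<open>A\<close>; there is room because the universe is not the union of two small sets.\<close>

lemma extend_to_injection:
  fixes h :: "'u \<Rightarrow> 'u"
  assumes inacc: "strongly_inaccessible |UNIV :: 'u set|" and sm: "small A" "small B"
    and h: "inj_on h A" "h ` A \<subseteq> B"
  obtains e where "inj_on e B" "\<And>x. x \<in> A \<Longrightarrow> e (h x) = x"
proof -
  have D: "small (B - h ` A)"
    using ordLeq_ordLess_trans[OF card_of_mono1[OF Diff_subset]] sm(2) unfolding small_def by blast
  have "|B - h ` A| \<le>o |- A|"
  proof (rule ccontr)
    assume "\<not> |B - h ` A| \<le>o |- A|"
    then have "|- A| <o |B - h ` A|"
      using not_ordLeq_iff_ordLess[OF card_of_Well_order card_of_Well_order] by blast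
    then have "small (- A)" using D ordLess_transitive unfolding small_def by blast
    then have "small (A \<union> - A)" by (rule small_Un[OF inacc sm(1)])
    then show False unfolding small_def by (simp add: ordLess_irreflexive)
  qed
  then obtain k where k: "inj_on k (B - h ` A)" "k ` (B - h ` A) \<subseteq> - A"
    using iffD2[OF card_of_ordLeq] by blast
  define e where "e x = (if x \<in> h ` A then inv_into A h x else k x)" for x
  have eh: "e (h x) = x" if "x \<in> A" for x
    using that inv_into_f_f[OF h(1) that] unfolding e_def by simp
  have eA: "e y \<in> A" if "y \<in> h ` A" for y using that eh by auto
  have enA: "e y \<notin> A" if "y \<in> B - h ` A" for y using that k(2) unfolding e_def by auto
  have "inj_on e B"
  proof (rule inj_onI)
    fix x y assume xy: "x \<in> B" "y \<in> B" "e x = e y"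
    show "x = y"
    proof (cases "x \<in> h ` A")
      case True
      then have "y \<in> h ` A" using eA[of x] enA[of y] xy by auto
      then show ?thesis using True eh xy(3) by auto
    next
      case False
      then have "y \<notin> h ` A" using eA[of y] enA[of x] xy by auto
      then show ?thesis using False xy inj_onD[OF k(1), of x y] unfolding e_def by simp
    qed
  qed
  then show ?thesis using eh that by blast
qed

lemma embedding_submodule:
  assumes M: "left_module R M" and N: "left_module R N" and f: "mod_embedding R f M N"
  shows "submodule (f ` carrier M) R N"
proof -
  interpret M: left_module R M by fact
  interpret N: left_module R N by fact
  note f' = f[unfolded mod_embedding_def]
  show ?thesis
  proof (intro submodule.intro group.subgroupI submodule_axioms.intro)
    show "group (add_monoid N)" by (rule N.M.a_group)
    show "f ` carrier M \<subseteq> carrier (add_monoid N)" using f' by simp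
    show "f ` carrier M \<noteq> {}" using M.M.zero_closed by blast
    show "inv\<^bsub>add_monoid N\<^esub> y \<in> f ` carrier M" if y: "y \<in> f ` carrier M" for y
    proof -
      obtain x where x: "x \<in> carrier M" "y = f x" using y by blast
      have "\<ominus>\<^bsub>N\<^esub> y = f (\<ominus>\<^bsub>M\<^esub> x)" using f' x by simp
      then show ?thesis using x(1) by (simp add: a_inv_def[of N, symmetric])
    qed
    show "y \<otimes>\<^bsub>add_monoid N\<^esub> z \<in> f ` carrier M" if yz: "y \<in> f ` carrier M" "z \<in> f ` carrier M" for y z
    proof -
      obtain x x' where x: "x \<in> carrier M" "y = f x" "x' \<in> carrier M" "z = f x'" using yz by blast
      have "y \<oplus>\<^bsub>N\<^esub> z = f (x \<oplus>\<^bsub>M\<^esub> x')" using f' x by simp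
      then show ?thesis using x(1,3) by simp
    qed
    show "r \<odot>\<^bsub>N\<^esub> y \<in> f ` carrier M" if r: "r \<in> carrier R" "y \<in> f ` carrier M" for r y
    proof -
      obtain x where x: "x \<in> carrier M" "y = f x" using r(2) by blast
      have "r \<odot>\<^bsub>N\<^esub> y = f (r \<odot>\<^bsub>M\<^esub> x)" using f' x r(1) by simp
      then show ?thesis using x(1) r(1) M.smult_closed by simp
    qed
  qed
qed

text \<open>\<open>f\<close> is an isomorphism onto its image, and the image is a strong submodel of
  \<open>N'\<close>. Closure under isomorphism and transitivity combine.\<close>

lemma K_embedding_sub:
  assumes ac: "abstract_class R K sub" and f: "K_embedding R K sub f N N'"
    and M: "sub M N" "substructure R M' N'" "carrier M' = f ` carrier M"
  shows "sub M' N'"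
proof -
  let ?P = "N'\<lparr>carrier := f ` carrier N\<rparr>"
  have N: "N \<in> K" "N' \<in> K" and fe: "mod_embedding R f N N'" and P: "sub ?P N'"
    using f unfolding K_embedding_def by simp_all
  have Ps: "substructure R ?P N'" by (rule abstract_class_sub(3)[OF ac P])
  have "mod_isomorphism R f N ?P"
    using fe Ps unfolding mod_isomorphism_def mod_embedding_def substructure_def by auto
  moreover have "carrier M' \<subseteq> f ` carrier N"
    using M(3) abstract_class_sub(3)[OF ac M(1)] unfolding substructure_def by auto
  then have "substructure R M' ?P"
    using M(2) Ps unfolding substructure_def by auto
  ultimately have "sub M' ?P" using abstract_class_iso(2)[OF ac N(1) _ M(1)] M(3) by blast
  then show ?thesis by (rule abstract_class_trans[OF ac _ P])
qed

lemma K_embedding_comp_iso: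
  assumes ac: "abstract_class R K sub" and g: "K_embedding R K sub g M N"
    and e: "mod_isomorphism R e N N'"
  shows "K_embedding R K sub (e \<circ> g) M N'"
proof -
  have K: "M \<in> K" "N \<in> K" and ge: "mod_embedding R g M N"
    and gs: "sub (N\<lparr>carrier := g ` carrier M\<rparr>) N"
    using g unfolding K_embedding_def by simp_all
  have N': "N' \<in> K" by (rule abstract_class_iso(1)[OF ac K(2) e])
  have emb: "mod_embedding R (e \<circ> g) M N'"
    unfolding mod_embedding_def
  proof (intro conjI)
    have im: "g ` carrier M \<subseteq> carrier N" using ge unfolding mod_embedding_def by blast
    then show "(e \<circ> g) ` carrier M \<subseteq> carrier N'"
      using e unfolding mod_isomorphism_def by auto
    have "inj_on e (g ` carrier M)"
      using e im unfolding mod_isomorphism_def mod_embedding_def by (meson inj_on_subset)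
    then show "inj_on (e \<circ> g) (carrier M)"
      using ge unfolding mod_embedding_def by (blast intro: comp_inj_on)
  qed (use ge e in \<open>auto simp: mod_isomorphism_def mod_embedding_def image_subset_iff\<close>)
  have "submodule ((e \<circ> g) ` carrier M) R N'"
    by (rule embedding_submodule[OF abstract_class_module[OF ac K(1)] abstract_class_module[OF ac N'] emb])
  then have "substructure R (N'\<lparr>carrier := (e \<circ> g) ` carrier M\<rparr>) N'"
    by (rule submodule_substructure[OF abstract_class_module[OF ac N']])
  then have "sub (N'\<lparr>carrier := (e \<circ> g) ` carrier M\<rparr>) N'"
    by (rule abstract_class_iso(2)[OF ac K(2) e gs]) auto
  then show ?thesis using K(1) N' emb unfolding K_embedding_def by blast
qed

text \<open>Infinity-AP, applied to the inclusions of \<open>M\<close> into models realizing the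
  types, gives maps that agree on \<open>M\<close> without fixing it. Renaming the amalgam makes
  them the identity on \<open>M\<close>, so the images of the realizations keep their types.\<close>

lemma amalgamate_types:
  fixes R :: "('r, 'm) ring_scheme" and K :: "('r, 'u) module set"
  assumes inacc: "strongly_inaccessible |UNIV :: 'u set|" and ac: "abstract_class R K sub"
    and ap: "infinity_AP R K sub" and M: "M \<in> K" and T: "T \<subseteq> types_over R K sub M"
    and smT: "|T| <o |UNIV :: 'u set|"
  shows "\<exists>N. sub M N \<and> T \<subseteq> types_in R K sub M N"
proof (cases "T = {}")
  case True
  then show ?thesis using abstract_class_refl[OF ac M] by blast
next
  case False
  obtain I :: "'u set" where I: "|T| =o |I|" "small I" using small_copy[OF smT] by blast
  obtain p where p: "bij_betw p I T" using card_of_ordIso ordIso_symmetric[OF I(1)] by blast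
  have pT: "p i \<in> types_over R K sub M" if "i \<in> I" for i
    using that p T unfolding bij_betw_def by blast
  have "\<exists>N c. sub M N \<and> c \<in> carrier N \<and> p i = ortp R K sub c (carrier M) N" if "i \<in> I" for i
    using pT[OF that] unfolding types_over_def types_in_def by blast
  then obtain Ni c where Ni: "\<And>i. i \<in> I \<Longrightarrow> sub M (Ni i)" "\<And>i. i \<in> I \<Longrightarrow> c i \<in> carrier (Ni i)"
      "\<And>i. i \<in> I \<Longrightarrow> p i = ortp R K sub (c i) (carrier M) (Ni i)" by metis
  have emb: "\<forall>i\<in>I. K_embedding R K sub (\<lambda>x. x) M (Ni i)"
    using K_embedding_inclusion[OF ac Ni(1)] by blast
  have "\<exists>N\<in>K. \<exists>g. (\<forall>i\<in>I. K_embedding R K sub (g i) (Ni i) N) \<and>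
      (\<forall>i\<in>I. \<forall>j\<in>I. \<forall>x\<in>carrier M. g i x = g j x)"
    by (rule ap[unfolded infinity_AP_def, THEN spec[of _ I], THEN spec[of _ M], THEN spec[of _ Ni],
          THEN spec[of _ "\<lambda>i x. x"], THEN mp, OF conjI[OF I(2) conjI[OF M emb]]])
  then obtain N g where N: "N \<in> K" and g: "\<And>i. i \<in> I \<Longrightarrow> K_embedding R K sub (g i) (Ni i) N"
      and agree: "\<And>i j x. i \<in> I \<Longrightarrow> j \<in> I \<Longrightarrow> x \<in> carrier M \<Longrightarrow> g i x = g j x"
    by blast
  \<comment> \<open>Any index will do, because the maps \<open>g i\<close> agree on
    \<open>M\<close>.\<close>
  obtain i0 where i0: "i0 \<in> I" using False p unfolding bij_betw_def by blast
  have MN0: "carrier M \<subseteq> carrier (Ni i0)"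
    using abstract_class_sub(3)[OF ac Ni(1)[OF i0]] unfolding substructure_def by blast
  have ge: "mod_embedding R (g i0) (Ni i0) N" using g[OF i0] unfolding K_embedding_def by blast
  have "inj_on (g i0) (carrier M)"
    using ge MN0 unfolding mod_embedding_def by (meson inj_on_subset)
  moreover have "g i0 ` carrier M \<subseteq> carrier N" using ge MN0 unfolding mod_embedding_def by blast
  ultimately obtain e where e: "inj_on e (carrier N)" "\<And>x. x \<in> carrier M \<Longrightarrow> e (g i0 x) = x"
    using extend_to_injection[OF inacc abstract_class_small[OF ac M] abstract_class_small[OF ac N]]
    by blast
  obtain N' :: "('r, 'u) module" where N': "mod_isomorphism R e N N'"
    using module_copy[OF abstract_class_module[OF ac N] e(1)] by blast
  have f: "K_embedding R K sub (e \<circ> g i) (Ni i) N'" if "i \<in> I" for i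
    by (rule K_embedding_comp_iso[OF ac g[OF that] N'])
  have idM: "(e \<circ> g i) x = x" if "i \<in> I" "x \<in> carrier M" for i x
    using agree[OF that(1) i0 that(2)] e(2)[OF that(2)] by simp
  have "substructure R M N'"
  proof -
    have s: "substructure R M (Ni i0)" by (rule abstract_class_sub(3)[OF ac Ni(1)[OF i0]])
    have em: "mod_embedding R (e \<circ> g i0) (Ni i0) N'" using f[OF i0] unfolding K_embedding_def by blast
    interpret M: left_module R M by (rule abstract_class_module[OF ac M])
    note fx = idM[OF i0]
    show ?thesis
      unfolding substructure_def
    proof (intro conjI ballI)
      show "carrier M \<subseteq> carrier N'"
      proof
        fix x assume x: "x \<in> carrier M"
        then have "(e \<circ> g i0) x \<in> carrier N'" using em MN0 unfolding mod_embedding_def by blast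
        then show "x \<in> carrier N'" using fx[OF x] by simp
      qed
      show "\<zero>\<^bsub>M\<^esub> = \<zero>\<^bsub>N'\<^esub>"
        using fx[OF M.M.zero_closed] s em unfolding substructure_def mod_embedding_def by simp
      fix x assume x: "x \<in> carrier M"
      then have x': "x \<in> carrier (Ni i0)" using MN0 by blast
      show "\<ominus>\<^bsub>M\<^esub> x = \<ominus>\<^bsub>N'\<^esub> x"
        using fx[OF M.M.a_inv_closed[OF x]] fx[OF x] s em x x'
        unfolding substructure_def mod_embedding_def by simp
      {
        fix y assume y: "y \<in> carrier M"
        then have y': "y \<in> carrier (Ni i0)" using MN0 by blast
        show "x \<oplus>\<^bsub>M\<^esub> y = x \<oplus>\<^bsub>N'\<^esub> y"
          using fx[OF M.M.a_closed[OF x y]] fx[OF x] fx[OF y] s em x x' y y'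
          unfolding substructure_def mod_embedding_def by simp
      }
    next
      fix r x assume r: "r \<in> carrier R" and x: "x \<in> carrier M"
      then have x': "x \<in> carrier (Ni i0)" using MN0 by blast
      show "r \<odot>\<^bsub>M\<^esub> x = r \<odot>\<^bsub>N'\<^esub> x"
        using fx[OF M.smult_closed[OF r x]] fx[OF x] s em r x x'
        unfolding substructure_def mod_embedding_def by simp
    qed
  qed
  moreover have "carrier M = (e \<circ> g i0) ` carrier M" using idM[OF i0] by force
  ultimately have sub: "sub M N'" by (rule K_embedding_sub[OF ac f[OF i0] Ni(1)[OF i0]])
  have "T \<subseteq> types_in R K sub M N'"
  proof
    fix t assume "t \<in> T"
    then obtain i where i: "i \<in> I" "t = p i" using p unfolding bij_betw_def by blast
    have Mi: "carrier M \<subseteq> carrier (Ni i)"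
      using abstract_class_sub(3)[OF ac Ni(1)[OF i(1)]] unfolding substructure_def by blast
    have "((c i, carrier M, Ni i), ((e \<circ> g i) (c i), carrier M, N')) \<in> E_at R K sub"
      using E_at_embedding[OF ac f[OF i(1)] Ni(2)[OF i(1)] Mi] idM[OF i(1)] by blast
    then have "t = ortp R K sub ((e \<circ> g i) (c i)) (carrier M) N'"
      unfolding i(2) Ni(3)[OF i(1)] by (intro ortp_eqI r_into_trancl)
    moreover have "(e \<circ> g i) (c i) \<in> carrier N'"
      using f[OF i(1)] Ni(2)[OF i(1)] unfolding K_embedding_def mod_embedding_def by blast
    ultimately show "t \<in> types_in R K sub M N'" unfolding types_in_def by blast
  qed
  then show ?thesis using sub by blast
qed

text \<open>All types over \<open>M\<close> might form a large collection, which infinity-AP cannot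
  treat at once. A failure of stability already provides \<open>cardSuc l\<close> many types; these
  are a small set, since \<open>cardSuc l\<close> is at most the power set of \<open>l\<close>, and
  realizing them in one model contradicts almost stability.\<close>

lemma stable_at_if_almost_stable_at:
  fixes R :: "('r, 'm) ring_scheme" and K :: "('r, 'u) module set" and l :: "'u rel"
  assumes inacc: "strongly_inaccessible |UNIV :: 'u set|" and ac: "abstract_class R K sub"
    and ap: "infinity_AP R K sub" and l: "small_card l"
    and st: "almost_stable_at R K sub l"
  shows "stable_at R K sub l"
  unfolding stable_at_def
proof (intro ballI impI, rule ccontr)
  fix M assume M: "M \<in> K" "|carrier M| =o l" and not: "\<not> |types_over R K sub M| \<le>o l"
  have lc: "Card_order l" using l unfolding small_card_def by blast
  have Sc: "Card_order (cardSuc l)" by (rule cardSuc_Card_order[OF lc])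
  have "l <o |types_over R K sub M|"
    using not not_ordLeq_iff_ordLess[OF card_order_on_well_order_on[OF lc] card_of_Well_order] by blast
  then have "cardSuc l \<le>o |types_over R K sub M|"
    by (rule cardSuc_least[OF lc card_of_Card_order])
  then have "|Field (cardSuc l)| \<le>o |types_over R K sub M|"
    by (rule ordIso_ordLeq_trans[OF card_of_Field_ordIso[OF Sc]])
  then obtain T where T: "T \<subseteq> types_over R K sub M" "|Field (cardSuc l)| =o |T|"
    using internalize_card_of_ordLeq[of "Field (cardSuc l)" "|types_over R K sub M|"]
    by (auto simp: Field_card_of)
  have ST: "cardSuc l =o |T|"
    by (rule ordIso_transitive[OF ordIso_symmetric[OF card_of_Field_ordIso[OF Sc]] T(2)])
  have "l <o |Pow (Field l)|"
    by (rule ordIso_ordLess_trans[OF ordIso_symmetric[OF card_of_Field_ordIso[OF lc]] card_of_Pow])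
  then have "cardSuc l \<le>o |Pow (Field l)|" by (rule cardSuc_least[OF lc card_of_Card_order])
  then have "cardSuc l <o |UNIV :: 'u set|"
    by (rule ordLeq_ordLess_trans[OF _ small_Pow[OF inacc small_Field[OF l]]])
  then have "|T| <o |UNIV :: 'u set|" by (rule ordIso_ordLess_trans[OF ordIso_symmetric[OF ST]])
  then obtain N where N: "sub M N" "T \<subseteq> types_in R K sub M N"
    using amalgamate_types[OF inacc ac ap M(1) T(1)] by blast
  have "|types_in R K sub M N| \<le>o l" using st N(1) M(2) unfolding almost_stable_at_def by blast
  then have "|T| \<le>o l" by (rule card_subset_le[OF N(2)])
  then have "cardSuc l \<le>o l" by (rule ordIso_ordLeq_trans[OF ST])
  then show False using cardSuc_greater[OF lc] not_ordLess_ordLeq by blast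
qed

theorem theorem3:
  fixes R :: "('r, 'm) ring_scheme"
    and K :: "('r, 'u) module set"
    and sub :: "('r, 'u) module \<Rightarrow> ('r, 'u) module \<Rightarrow> bool"
    and \<mu> \<kappa> :: "'u rel"
  assumes "strongly_inaccessible |UNIV :: 'u set|"
    and "ring R"
    and "small_card \<mu>" and "Cinfinite \<mu>" and "regularCard \<mu>"
    and "mu_AEC R \<mu> K sub"
    and "small_card \<kappa>" and "Cinfinite \<kappa>"
    and "\<kappa> =o powlt \<kappa> \<mu> +c LS_number R \<mu> K sub"
    and "tame R K sub \<kappa>"
    and "syntactic R K sub \<kappa>"
  shows "(\<exists>\<xi> :: 'u rel. small_card \<xi> \<and> \<kappa> \<le>o \<xi> \<and>
            (\<forall>l :: 'u rel. small_card l \<and> Cinfinite l \<and> l =o l ^c \<xi> \<longrightarrow> almost_stable_at R K sub l)) \<and>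
         AEC_almost_stable R K sub \<and>
         (infinity_AP R K sub \<longrightarrow> AEC_stable R K sub)"
proof -
  have ac: "abstract_class R K sub" using assms(6) unfolding mu_AEC_def by (rule conjunct1)
  note LS = Loewenheim_Skolem_kappa[OF assms(1,3,6-9)]
  obtain \<xi> :: "'u rel" where \<xi>: "small_card \<xi>" "\<kappa> \<le>o \<xi>"
      and st: "\<And>l :: 'u rel. Cinfinite l \<Longrightarrow> l =o l ^c \<xi> \<Longrightarrow> almost_stable_at R K sub l"
    using almost_stable_at_if_syntactic[OF assms(1) ac assms(7,8) LS assms(10,11)] by blast
  have inf\<xi>: "Cinfinite \<xi>" using cinfinite_mono[OF \<xi>(2)] assms(8) \<xi>(1) unfolding small_card_def by blast
  have "AEC_almost_stable R K sub"
    unfolding AEC_almost_stable_def by (rule unboundedly_many_powers[OF assms(1) \<xi>(1) inf\<xi> st])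
  moreover have "AEC_stable R K sub" if "infinity_AP R K sub"
    unfolding AEC_stable_def
    by (rule unboundedly_many_powers[OF assms(1) \<xi>(1) inf\<xi>])
      (rule stable_at_if_almost_stable_at[OF assms(1) ac that _ st])
  ultimately show ?thesis using \<xi> st by blast
qed

end
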